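(* Let $D<-4$ be the discriminant of an imaginary quadratic field with $D\equiv1\pmod4$, and let $N=|D|$, $\chi=\chi_D$, $h=h(D)$. Put $$E_0(4)=\sum_{0<x<\frac N4}\chi(x),\qquad E_1(4)=\sum_{\frac N4<x<\frac N2}\chi(x).$$ Then: - if $N\equiv7\pmod8$: $E_0(4)=h$ and $E_1(4)=0$; - if $N\equiv3\pmod8$: $E_0(4)=0$ and $E_1(4)=3h$.
   Context: Here $D\equiv 1\pmod 4$ is a negative square-free integer, the discriminant of $K=\mathbb{Q}(\sqrt D)$; $h(D)$ is the order of the ideal class group of $K$; and $\chi_D(x)=\left(\frac{x}{N}\right)$ is the Jacobi symbol (equal to $0$ when $\gcd(x,N)>1$). Sums are over integers $x$ with $1\le x\le N$ and $\gcd(x,N)=1$ in the indicated open intervals. *)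

theory Defs
  imports
    "HOL-Number_Theory.Number_Theory"
    "HOL-Computational_Algebra.Computational_Algebra"
    "HOL-Algebra.Coset"
    Complex_Main
begin

definition quadratic_field :: "int \<Rightarrow> complex set" where
  "quadratic_field D = {of_rat a + of_rat b * csqrt (of_int D) | a b. True}"

definition ring_of_integers :: "int \<Rightarrow> complex set" where
  "ring_of_integers D = {x \<in> quadratic_field D. algebraic_int x}"

definition fractional_ideal :: "int \<Rightarrow> complex set \<Rightarrow> bool" where
  "fractional_ideal D I \<longleftrightarrow>
     I \<subseteq> quadratic_field D \<and> 0 \<in> I \<and> I \<noteq> {0} \<and>
     (\<forall>x\<in>I. \<forall>y\<in>I. x + y \<in> I) \<and>
     (\<forall>r\<in>ring_of_integers D. \<forall>x\<in>I. r * x \<in> I) \<and>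
     (\<exists>d\<in>ring_of_integers D. d \<noteq> 0 \<and> (\<forall>x\<in>I. d * x \<in> ring_of_integers D))"

definition ideal_product :: "complex set \<Rightarrow> complex set \<Rightarrow> complex set" where
  "ideal_product I J =
     {\<Sum>i<n. f i * g i | (n :: nat) f g. \<forall>i<n. f i \<in> I \<and> g i \<in> J}"

definition fractional_ideal_group :: "int \<Rightarrow> complex set monoid" where
  "fractional_ideal_group D =
     \<lparr>carrier = {I. fractional_ideal D I}, mult = ideal_product, one = ring_of_integers D\<rparr>"

definition principal_fractional_ideals :: "int \<Rightarrow> complex set set" where
  "principal_fractional_ideals D =
     {(\<lambda>r. a * r) ` ring_of_integers D | a. a \<in> quadratic_field D \<and> a \<noteq> 0}"

definition ideal_class_group :: "int \<Rightarrow> complex set set monoid" where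
  "ideal_class_group D = fractional_ideal_group D Mod principal_fractional_ideals D"

definition class_number :: "int \<Rightarrow> nat" where
  "class_number D = Coset.order (ideal_class_group D)"

(* The second argument is meant to be odd and positive.  The value is 0 when the arguments
   have a common prime factor, because Legendre a p = 0 for p dividing a. *)
definition Jacobi :: "int \<Rightarrow> nat \<Rightarrow> int" where
  "Jacobi a n = (\<Prod>p\<in>#prime_factorization n. Legendre a (int p))"

definition quadratic_character :: "int \<Rightarrow> int \<Rightarrow> int" where
  "quadratic_character D x = Jacobi x (nat \<bar>D\<bar>)"

definition character_sum :: "int \<Rightarrow> real \<Rightarrow> real \<Rightarrow> int" where
  "character_sum D u v =
     (\<Sum>x | 1 \<le> x \<and> x \<le> \<bar>D\<bar> \<and> coprime x \<bar>D\<bar> \<and> u < of_int x \<and> of_int x < v.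
        quadratic_character D x)"

end

theory Submission
  imports Defs "HOL-Analysis.Infinite_Sum" "HOL-Analysis.Elementary_Normed_Spaces"
begin

text \<open>
Write \<open>N = \<bar>D\<bar>\<close>, so that \<open>N\<close> is square-free, \<open>N \<equiv> 3 (mod 4)\<close>, and \<open>\<chi>(x) = (x/N)\<close> is an odd
character modulo \<open>N\<close>. Everything rests on Dirichlet's class number formula in the shape
\<open>N h = - (\<Sum>k<N. k \<chi>(k))\<close>. Given this, splitting the sums by parity and using \<open>\<chi>(N - k) = - \<chi>(k)\<close> and
\<open>\<chi>(2 k) = \<chi>(2) \<chi>(k)\<close> yields \<open>E0 + E1 = (2 - \<chi>(2)) h\<close> and \<open>E0 + E1 = \<chi>(2) (E0 - E1)\<close>
(lemma \<open>chi_quarter_sums\<close>); the theorem is the solution of these two equations for \<open>\<chi>(2) = 1\<close>, which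
is the case \<open>N \<equiv> 7 (mod 8)\<close>, and for \<open>\<chi>(2) = -1\<close>, which is the case \<open>N \<equiv> 3 (mod 8)\<close>.

The class number formula (lemma \<open>class_number_formula\<close>) is obtained by comparing the constant terms
of two expansions at \<open>t \<rightarrow> 0\<close>. The value \<open>L(1,\<chi>)\<close>, which in the usual argument is
evaluated by means of Gauss sums, sits in the singular terms, and these are cancelled before the limit is
taken.

The algebraic side counts fractional ideals \<open>J\<close> that contain \<open>1\<close>, hence the ring of integers, by
their index over it. Such an ideal is \<open>(1/k) (\<int> + \<int> (y + \<omega>)/a)\<close> with \<open>a\<close> dividing
\<open>y\<^sup>2 + y + m\<close>, where \<open>\<omega> = (1 + sqrt D)/2\<close> and \<open>4 m = N + 1\<close>, and its index is \<open>k\<^sup>2 a\<close>. The number of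
those of index \<open>n\<close> is therefore a Dirichlet convolution of root counts of \<open>y\<^sup>2 + y + m\<close> with the indicator
of the squares. By quadratic reciprocity and lifting of roots this multiplicative function agrees with
\<open>\<Sum>d dvd n. \<chi>(d)\<close> on prime powers, hence everywhere (theorem \<open>divisor_sum_eq_root_sum\<close>). On the other
hand, if \<open>L\<close> is an ideal containing \<open>1\<close>, the ideals of its class that contain \<open>1\<close> are the
\<open>L / x\<close> with \<open>x\<close> in \<open>L\<close> nonzero, each arising from exactly the two elements \<open>x\<close> and \<open>-x\<close>, and the index is
the value at \<open>x\<close> of a positive definite binary form of discriminant \<open>-N\<close> (lemma \<open>card_representations\<close>).
Summing over the classes gives, with \<open>\<theta>\<^sub>C\<close> the theta series of the form belonging to the class \<open>C\<close>,
\<open>(\<Sum>C. \<theta>\<^sub>C(t)) = h + 2 A(t)\<close> with \<open>A(t) = (\<Sum>n\<ge>1. (\<Sum>d dvd n. \<chi>(d)) exp(-n t)) = (\<Sum>d\<ge>1. \<chi>(d)/(exp(d t) - 1))\<close>.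

The analytic side evaluates \<open>F(4 t) * 4 - F(t)\<close> for both sides as \<open>t \<rightarrow> 0\<close>. This operation annihilates
multiples of \<open>1/t\<close>. A theta series is such a multiple up to \<open>o(1)\<close>, because a sum
\<open>\<Sum>x\<in>\<int>. exp(-s (x + \<alpha>)\<^sup>2)\<close> depends on \<open>\<alpha>\<close> only up to \<open>O(s)\<close>; so the left hand side tends to \<open>0\<close>
(lemma \<open>theta_limit\<close>). On the right, \<open>A(t) - 4 A(4 t)\<close> is a sum of \<open>\<chi>(d)\<close> against the convex bounded
function \<open>g(u) + 2 g(2 u)\<close>, \<open>g(u) = 1/(exp u + 1)\<close>, at \<open>u = d t\<close>, and two summations by parts show that it
tends to \<open>3/2\<close> times the mean of the partial sums of \<open>\<chi>\<close> (lemma \<open>lambert_limit\<close>). That mean is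
\<open>-(1/N) (\<Sum>k<N. k \<chi>(k))\<close>, and \<open>3 h\<close> equals three times it.
\<close>

section \<open>The Jacobi symbol\<close>

lemma Legendre_values: "Legendre a p \<in> {-1, 0, 1}"
  by (simp add: Legendre_def)

lemma Legendre_cong:
  assumes "[a = b] (mod p)"
  shows "Legendre a p = Legendre b p"
proof -
  have "[a = 0] (mod p) \<longleftrightarrow> [b = 0] (mod p)"
    using assms cong_sym cong_trans by blast
  moreover have "QuadRes p a \<longleftrightarrow> QuadRes p b"
    unfolding QuadRes_def using assms cong_sym cong_trans by blast
  ultimately show ?thesis by (simp add: Legendre_def)
qed

lemma small_cong_imp_eq:
  fixes p :: nat and x y :: int
  assumes "2 < p" "x \<in> {-1, 0, 1}" "y \<in> {-1, 0, 1}" "[x = y] (mod int p)"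
  shows "x = y"
proof -
  have d: "int p dvd x - y" using assms(4) by (simp add: cong_iff_dvd_diff)
  have "\<bar>x - y\<bar> < int p" using assms(1-3) by auto
  with d show ?thesis using zdvd_imp_le[of "int p" "\<bar>x - y\<bar>"] by fastforce
qed

lemma Legendre_mult:
  assumes "prime p" "2 < p"
  shows "Legendre (a*b) (int p) = Legendre a (int p) * Legendre b (int p)"
proof (rule small_cong_imp_eq[OF assms(2)])
  let ?e = "(p - 1) div 2"
  have "[Legendre a p * Legendre b p = a ^ ?e * b ^ ?e] (mod int p)"
    by (intro cong_mult euler_criterion assms)
  moreover have "[Legendre (a*b) p = (a*b) ^ ?e] (mod int p)"
    by (intro euler_criterion assms)
  ultimately show "[Legendre (a*b) (int p) = Legendre a (int p) * Legendre b (int p)] (mod int p)"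
    using cong_sym cong_trans by (metis power_mult_distrib)
  show "Legendre a (int p) * Legendre b (int p) \<in> {-1, 0, 1}"
    using Legendre_values[of a p] Legendre_values[of b p] by auto
qed (rule Legendre_values)

lemma Legendre_minus_one:
  assumes "prime p" "2 < p"
  shows "Legendre (-1) (int p) = (-1) ^ ((p - 1) div 2)"
  by (rule small_cong_imp_eq[OF assms(2)])
     (use euler_criterion[OF assms, of "-1"] Legendre_values in \<open>auto simp: minus_one_power_iff\<close>)

text \<open>Gauss's lemma for the multiplier \<open>2\<close>: among \<open>2, 4, \<dots>, p - 1\<close> the elements exceeding \<open>r = (p - 1)/2\<close> are
the doubles of the numbers in \<open>{r div 2<..r}\<close>, and the parity of their number is read off from \<open>p mod 8\<close>.\<close>

lemma Legendre_two:
  assumes "prime p" "2 < p"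
  shows "Legendre 2 (int p) = (if p mod 8 = 1 \<or> p mod 8 = 7 then 1 else -1)"
proof -
  have "odd p" using assms prime_odd_nat by blast
  have ncong: "[2 \<noteq> (0::int)] (mod int p)"
    using assms(2) by (auto simp: cong_0_iff dest: zdvd_imp_le)
  interpret G: GAUSS p 2
    by unfold_locales (use assms ncong in auto)
  define r where "r = (int p - 1) div 2"
  have p: "int p = 2 * r + 1" using \<open>odd p\<close> unfolding r_def by presburger
  have C: "G.C = (\<lambda>x. x * 2) ` {0<..r}"
    unfolding G.C_def G.B_def G.A_def image_image r_def[symmetric]
    by (rule image_cong) (auto simp: p)
  have E: "G.E = (\<lambda>x. x * 2) ` {r div 2<..r}"
    unfolding G.E_def C r_def[symmetric]
  proof (intro equalityI subsetI)
    fix z assume "z \<in> (\<lambda>x. x * 2) ` {0<..r} \<inter> {r<..}"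
    thus "z \<in> (\<lambda>x. x * 2) ` {r div 2<..r}" by (auto intro!: imageI)
  next
    fix z assume "z \<in> (\<lambda>x. x * 2) ` {r div 2<..r}"
    then obtain x where x: "z = x * 2" "r div 2 < x" "x \<le> r" by auto
    have "r \<ge> 0" using p assms(2) by linarith
    hence "0 < x" "r < x * 2" using x(2) by linarith+
    thus "z \<in> (\<lambda>x. x * 2) ` {0<..r} \<inter> {r<..}" using x by auto
  qed
  have "card G.E = nat (r - r div 2)"
    unfolding E by (subst card_image) (auto simp: inj_on_def)
  moreover have "even (nat (r - r div 2)) \<longleftrightarrow> p mod 8 = 1 \<or> p mod 8 = 7"
  proof -
    have "r \<ge> 0" using p assms(2) by linarith
    hence "int (nat (r - r div 2)) = r - r div 2" by simp
    hence "even (nat (r - r div 2)) \<longleftrightarrow> even (r - r div 2)" by presburger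
    also have "\<dots> \<longleftrightarrow> int p mod 8 = 1 \<or> int p mod 8 = 7" unfolding p by presburger
    also have "int p mod 8 = int (p mod 8)" by (simp add: zmod_int)
    also have "int (p mod 8) = 1 \<or> int (p mod 8) = 7 \<longleftrightarrow> p mod 8 = 1 \<or> p mod 8 = 7" by linarith
    finally show ?thesis .
  qed
  ultimately show ?thesis using G.gauss_lemma by (auto simp: minus_one_power_iff)
qed

lemma Jacobi_1 [simp]: "Jacobi a 1 = 1" "Jacobi a (Suc 0) = 1"
  by (simp_all add: Jacobi_def)

lemma Jacobi_prime_mult:
  assumes "prime q" "n > 0"
  shows "Jacobi a (q * n) = Legendre a (int q) * Jacobi a n"
  using assms by (simp add: Jacobi_def prime_factorization_mult prime_factorization_prime)

text \<open>The Jacobi symbol is a product over prime factors, so its laws for odd moduli propagate from the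
Legendre symbol one prime at a time.\<close>

lemma odd_nat_induct [consumes 1, case_names one mult]:
  assumes "odd (n::nat)"
    and "P 1"
    and "\<And>q n. prime q \<Longrightarrow> 2 < q \<Longrightarrow> odd n \<Longrightarrow> P n \<Longrightarrow> P (q * n)"
  shows "P n"
  using assms(1)
proof (induction n rule: less_induct)
  case (less n)
  show ?case
  proof (cases "n = 1")
    case True thus ?thesis using assms(2) by simp
  next
    case False
    then obtain q where q: "prime q" "q dvd n" using prime_factor_nat by blast
    then obtain k where k: "n = q * k" by (elim dvdE)
    have "odd q" "odd k" using less.prems k by auto
    have "2 < q" using q(1) \<open>odd q\<close> prime_gt_1_nat[of q] by (cases "q = 2") auto
    have "k > 0" using \<open>odd k\<close> odd_pos by blast
    hence "k < n" using k \<open>2 < q\<close> by simp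
    show ?thesis unfolding k
      by (rule assms(3)) (use q(1) \<open>2 < q\<close> \<open>odd k\<close> less.IH \<open>k < n\<close> in auto)
  qed
qed

lemma Jacobi_values: "Jacobi a n \<in> {-1, 0, 1}"
proof -
  have "(\<Prod>p\<in>#A. Legendre a (int p)) \<in> {-1, 0, 1}" for A
  proof (induction A)
    case (add x A)
    thus ?case using Legendre_values[of a x] by auto
  qed auto
  thus ?thesis by (simp add: Jacobi_def)
qed

lemma Jacobi_cong:
  assumes "[a = b] (mod int n)"
  shows "Jacobi a n = Jacobi b n"
proof (cases "n = 0")
  case False
  have "Legendre a (int p) = Legendre b (int p)" if "p \<in># prime_factorization n" for p
  proof (rule Legendre_cong)
    have "int p dvd int n" using that by auto
    thus "[a = b] (mod int p)" using assms cong_dvd_modulus by blast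
  qed
  thus ?thesis unfolding Jacobi_def by (simp cong: image_mset_cong)
qed (auto simp: Jacobi_def)

lemma Jacobi_mult: "odd n \<Longrightarrow> Jacobi (a * b) n = Jacobi a n * Jacobi b n"
  by (induction n rule: odd_nat_induct)
     (auto simp: Jacobi_prime_mult Legendre_mult odd_pos)

lemma Jacobi_one_left: "Jacobi 1 n = 1"
proof -
  have "Legendre 1 (int p) = 1" if "prime p" for p
    using that prime_gt_1_nat[of p] by (auto simp: Legendre_def QuadRes_def cong_0_iff intro!: exI[of _ 1])
  thus ?thesis unfolding Jacobi_def
    by (intro prod_mset.neutral) (auto simp: in_prime_factors_iff)
qed

lemma Jacobi_eq_0:
  assumes "\<not> coprime a (int n)" "n > 0"
  shows "Jacobi a n = 0"
proof -
  have "gcd (nat \<bar>a\<bar>) n \<noteq> 1" using assms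
    by (metis coprime_iff_gcd_eq_1 gcd_int_int_eq gcd_abs1_int int_nat_eq abs_ge_zero of_nat_1)
  then obtain q where q: "prime q" "q dvd gcd (nat \<bar>a\<bar>) n"
    using prime_factor_nat by blast
  hence "q dvd n" "q dvd nat \<bar>a\<bar>" using gcd_greatest_iff dvd_trans by blast+
  have "int q dvd int (nat \<bar>a\<bar>)" using \<open>q dvd nat \<bar>a\<bar>\<close> by (simp only: int_dvd_int_iff)
  hence "int q dvd a" by simp
  from \<open>q dvd n\<close> obtain k where k: "n = q * k" by (elim dvdE)
  have "Legendre a (int q) = 0" using \<open>int q dvd a\<close> by (simp add: Legendre_def cong_0_iff)
  thus ?thesis using k q(1) assms(2) by (simp add: Jacobi_prime_mult)
qed

lemma Jacobi_minus_one:
  assumes "odd n"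
  shows "Jacobi (-1) n = (if n mod 4 = 1 then 1 else -1)"
  using assms
proof (induction n rule: odd_nat_induct)
  case (mult q n)
  have "odd q" using mult prime_odd_nat by blast
  have "even ((q - 1) div 2) \<longleftrightarrow> q mod 4 = 1" using \<open>odd q\<close> by presburger
  hence *: "Legendre (-1) (int q) = (if q mod 4 = 1 then 1 else -1)"
    using Legendre_minus_one[OF mult(1,2)] by (simp add: minus_one_power_iff)
  have "q mod 4 = 1 \<or> q mod 4 = 3" "n mod 4 = 1 \<or> n mod 4 = 3"
    using \<open>odd q\<close> \<open>odd n\<close> by presburger+
  hence "(q * n) mod 4 = 1 \<longleftrightarrow> (q mod 4 = 1 \<longleftrightarrow> n mod 4 = 1)"
    by (auto simp: mod_mult_eq[of q 4 n, symmetric])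
  thus ?case using mult * by (auto simp: Jacobi_prime_mult odd_pos)
qed auto

lemma Jacobi_two:
  assumes "odd n"
  shows "Jacobi 2 n = (if n mod 8 = 1 \<or> n mod 8 = 7 then 1 else -1)"
  using assms
proof (induction n rule: odd_nat_induct)
  case (mult q n)
  have "odd q" using mult prime_odd_nat by blast
  have "q mod 8 = 1 \<or> q mod 8 = 3 \<or> q mod 8 = 5 \<or> q mod 8 = 7"
       "n mod 8 = 1 \<or> n mod 8 = 3 \<or> n mod 8 = 5 \<or> n mod 8 = 7"
    using \<open>odd q\<close> \<open>odd n\<close> by presburger+
  hence "((q * n) mod 8 = 1 \<or> (q * n) mod 8 = 7) \<longleftrightarrow> ((q mod 8 = 1 \<or> q mod 8 = 7) \<longleftrightarrow> (n mod 8 = 1 \<or> n mod 8 = 7))"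
    by (auto simp: mod_mult_eq[of q 8 n, symmetric])
  thus ?case using mult Legendre_two[OF mult(1,2)] by (auto simp: Jacobi_prime_mult odd_pos)
qed auto

text \<open>This relates \<open>\<chi>(p)\<close> to the splitting of \<open>p\<close> in the quadratic field. The sign is \<open>-1\<close> exactly if both \<open>p\<close> and \<open>n\<close> are \<open>3\<close> modulo \<open>4\<close>; this condition is multiplicative in \<open>n\<close>.\<close>

lemma Jacobi_reciprocity:
  assumes "odd n" "prime p" "2 < p" "\<not> p dvd n"
  shows "Jacobi (int p) n = Legendre (int n) (int p) * (if p mod 4 = 1 \<or> n mod 4 = 1 then 1 else -1)"
  using assms(1,4)
proof (induction n rule: odd_nat_induct)
  case one
  have "Legendre 1 (int p) = 1"
    using assms by (auto simp: Legendre_def QuadRes_def cong_0_iff intro!: exI[of _ 1])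
  thus ?case by simp
next
  case (mult q n)
  have "odd q" using mult prime_odd_nat by blast
  have "odd p" using assms prime_odd_nat by blast
  have "p \<noteq> q" using mult.prems by auto
  have qr: "Legendre p q * Legendre q p = (-1::int) ^ ((p - 1) div 2 * ((q - 1) div 2))"
    by (rule Quadratic_Reciprocity) (use assms mult \<open>p \<noteq> q\<close> in auto)
  have half: "even ((k - 1) div 2) \<longleftrightarrow> k mod 4 = 1" if "odd k" for k :: nat
    using that by presburger
  have qr': "Legendre p q * Legendre q p = (if p mod 4 = 1 \<or> q mod 4 = 1 then 1 else -1)"
    using qr half[OF \<open>odd q\<close>] half[OF \<open>odd p\<close>] by (simp add: minus_one_power_iff)
  have sq: "Legendre p q = Legendre q p * (if p mod 4 = 1 \<or> q mod 4 = 1 then 1 else -1)"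
  proof -
    have "x = y * e" if "x * y = e" "x \<in> {-1, 0, 1}" "y \<in> {-1, 0, 1}" "e \<in> {1, -1}" for x y e :: int
      using that by auto
    from this[OF qr' Legendre_values Legendre_values] show ?thesis by simp
  qed
  have odd4: "k mod 4 = 1 \<or> k mod 4 = 3" if "odd k" for k :: nat
    using that by presburger
  from odd4[OF \<open>odd q\<close>] odd4[OF \<open>odd n\<close>] have md: "(q * n) mod 4 = 1 \<longleftrightarrow> (q mod 4 = 1 \<longleftrightarrow> n mod 4 = 1)"
    by (auto simp: mod_mult_eq[of q 4 n, symmetric])
  have ndvd: "\<not> p dvd n" using mult.prems dvd_mult[of p n q] by blast
  have "n > 0" using \<open>odd n\<close> by (rule odd_pos)
  have 1: "Jacobi (int p) (q * n) = Legendre p q * Jacobi (int p) n"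
    by (rule Jacobi_prime_mult) fact+
  have 2: "Legendre (int (q * n)) (int p) = Legendre (int q) (int p) * Legendre (int n) (int p)"
    unfolding of_nat_mult by (rule Legendre_mult) fact+
  show ?case unfolding 1 2 sq mult.IH[OF ndvd] md by auto
qed

section \<open>Roots of a quadratic polynomial modulo n\<close>

lemma root_poly_cong: "[y = z] (mod a) \<Longrightarrow> a dvd y^2 + y + m \<longleftrightarrow> a dvd z^2 + z + (m::int)"
  by (intro cong_dvd_iff cong_add cong_pow cong_refl)

definition root_count :: "int \<Rightarrow> nat \<Rightarrow> nat" where
  "root_count m a = card {y \<in> {0..<int a}. int a dvd y^2 + y + m}"

lemma finite_roots [simp]: "finite {y \<in> {0..<int a}. int a dvd y^2 + y + m}"
  by (rule finite_subset[of _ "{0..<int a}"]) auto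

lemma root_count_1 [simp]: "root_count m 1 = 1" "root_count m (Suc 0) = 1"
proof -
  have "{y \<in> {0..<int 1}. int 1 dvd y^2 + y + m} = {0}" by auto
  thus "root_count m 1 = 1" by (simp add: root_count_def)
  thus "root_count m (Suc 0) = 1" by simp
qed

text \<open>The Chinese remainder theorem.\<close>

lemma root_count_mult:
  assumes "coprime a b" "a > 0" "b > 0"
  shows "root_count m (a * b) = root_count m a * root_count m b"
proof -
  let ?R = "\<lambda>a. {y \<in> {0..<int a}. int a dvd y^2 + y + m}"
  have cop: "coprime (int a) (int b)" using assms by simp
  have "bij_betw (\<lambda>y. (y mod int a, y mod int b)) (?R (a * b)) (?R a \<times> ?R b)"
    unfolding bij_betw_def
  proof (intro conjI inj_onI equalityI subsetI)
    fix x y assume x: "x \<in> ?R (a * b)" and y: "y \<in> ?R (a * b)"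
      and eq: "(x mod int a, x mod int b) = (y mod int a, y mod int b)"
    have "[x = y] (mod int a * int b)"
      by (rule coprime_cong_mult) (use eq cop in \<open>auto simp: cong_def\<close>)
    thus "x = y" using x y by (auto simp: cong_def)
  next
    fix z assume "z \<in> (\<lambda>y. (y mod int a, y mod int b)) ` ?R (a * b)"
    then obtain y where y: "y \<in> ?R (a * b)" "z = (y mod int a, y mod int b)" by blast
    have "int a dvd y^2 + y + m" "int b dvd y^2 + y + m"
      using y(1) by (auto intro: dvd_mult_left dvd_mult_right)
    thus "z \<in> ?R a \<times> ?R b"
      using assms root_poly_cong[of "y mod int a" y "int a" m] root_poly_cong[of "y mod int b" y "int b" m]
      by (auto simp: y(2))
  next
    fix z assume z: "z \<in> ?R a \<times> ?R b"
    obtain u v where uv: "z = (u, v)" by (cases z)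
    obtain x where x: "[x = u] (mod int a)" "[x = v] (mod int b)"
      using binary_chinese_remainder_int[OF cop] by blast
    define y where "y = x mod (int a * int b)"
    have yx: "[y = x] (mod int a * int b)" by (simp add: y_def cong_def)
    have y: "[y = u] (mod int a)" "[y = v] (mod int b)"
      using yx x cong_modulus_mult cong_trans by (blast, metis cong_trans cong_modulus_mult mult.commute)
    have "int a dvd y^2 + y + m" "int b dvd y^2 + y + m"
      using z root_poly_cong[OF y(1)] root_poly_cong[OF y(2)] by (auto simp: uv)
    hence "int a * int b dvd y^2 + y + m" using cop by (simp add: divides_mult)
    hence "y \<in> ?R (a * b)" using assms by (simp add: y_def)
    moreover have "z = (y mod int a, y mod int b)" using y z by (auto simp: uv cong_def)
    ultimately show "z \<in> (\<lambda>y. (y mod int a, y mod int b)) ` ?R (a * b)" by blast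
  qed
  from bij_betw_same_card[OF this] show ?thesis
    by (simp add: root_count_def card_cartesian_product)
qed

text \<open>Completing the square; \<open>-N\<close> is the discriminant of the polynomial \<open>y\<^sup>2 + y + m\<close>.\<close>

lemma root_disc: "4 * m = N + 1 \<Longrightarrow> (2*y+1)^2 = 4 * (y^2 + y + m) - (N::int)"
  by (simp add: power2_eq_square algebra_simps)

lemma odd_prime_dvd_root_iff:
  assumes "4 * m = N + 1" "prime p" "odd p"
  shows "int p dvd y^2 + y + m \<longleftrightarrow> int p dvd (2*y+1)^2 + N"
proof -
  have cop: "coprime (int p) 4"
    using assms(3) by (metis coprime_right_2_iff_odd coprime_mult_right_iff even_of_nat mult_2 numeral_Bit0)
  have "int p dvd y^2 + y + m \<longleftrightarrow> int p dvd 4 * (y^2 + y + m)"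
    by (simp only: coprime_dvd_mult_right_iff[OF cop])
  also have "4 * (y^2 + y + m) = (2*y+1)^2 + N" using root_disc[OF assms(1), of y] by simp
  finally show ?thesis .
qed

text \<open>Here \<open>2 y + 1\<close> is the derivative of the polynomial at its root \<open>y\<close>; a double root would force
\<open>p\<close> to divide the discriminant.\<close>

lemma unramified_root_simple:
  assumes "4 * m = N + 1" "\<not> int p dvd N" "int p dvd y^2 + y + m"
  shows "\<not> int p dvd 2 * y + 1"
proof
  assume "int p dvd 2 * y + 1"
  hence "int p dvd (2*y+1)^2" by (simp add: power2_eq_square)
  moreover have "int p dvd 4 * (y^2 + y + m)" using assms(3) by (rule dvd_mult)
  ultimately have "int p dvd 4 * (y^2 + y + m) - (2*y+1)^2" by (rule dvd_diff[rotated])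
  thus False using assms(2) root_disc[OF assms(1), of y] by simp
qed

lemma root_count_ramified:
  assumes "4 * m = N + 1" "prime p" "odd p" "int p dvd N"
  shows "root_count m p = 1"
proof -
  have pint: "prime (int p)" using assms by simp
  have iff: "int p dvd y^2 + y + m \<longleftrightarrow> int p dvd 2*y+1" for y
    unfolding odd_prime_dvd_root_iff[OF assms(1-3)] dvd_add_left_iff[OF assms(4)]
    using pint by (simp add: prime_dvd_power_iff)
  have "{y \<in> {0..<int p}. int p dvd y^2 + y + m} = {(int p - 1) div 2}"
  proof (intro equalityI subsetI)
    fix y assume "y \<in> {y \<in> {0..<int p}. int p dvd y^2 + y + m}"
    hence y: "0 \<le> y" "y < int p" "int p dvd 2*y+1" by (auto simp: iff)
    then obtain c where c: "2*y+1 = int p * c" by (elim dvdE)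
    have "int p * c > 0" using y c by linarith
    hence "c > 0" by (simp add: zero_less_mult_iff)
    have "int p * c < int p * 2" using c y by linarith
    moreover have "int p > 0" using assms(2) prime_gt_0_nat by simp
    ultimately have "c < 2" using mult_less_cancel_left_pos by blast
    with \<open>c > 0\<close> have "c = 1" by simp
    thus "y \<in> {(int p - 1) div 2}" using c by simp
  next
    fix y assume "y \<in> {(int p - 1) div 2}"
    hence "2 * y + 1 = int p" using assms(3) by simp
    moreover have "int p > 0" using assms prime_gt_0_nat by simp
    ultimately show "y \<in> {y \<in> {0..<int p}. int p dvd y^2 + y + m}" unfolding mem_Collect_eq iff by auto
  qed
  thus ?thesis by (simp add: root_count_def)
qed

text \<open>A root modulo \<open>p\<^sup>2\<close> would make both \<open>2 y + 1\<close> divisible by \<open>p\<close> and \<open>N\<close> divisible by \<open>p\<^sup>2\<close>.\<close>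

lemma root_count_ramified_power:
  assumes "4 * m = N + 1" "prime p" "int p dvd N" "\<not> (int p)^2 dvd N" "k \<ge> 2"
  shows "root_count m (p ^ k) = 0"
proof -
  have pint: "prime (int p)" using assms by simp
  have False if "int (p^k) dvd y^2 + y + m" for y
  proof -
    have "int p ^ 2 dvd int p ^ k" using assms(5) by (rule le_imp_power_dvd)
    hence "int p ^ 2 dvd y^2 + y + m" using that dvd_trans by (metis of_nat_power)
    hence p2: "int p ^ 2 dvd 4 * (y^2 + y + m)" by (rule dvd_mult)
    have "int p dvd int p ^ 2" by (simp add: power2_eq_square)
    hence "int p dvd 4 * (y^2 + y + m)" using p2 by (rule dvd_trans)
    hence "int p dvd (2*y+1)^2" unfolding root_disc[OF assms(1)] using assms(3) by simp
    hence "int p dvd 2*y+1" using pint by (simp add: prime_dvd_power_iff)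
    hence "int p ^ 2 dvd (2*y+1)^2" by (simp add: dvd_power_same)
    hence "int p ^ 2 dvd 4 * (y^2 + y + m) - (2*y+1)^2" using p2 by (rule dvd_diff[rotated])
    thus False using assms(4) root_disc[OF assms(1), of y] by simp
  qed
  hence "{y \<in> {0..<int (p^k)}. int (p^k) dvd y^2 + y + m} = {}" by blast
  thus ?thesis by (simp only: root_count_def card.empty)
qed

text \<open>One step of Hensel lifting replaces \<open>y\<close> by \<open>y - p\<^sup>k c x\<close>, where \<open>p\<^sup>k c\<close> is the value at \<open>y\<close> and \<open>x\<close> inverts the
derivative \<open>2 y + 1\<close> modulo \<open>p\<close>.\<close>

lemma root_lift:
  assumes "4 * m = N + 1" "prime p" "\<not> int p dvd N" "int p dvd y0^2 + y0 + m" "k \<ge> 1"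
  shows "\<exists>y. int p ^ k dvd y^2 + y + m"
  using assms(5)
proof (induction k rule: dec_induct)
  case base
  show ?case using assms(4) by auto
next
  case (step k)
  have pint: "prime (int p)" using assms by simp
  from step.IH obtain y c where y: "y^2 + y + m = int p ^ k * c" by (auto elim: dvdE)
  have "int p dvd y^2 + y + m" using step.hyps by (simp add: y dvd_mult2 dvd_power)
  have "\<not> int p dvd 2 * y + 1" by (rule unramified_root_simple) fact+
  hence "coprime (2*y+1) (int p)" using pint prime_imp_coprime coprime_commute by blast
  then obtain x where "[(2*y+1) * x = 1] (mod int p)" using cong_solve_coprime_int by blast
  hence x: "int p dvd (2*y+1) * x - 1" by (simp add: cong_iff_dvd_diff)
  define z where "z = y + int p ^ k * (- c * x)"
  have "z^2 + z + m = (y^2 + y + m) + int p ^ k * (- c * x) * (2 * y + 1) + (int p ^ k)^2 * (c*x)^2"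
    unfolding z_def by (simp add: power2_eq_square algebra_simps)
  also have "\<dots> = int p ^ k * (- c * ((2*y+1) * x - 1)) + (int p ^ k * int p ^ k) * (c*x)^2"
    unfolding y by (simp add: power2_eq_square algebra_simps)
  finally have eq: "z^2 + z + m = \<dots>" .
  have "int p ^ Suc k dvd int p ^ k * (- c * ((2*y+1) * x - 1))"
    using x by (simp add: mult.commute[of "int p"])
  moreover have "int p dvd int p ^ k" using step.hyps by (simp add: dvd_power)
  hence "int p ^ Suc k dvd int p ^ k * int p ^ k" by (auto simp: mult.commute[of "int p"] intro: mult_dvd_mono)
  hence "int p ^ Suc k dvd (int p ^ k * int p ^ k) * (c*x)^2" by (rule dvd_mult2)
  ultimately show ?case unfolding eq[symmetric] by (metis dvd_add eq)
qed

text \<open>If \<open>y\<close> is a root, so is \<open>-1 - y\<close>, and these differ because the derivative is a unit. There is no third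
root: \<open>(z - y) (z + y + 1)\<close> is divisible by the prime power, and \<open>p\<close> cannot divide both factors since it
does not divide their difference.\<close>

lemma root_count_unramified:
  assumes "4 * m = N + 1" "prime p" "\<not> int p dvd N" "k \<ge> 1"
  shows "root_count m (p ^ k) = (if \<exists>y. int p dvd y^2 + y + m then 2 else 0)"
proof (cases "\<exists>y. int p dvd y^2 + y + m")
  case False
  have "int p dvd int (p^k)" using assms(4) by (simp add: dvd_power)
  hence "{y \<in> {0..<int (p^k)}. int (p^k) dvd y^2 + y + m} = {}" using False dvd_trans by blast
  thus ?thesis using False by (simp only: root_count_def card.empty if_False)
next
  case True
  have pint: "prime (int p)" using assms by simp
  let ?q = "int (p^k)"
  have q0: "?q > 0" using assms(2) prime_gt_0_nat by simp
  have pq: "int p dvd ?q" using assms(4) by (simp add: dvd_power)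
  from True root_lift[OF assms(1-3) _ assms(4)] obtain y' where y': "?q dvd y'^2 + y' + m" by auto
  define y where "y = y' mod ?q"
  have y: "?q dvd y^2 + y + m" using y' root_poly_cong[of y y' ?q m] by (simp add: y_def)
  have "int p dvd y^2 + y + m" using pq y by (rule dvd_trans)
  with assms(1,3) have nd: "\<not> int p dvd 2 * y + 1" by (rule unramified_root_simple)
  \<comment> \<open>The conjugate root.\<close>
  define y2 where "y2 = (-1 - y) mod ?q"
  have y2: "?q dvd y2^2 + y2 + m"
  proof -
    have "(-1-y)^2 + (-1-y) + m = y^2 + y + m" by (simp add: power2_eq_square algebra_simps)
    hence "?q dvd (-1-y)^2 + (-1-y) + m" using y by (simp only:)
    thus ?thesis using root_poly_cong[of y2 "-1-y" ?q m] by (simp add: y2_def)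
  qed
  have "y \<noteq> y2"
  proof
    assume "y = y2"
    hence "[y = -1 - y] (mod ?q)" by (simp add: y2_def cong_def y_def)
    hence "?q dvd 2 * y + 1" by (simp add: cong_iff_dvd_diff)
    thus False using nd pq dvd_trans by blast
  qed
  have "{y \<in> {0..<?q}. ?q dvd y^2 + y + m} = {y, y2}"
  proof (intro equalityI subsetI)
    fix z assume "z \<in> {y \<in> {0..<?q}. ?q dvd y^2 + y + m}"
    hence z: "0 \<le> z" "z < ?q" "?q dvd z^2 + z + m" by auto
    have "(z - y) * (z + y + 1) = (z^2 + z + m) - (y^2 + y + m)"
      by (simp add: power2_eq_square algebra_simps)
    have dv: "?q dvd (z - y) * (z + y + 1)" unfolding \<open>(z - y) * (z + y + 1) = _\<close> using z(3) y by (rule dvd_diff)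
    have "\<not> int p dvd z - y \<or> \<not> int p dvd z + y + 1"
    proof (rule ccontr)
      assume "\<not> ?thesis"
      hence "int p dvd (z + y + 1) - (z - y)" using dvd_diff by blast
      thus False using nd by (simp add: algebra_simps)
    qed
    hence "coprime ?q (z - y) \<or> coprime ?q (z + y + 1)"
      using prime_imp_coprime[OF pint] by auto
    hence "?q dvd z + y + 1 \<or> ?q dvd z - y"
      using dv by (metis coprime_dvd_mult_right_iff coprime_dvd_mult_left_iff)
    hence "[z = -1 - y] (mod ?q) \<or> [z = y] (mod ?q)" by (simp add: cong_iff_dvd_diff algebra_simps)
    hence "z = y2 \<or> z = y" using z by (auto simp: cong_def y2_def y_def)
    thus "z \<in> {y, y2}" by auto
  next
    fix z assume "z \<in> {y, y2}"
    thus "z \<in> {y \<in> {0..<?q}. ?q dvd y^2 + y + m}"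
      using y y2 q0 by (auto simp: y_def y2_def simp del: of_nat_power)
  qed
  thus ?thesis using True \<open>y \<noteq> y2\<close> by (simp add: root_count_def)
qed

lemma root_exists_iff_Legendre:
  assumes "4 * m = N + 1" "prime p" "odd p" "\<not> int p dvd N"
  shows "(\<exists>y. int p dvd y^2 + y + m) \<longleftrightarrow> Legendre (-N) (int p) = 1"
proof -
  have iff: "int p dvd y^2 + y + m \<longleftrightarrow> [(2*y+1)^2 = -N] (mod int p)" for y
    unfolding odd_prime_dvd_root_iff[OF assms(1-3)] by (simp add: cong_iff_dvd_diff)
  have "(\<exists>y. int p dvd y^2 + y + m) \<longleftrightarrow> QuadRes (int p) (-N)"
  proof
    assume "\<exists>y. int p dvd y^2 + y + m"
    thus "QuadRes (int p) (-N)" unfolding iff QuadRes_def by blast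
  next
    assume "QuadRes (int p) (-N)"
    then obtain x where x: "[x^2 = -N] (mod int p)" unfolding QuadRes_def by blast
    define x' where "x' = (if odd x then x else x + int p)"
    have "odd x'" using assms(3) by (simp add: x'_def)
    then obtain y where y: "x' = 2 * y + 1" by (elim oddE)
    have "[x' = x] (mod int p)" by (simp add: x'_def cong_def)
    hence "[x'^2 = x^2] (mod int p)" by (rule cong_pow)
    hence "[(2*y+1)^2 = -N] (mod int p)" using x cong_trans y by blast
    thus "\<exists>y. int p dvd y^2 + y + m" unfolding iff by blast
  qed
  thus ?thesis using assms(4) by (simp add: Legendre_def cong_0_iff)
qed

text \<open>The right hand side is \<open>2\<close>, \<open>0\<close> for \<open>\<chi>(p) = 1, -1\<close>, and for \<open>\<chi>(p) = 0\<close> it is \<open>1\<close> or \<open>0\<close> according to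
whether \<open>k = 1\<close> (recall \<open>0\<^sup>0 = 1\<close>): the three possible behaviours of \<open>p\<close> in the quadratic field. That
\<open>\<chi>(p)\<close> decides about the existence of a root is quadratic reciprocity, with the supplementary law at
\<open>p = 2\<close>, where \<open>y\<^sup>2 + y + m\<close> has a root modulo \<open>2\<close> iff \<open>m\<close> is even.\<close>

lemma root_count_prime_power:
  fixes N :: nat
  assumes m: "4 * m = int N + 1" and sf: "squarefree N" and p: "prime p" and k: "k \<ge> 1"
  defines "c \<equiv> Jacobi (int p) N"
  shows "int (root_count m (p ^ k)) = c ^ (k - 1) + c ^ k"
proof -
  have N3: "N mod 4 = 3" using m by presburger
  hence "odd N" by presburger
  have N0: "N > 0" using \<open>odd N\<close> by (rule odd_pos)
  show ?thesis
  proof (cases "p dvd N")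
    case True
    have "odd p" using True \<open>odd N\<close> by auto
    have "c = 0" unfolding c_def
      by (rule Jacobi_eq_0) (use True p N0 in \<open>auto simp: prime_nat_iff coprime_absorb_left\<close>)
    have "\<not> p ^ 2 dvd N" using sf p by (auto simp: squarefree_def)
    hence "\<not> (int p) ^ 2 dvd int N" by (metis int_dvd_int_iff of_nat_power)
    show ?thesis
    proof (cases "k = 1")
      case True
      have "root_count m p = 1" by (rule root_count_ramified[OF m p \<open>odd p\<close>]) (use \<open>p dvd N\<close> in simp)
      thus ?thesis using \<open>c = 0\<close> True by simp
    next
      case False
      have "root_count m (p ^ k) = 0"
        by (rule root_count_ramified_power[OF m p]) (use \<open>p dvd N\<close> \<open>\<not> (int p) ^ 2 dvd int N\<close> False k in auto)
      moreover have "k - 1 \<noteq> 0" "k \<noteq> 0" using False k by auto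
      ultimately show ?thesis using \<open>c = 0\<close> by (simp only: power_0_left) simp
    qed
  next
    case False
    have iff: "(\<exists>y. int p dvd y^2 + y + m) \<longleftrightarrow> c = 1" and c: "c = 1 \<or> c = -1"
    proof -
      have "((\<exists>y. int p dvd y^2 + y + m) \<longleftrightarrow> c = 1) \<and> (c = 1 \<or> c = -1)"
      proof (cases "p = 2")
        case True
        have "even (y^2 + y + m) \<longleftrightarrow> even m" for y :: int by auto
        moreover have "even m \<longleftrightarrow> N mod 8 = 7" using m by presburger
        moreover have "N mod 8 \<noteq> 1" using N3 by presburger
        ultimately show ?thesis using True Jacobi_two[OF \<open>odd N\<close>] by (auto simp: c_def)
      next
        case False
        hence "2 < p" using prime_ge_2_nat[OF p] by simp
        have "odd p" using \<open>2 < p\<close> p prime_odd_nat by blast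
        have "Legendre (-1 * int N) (int p) = Legendre (-1) (int p) * Legendre (int N) (int p)"
          by (rule Legendre_mult) fact+
        moreover have "even ((p - 1) div 2) \<longleftrightarrow> p mod 4 = 1" using \<open>odd p\<close> by presburger
        ultimately have "Legendre (- int N) (int p) = c"
          using Jacobi_reciprocity[OF \<open>odd N\<close> p \<open>2 < p\<close> \<open>\<not> p dvd N\<close>] N3 Legendre_minus_one[OF p \<open>2 < p\<close>]
          by (simp add: c_def minus_one_power_iff)
        moreover have "\<not> int p dvd int N" using \<open>\<not> p dvd N\<close> by simp
        moreover have "Legendre (- int N) (int p) = 1 \<or> Legendre (- int N) (int p) = -1"
          using \<open>\<not> int p dvd int N\<close> by (simp add: Legendre_def cong_0_iff)
        ultimately show ?thesis using root_exists_iff_Legendre[OF m p \<open>odd p\<close>] by metis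
      qed
      thus "(\<exists>y. int p dvd y^2 + y + m) \<longleftrightarrow> c = 1" "c = 1 \<or> c = -1" by auto
    qed
    have "\<not> int p dvd int N" using False by simp
    from root_count_unramified[OF m p this k] iff
    have rc: "root_count m (p^k) = (if c = 1 then 2 else 0)" by simp
    obtain j where "k = Suc j" using k by (cases k) auto
    thus ?thesis using rc c by (auto simp: minus_one_power_iff)
  qed
qed

section \<open>Dirichlet convolution\<close>

definition dconv :: "(nat \<Rightarrow> int) \<Rightarrow> (nat \<Rightarrow> int) \<Rightarrow> nat \<Rightarrow> int" where
  "dconv f g n = (\<Sum>d | d dvd n. f d * g (n div d))"

definition multiplicative :: "(nat \<Rightarrow> int) \<Rightarrow> bool" where
  "multiplicative f \<longleftrightarrow> f 1 = 1 \<and> (\<forall>m n. m > 0 \<longrightarrow> n > 0 \<longrightarrow> coprime m n \<longrightarrow> f (m * n) = f m * f n)"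

lemma bij_betw_divisors_coprime:
  assumes "coprime m (n::nat)" "m > 0" "n > 0"
  shows "bij_betw (\<lambda>(a, b). a * b) ({d. d dvd m} \<times> {d. d dvd n}) {d. d dvd m * n}"
  unfolding bij_betw_def
proof (intro conjI inj_onI equalityI subsetI)
  fix x y assume x: "x \<in> {d. d dvd m} \<times> {d. d dvd n}" and y: "y \<in> {d. d dvd m} \<times> {d. d dvd n}"
    and eq: "(\<lambda>(a, b). a * b) x = (\<lambda>(a, b). a * b) y"
  obtain a b c d where xy: "x = (a, b)" "y = (c, d)" by (cases x, cases y)
  have "coprime a d" "coprime c b"
    using x y xy coprime_divisors[OF _ _ assms(1)] by auto
  have eq': "a * b = c * d" using eq xy by simp
  have "a dvd c * d" "c dvd a * b" "b dvd c * d" "d dvd a * b"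
    unfolding eq'[symmetric] by simp_all (simp_all add: eq')
  hence "a dvd c" "c dvd a" "b dvd d" "d dvd b"
    using \<open>coprime a d\<close> \<open>coprime c b\<close> coprime_commute
    by (auto simp: coprime_dvd_mult_left_iff coprime_dvd_mult_right_iff coprime_commute)
  thus "x = y" using xy by (simp add: dvd_antisym)
next
  fix z assume "z \<in> (\<lambda>(a, b). a * b) ` ({d. d dvd m} \<times> {d. d dvd n})"
  thus "z \<in> {d. d dvd m * n}" by (auto intro: mult_dvd_mono)
next
  fix z assume "z \<in> {d. d dvd m * n}"
  hence "z dvd m * n" by simp
  then obtain a b where "z = a * b" "a dvd m" "b dvd n" using division_decomp by blast
  thus "z \<in> (\<lambda>(a, b). a * b) ` ({d. d dvd m} \<times> {d. d dvd n})" by auto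
qed

lemma multiplicative_dconv:
  assumes "multiplicative f" "multiplicative g"
  shows "multiplicative (dconv f g)"
  unfolding multiplicative_def
proof (intro conjI allI impI)
  have "{d. d dvd (1::nat)} = {1}" by auto
  thus "dconv f g 1 = 1" using assms by (simp add: dconv_def multiplicative_def)
next
  fix m n :: nat assume mn: "m > 0" "n > 0" "coprime m n"
  have "dconv f g (m * n) = (\<Sum>(a,b)\<in>{d. d dvd m} \<times> {d. d dvd n}. f (a*b) * g (m * n div (a * b)))"
    unfolding dconv_def
    using sum.reindex_bij_betw[OF bij_betw_divisors_coprime[OF mn(3,1,2)], of "\<lambda>d. f d * g (m * n div d)"]
    by (simp add: case_prod_unfold)
  also have "\<dots> = (\<Sum>(a,b)\<in>{d. d dvd m} \<times> {d. d dvd n}. (f a * g (m div a)) * (f b * g (n div b)))"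
  proof (rule sum.cong[OF refl], clarify)
    fix a b assume ab: "a dvd m" "b dvd n"
    have "a > 0" "b > 0" "m div a > 0" "n div b > 0"
      using ab mn by (auto intro: Nat.gr0I simp: dvd_div_eq_0_iff)
    moreover have "m div a dvd m" "n div b dvd n"
      using ab by (metis dvd_mult_div_cancel dvd_triv_right)+
    hence "coprime a b" "coprime (m div a) (n div b)"
      using coprime_divisors[OF _ _ mn(3)] ab by blast+
    moreover have "m * n div (a * b) = (m div a) * (n div b)" using ab by (simp add: div_mult_div_if_dvd)
    ultimately show "f (a*b) * g (m * n div (a * b)) = (f a * g (m div a)) * (f b * g (n div b))"
      using assms by (simp add: multiplicative_def)
  qed
  also have "\<dots> = dconv f g m * dconv f g n"
    unfolding dconv_def sum_product by (simp add: sum.cartesian_product)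
  finally show "dconv f g (m * n) = dconv f g m * dconv f g n" .
qed

lemma multiplicative_eqI:
  assumes "multiplicative f" "multiplicative g"
    and "\<And>p k. prime p \<Longrightarrow> f (p ^ k) = g (p ^ k)"
    and "n > 0"
  shows "f n = g n"
  using assms(4)
proof (induction n rule: less_induct)
  case (less n)
  show ?case
  proof (cases "n = 1")
    case True thus ?thesis using assms by (simp add: multiplicative_def)
  next
    case False
    then obtain p where p: "prime p" "p dvd n" using prime_factor_nat by blast
    obtain r where r: "n = p ^ multiplicity p n * r" "\<not> p dvd r"
      using multiplicity_decompose'[of n p] less.prems p by (auto simp: prime_nat_iff)
    define k where "k = multiplicity p n"
    have "k > 0" using p less.prems by (simp add: k_def prime_multiplicity_gt_zero_iff)
    have "r > 0" using r less.prems by (cases "r = 0") auto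
    have "p ^ k > 1" using \<open>k > 0\<close> prime_gt_1_nat[OF p(1)] by (rule one_less_power[rotated])
    hence "r < n" using r(1) \<open>r > 0\<close> unfolding k_def[symmetric] by simp
    have "coprime (p ^ k) r" using prime_imp_coprime[OF p(1) r(2)] by simp
    thus ?thesis using assms(1-3) less.IH[OF \<open>r < n\<close> \<open>r > 0\<close>] r(1) p(1) \<open>r > 0\<close> \<open>p ^ k > 1\<close>
      unfolding k_def[symmetric] multiplicative_def by (metis gr0I not_one_less_zero)
  qed
qed

lemma dconv_prime_power:
  assumes "prime p"
  shows "dconv f g (p ^ e) = (\<Sum>j\<le>e. f (p ^ j) * g (p ^ (e - j)))"
proof -
  have "{d. d dvd p ^ e} = (\<lambda>j. p ^ j) ` {..e}"
    using divides_primepow_nat[OF assms] by auto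
  moreover have "inj_on (\<lambda>j. p ^ j) {..e}"
    using assms prime_gt_1_nat by (auto simp: inj_on_def)
  ultimately have "dconv f g (p ^ e) = (\<Sum>j\<le>e. f (p ^ j) * g (p ^ e div p ^ j))"
    unfolding dconv_def by (simp add: sum.reindex)
  also have "\<dots> = (\<Sum>j\<le>e. f (p ^ j) * g (p ^ (e - j)))"
    using assms prime_gt_0_nat by (intro sum.cong refl) (simp add: power_diff)
  finally show ?thesis .
qed

definition square_ind :: "nat \<Rightarrow> int" where
  "square_ind n = (if is_square n then 1 else 0)"

lemma multiplicative_square_ind: "multiplicative square_ind"
  unfolding multiplicative_def
proof (intro conjI allI impI)
  show "square_ind 1 = 1" by (simp add: square_ind_def)
  fix m n :: nat assume "m > 0" "n > 0" "coprime m n"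
  hence "is_square (m * n) \<longleftrightarrow> is_square m \<and> is_square n"
    using is_nth_power_mult_coprime_nat_iff[of m n 2] by simp
  thus "square_ind (m * n) = square_ind m * square_ind n" by (simp add: square_ind_def)
qed

text \<open>Each value of \<open>r\<close> collects two consecutive powers of \<open>c\<close>, so the values at every other index exhaust the
geometric sum.\<close>

lemma sum_alternate_eq_geometric:
  fixes c :: int
  assumes "r 0 = 1" "\<And>k. k \<ge> 1 \<Longrightarrow> r k = c ^ (k - 1) + c ^ k"
  shows "(\<Sum>j\<le>e. if even (e - j) then r j else 0) = (\<Sum>j\<le>e. c ^ j)"
proof (induction e rule: induct_nat_012)
  case 0 thus ?case using assms by simp
next
  case 1 thus ?case using assms by simp
next
  case (ge2 e)
  have "(\<Sum>j\<le>Suc (Suc e). if even (Suc (Suc e) - j) then r j else 0)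
      = (\<Sum>j\<le>e. if even (Suc (Suc e) - j) then r j else 0) + r (Suc (Suc e))" by simp
  also have "(\<Sum>j\<le>e. if even (Suc (Suc e) - j) then r j else 0) = (\<Sum>j\<le>e. if even (e - j) then r j else 0)"
    by (intro sum.cong refl) (auto simp: Suc_diff_le)
  also have "\<dots> = (\<Sum>j\<le>e. c ^ j)" by (rule ge2)
  also have "r (Suc (Suc e)) = c ^ Suc e + c ^ Suc (Suc e)" using assms(2)[of "Suc (Suc e)"] by simp
  finally show ?case by simp
qed

text \<open>Both sides are Dirichlet convolutions of multiplicative functions. In terms of Dirichlet series this is
\<open>\<zeta>(2 s) (\<Sum>a. \<rho>(a) / a powr s) = \<zeta>(s) L(s, \<chi>)\<close> for the root count \<open>\<rho>\<close>; the Euler factors are compared one at a time.\<close>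

theorem divisor_sum_eq_root_sum:
  fixes N :: nat
  assumes m: "4 * m = int N + 1" and sf: "squarefree N" and n: "n > 0"
  shows "dconv (\<lambda>a. int (root_count m a)) square_ind n = (\<Sum>d | d dvd n. Jacobi (int d) N)"
proof -
  have "N mod 4 = 3" using m by presburger
  hence "odd N" by presburger
  have M1: "multiplicative (\<lambda>a. int (root_count m a))"
    by (auto simp: multiplicative_def root_count_mult)
  have M2: "multiplicative (\<lambda>d. Jacobi (int d) N)"
    by (auto simp: multiplicative_def Jacobi_mult \<open>odd N\<close> Jacobi_one_left)
  have M3: "multiplicative (\<lambda>_. 1)" by (simp add: multiplicative_def)
  have "dconv (\<lambda>a. int (root_count m a)) square_ind n = dconv (\<lambda>d. Jacobi (int d) N) (\<lambda>_. 1) n"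
  proof (rule multiplicative_eqI[OF _ _ _ n])
    fix p k :: nat assume p: "prime p"
    let ?c = "Jacobi (int p) N"
    have pw: "Jacobi (int p ^ j) N = ?c ^ j" for j
      by (induction j) (auto simp: Jacobi_one_left Jacobi_mult \<open>odd N\<close>)
    have "is_square (p ^ i) \<longleftrightarrow> even i" for i
      using p by (simp add: is_nth_power_prime_power_nat_iff)
    hence "dconv (\<lambda>a. int (root_count m a)) square_ind (p ^ k)
       = (\<Sum>j\<le>k. if even (k - j) then int (root_count m (p ^ j)) else 0)"
      unfolding dconv_prime_power[OF p] by (intro sum.cong refl) (simp add: square_ind_def)
    also have "\<dots> = (\<Sum>j\<le>k. ?c ^ j)"
      by (rule sum_alternate_eq_geometric) (auto simp: root_count_prime_power[OF m sf p])
    finally show "dconv (\<lambda>a. int (root_count m a)) square_ind (p ^ k) = dconv (\<lambda>d. Jacobi (int d) N) (\<lambda>_. 1) (p ^ k)"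
      unfolding dconv_prime_power[OF p] by (simp add: pw)
  qed (intro multiplicative_dconv M1 M2 M3 multiplicative_square_ind)+
  thus ?thesis by (simp add: dconv_def)
qed

section \<open>Periodized Gaussians\<close>

lemma has_sum_diff_real:
  fixes f g :: "'a \<Rightarrow> real"
  assumes "(f has_sum a) A" "(g has_sum b) A"
  shows "((\<lambda>x. f x - g x) has_sum (a - b)) A"
  using has_sum_add[OF assms(1) has_sum_uminusI[OF assms(2)]] by simp

lemma has_sum_exp_abs_int:
  assumes "r > 0"
  shows "((\<lambda>x::int. exp (- r * \<bar>real_of_int x\<bar>)) has_sum ((1 + exp (-r)) / (1 - exp (-r)))) UNIV"
proof -
  define q where "q = exp (-r)"
  have q: "0 < q" "q < 1" using assms by (simp_all add: q_def)
  have pw: "exp (- r * real n) = q ^ n" for n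
    unfolding q_def exp_of_nat_mult[symmetric] by (simp add: mult.commute)
  have 1: "((\<lambda>n::nat. q ^ n) has_sum (1 / (1 - q))) UNIV"
    by (rule sums_nonneg_imp_has_sum) (use q geometric_sums[of q] in auto)
  have "((\<lambda>x::int. exp (- r * \<bar>real_of_int x\<bar>)) has_sum (1 / (1 - q))) {0..}"
    by (rule has_sum_reindex_bij_witness[of UNIV nat int, THEN iffD1, OF _ _ _ _ _ _ 1])
       (auto simp: pw[symmetric])
  moreover have "((\<lambda>n::nat. q * q ^ n) has_sum (q * (1 / (1 - q)))) UNIV"
    by (intro has_sum_cmult_right 1)
  hence "((\<lambda>x::int. exp (- r * \<bar>real_of_int x\<bar>)) has_sum (q * (1 / (1 - q)))) {..<0}"
  proof (rule has_sum_reindex_bij_witness[of UNIV "\<lambda>x. nat (- x - 1)" "\<lambda>n. - int n - 1", THEN iffD1, rotated 6])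
    fix n :: nat
    have "exp (- r * \<bar>real_of_int (- int n - 1)\<bar>) = exp (- r * real (Suc n))" by simp
    also have "\<dots> = q * q ^ n" unfolding pw by simp
    finally show "exp (- r * \<bar>real_of_int (- int n - 1)\<bar>) = q * q ^ n" .
  qed auto
  ultimately have "((\<lambda>x::int. exp (- r * \<bar>real_of_int x\<bar>)) has_sum (1 / (1 - q) + q * (1 / (1 - q)))) ({0..} \<union> {..<0})"
    by (rule has_sum_Un_disjoint) auto
  moreover have "{0..} \<union> {..<0} = (UNIV :: int set)" by auto
  moreover have "1 / (1 - q) + q * (1 / (1 - q)) = (1 + q) / (1 - q)" by (simp add: add_divide_distrib)
  ultimately show ?thesis by (simp add: q_def)
qed

text \<open>The sum is dominated by a two-sided geometric series. The constant \<open>12\<close> is \<open>3 * 4\<close>, where \<open>3\<close> bounds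
\<open>exp r\<close>, the price for rounding the shift \<open>\<alpha>\<close> to an integer, and \<open>4/r\<close> bounds the series at \<open>\<alpha> = 0\<close>.\<close>

lemma exp_abs_shift_bound:
  assumes "0 < r" "r \<le> 1"
  shows "(\<lambda>x::int. exp (- r * \<bar>real_of_int x + \<alpha>\<bar>)) summable_on UNIV"
    and "(\<Sum>\<^sub>\<infinity>x::int. exp (- r * \<bar>real_of_int x + \<alpha>\<bar>)) \<le> 12 / r"
proof -
  define k where "k = \<lfloor>\<alpha>\<rfloor>"
  let ?S = "(1 + exp (-r)) / (1 - exp (-r))"
  have "((\<lambda>x::int. exp (- r * \<bar>real_of_int (x + k)\<bar>)) has_sum ?S) UNIV"
    by (rule has_sum_reindex_bij_witness[of UNIV "\<lambda>x. x - k" "\<lambda>x. x + k", THEN iffD2, OF _ _ _ _ _ _ has_sum_exp_abs_int[OF assms(1)]]) auto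
  hence hs: "((\<lambda>x::int. exp r * exp (- r * \<bar>real_of_int (x + k)\<bar>)) has_sum (exp r * ?S)) UNIV"
    by (rule has_sum_cmult_right)
  have le: "exp (- r * \<bar>real_of_int x + \<alpha>\<bar>) \<le> exp r * exp (- r * \<bar>real_of_int (x + k)\<bar>)" for x :: int
  proof -
    have "real_of_int k \<le> \<alpha>" "\<alpha> < real_of_int k + 1" unfolding k_def by linarith+
    hence "\<bar>real_of_int (x + k)\<bar> \<le> \<bar>real_of_int x + \<alpha>\<bar> + 1" by simp
    hence "r * \<bar>real_of_int (x + k)\<bar> \<le> r * (\<bar>real_of_int x + \<alpha>\<bar> + 1)"
      using assms by (intro mult_left_mono) auto
    thus ?thesis unfolding exp_add[symmetric] by (simp add: algebra_simps)
  qed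
  show sm: "(\<lambda>x::int. exp (- r * \<bar>real_of_int x + \<alpha>\<bar>)) summable_on UNIV"
    by (rule summable_on_comparison_test[OF has_sum_imp_summable[OF hs]]) (use le in auto)
  have "(\<Sum>\<^sub>\<infinity>x::int. exp (- r * \<bar>real_of_int x + \<alpha>\<bar>)) \<le> exp r * ?S"
    by (rule has_sum_mono[OF has_sum_infsum[OF sm] hs]) (use le in auto)
  also have "\<dots> \<le> 3 * (4 / r)"
  proof (rule mult_mono)
    show "exp r \<le> 3" using exp_le assms exp_le_cancel_iff[of r 1] by linarith
    have "1 + r \<le> exp r" by (rule exp_ge_add_one_self)
    hence q: "exp (-r) \<le> 1 / (1 + r)" using assms by (simp add: exp_minus field_simps)
    have "1 - 1 / (1 + r) = r / (1 + r)" using assms by (simp add: field_simps)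
    hence den: "r / (1 + r) \<le> 1 - exp (-r)" using q by linarith
    have "r / 2 \<le> r / (1 + r)" using assms by (intro divide_left_mono) auto
    hence den2: "r / 2 \<le> 1 - exp (-r)" using den by linarith
    have "?S \<le> 2 / (r / 2)"
      by (rule frac_le) (use assms den2 in auto)
    thus "?S \<le> 4 / r" by simp
    have "0 < 1 - exp (-r)" using assms by simp
    thus "0 \<le> ?S" by (simp add: add_nonneg_nonneg)
  qed simp
  finally show "(\<Sum>\<^sub>\<infinity>x::int. exp (- r * \<bar>real_of_int x + \<alpha>\<bar>)) \<le> 12 / r" by simp
qed

text \<open>For \<open>j \<le> 3\<close> this is the \<open>j\<close>-th derivative of \<open>u \<mapsto> exp (-(r u)\<^sup>2)\<close>.\<close>

definition gauss_deriv :: "real \<Rightarrow> nat \<Rightarrow> real \<Rightarrow> real" where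
  "gauss_deriv r j u =
     (if j = 0 then 1
      else if j = 1 then - 2 * r * (r * u)
      else if j = 2 then r^2 * (4 * (r * u)^2 - 2)
      else r^3 * (12 * (r * u) - 8 * (r * u)^3)) * exp (- ((r * u)^2))"

lemma gauss_deriv_DERIV:
  assumes "j < 3"
  shows "(gauss_deriv r j has_real_derivative gauss_deriv r (Suc j) u) (at u)"
proof -
  have "j = 0 \<or> j = 1 \<or> j = 2" using assms by auto
  thus ?thesis
    unfolding gauss_deriv_def [abs_def]
    by (elim disjE; simp)
       (auto intro!: derivative_eq_intros simp: power2_eq_square power3_eq_cube algebra_simps eval_nat_numeral)
qed

text \<open>Completing the square, \<open>v\<^sup>2 \<ge> 2 \<bar>v\<bar> - 1\<close>; hence the Gaussian absorbs a factor \<open>exp \<bar>v\<bar>\<close> and still decays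
exponentially. The constant \<open>3\<close> bounds \<open>exp 1\<close>.\<close>

lemma poly_gauss_bound:
  fixes v C :: real
  assumes "\<bar>P\<bar> \<le> C * exp \<bar>v\<bar>"
  shows "\<bar>P * exp (- (v^2))\<bar> \<le> 3 * C * exp (- \<bar>v\<bar>)"
proof -
  have "0 \<le> (\<bar>v\<bar> - 1)^2" by simp
  hence "- (v^2) \<le> 1 + - 2 * \<bar>v\<bar>" by (simp add: power2_eq_square algebra_simps abs_mult_self_eq)
  hence "exp (- (v^2)) \<le> exp 1 * exp (- 2 * \<bar>v\<bar>)" unfolding exp_add[symmetric] by simp
  also have "\<dots> \<le> 3 * exp (- 2 * \<bar>v\<bar>)" using exp_le by (intro mult_right_mono) auto
  finally have e: "exp (- (v^2)) \<le> 3 * exp (- 2 * \<bar>v\<bar>)" .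
  have "\<bar>P * exp (- (v^2))\<bar> \<le> (C * exp \<bar>v\<bar>) * (3 * exp (- 2 * \<bar>v\<bar>))"
    unfolding abs_mult by (rule mult_mono) (use assms e order_trans[OF abs_ge_zero assms] in auto)
  also have "\<dots> = 3 * C * (exp \<bar>v\<bar> * exp (- 2 * \<bar>v\<bar>))" by simp
  also have "exp \<bar>v\<bar> * exp (- 2 * \<bar>v\<bar>) = exp (- \<bar>v\<bar>)" unfolding exp_add[symmetric] by simp
  finally show ?thesis .
qed

lemma abs_le_exp_abs: "\<bar>v::real\<bar> \<le> exp \<bar>v\<bar>" "v^2 \<le> 2 * exp \<bar>v\<bar>" "\<bar>v\<bar>^3 \<le> 6 * exp \<bar>v\<bar>"
proof -
  have "(\<Sum>k<n. \<bar>v\<bar> ^ k / fact k) \<le> exp \<bar>v\<bar>" for n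
    using sum_le_suminf[OF summable_exp_generic, of "{..<n}" "\<bar>v\<bar>"]
    by (auto simp: exp_def scaleR_conv_of_real divide_inverse mult.commute)
  from this[of 4] have "1 + \<bar>v\<bar> + \<bar>v\<bar>^2 / 2 + \<bar>v\<bar>^3 / 6 \<le> exp \<bar>v\<bar>"
    by (simp add: eval_nat_numeral)
  moreover have "\<bar>v\<bar> \<ge> 0" "v^2 \<ge> 0" "\<bar>v\<bar>^3 \<ge> 0" "\<bar>v\<bar>^2 = v^2" by auto
  ultimately show "\<bar>v\<bar> \<le> exp \<bar>v\<bar>" "v^2 \<le> 2 * exp \<bar>v\<bar>" "\<bar>v\<bar>^3 \<le> 6 * exp \<bar>v\<bar>" by linarith+
qed

lemma gauss_deriv_bound:
  assumes "0 < r" "j \<le> 3"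
  shows "\<bar>gauss_deriv r j u\<bar> \<le> 180 * r ^ j * exp (- r * \<bar>u\<bar>)"
proof -
  define v where "v = r * u"
  have v: "r * \<bar>u\<bar> = \<bar>v\<bar>" using assms by (simp add: v_def abs_mult)
  have one: "1 \<le> exp \<bar>v\<bar>" by simp
  note b = abs_le_exp_abs[of v]
  have "j = 0 \<or> j = 1 \<or> j = 2 \<or> j = 3" using assms by auto
  then obtain P where P: "gauss_deriv r j u = r ^ j * (P * exp (- (v^2)))" "\<bar>P\<bar> \<le> 60 * exp \<bar>v\<bar>"
  proof (elim disjE)
    assume "j = 0" moreover have "\<bar>1\<bar> \<le> 60 * exp \<bar>v\<bar>" unfolding abs_one using one by linarith
    ultimately show thesis by (intro that[of 1]) (auto simp: gauss_deriv_def v_def)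
  next
    assume "j = 1"
    moreover have "\<bar>-2 * v\<bar> \<le> 60 * exp \<bar>v\<bar>" unfolding abs_mult using b one by linarith
    ultimately show thesis by (intro that[of "-2 * v"]) (auto simp: gauss_deriv_def v_def)
  next
    assume "j = 2"
    moreover have "\<bar>4 * v^2 - 2\<bar> \<le> 60 * exp \<bar>v\<bar>" using b one zero_le_power2[of v] by linarith
    ultimately show thesis by (intro that[of "4 * v^2 - 2"]) (auto simp: gauss_deriv_def v_def numeral_2_eq_2)
  next
    assume "j = 3"
    moreover have "\<bar>v^3\<bar> = \<bar>v\<bar>^3" by (simp add: power_abs)
    hence "\<bar>12 * v - 8 * v^3\<bar> \<le> 60 * exp \<bar>v\<bar>" using b one by linarith
    ultimately show thesis by (intro that[of "12 * v - 8 * v^3"]) (auto simp: gauss_deriv_def v_def numeral_3_eq_3)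
  qed
  have "\<bar>gauss_deriv r j u\<bar> = r ^ j * \<bar>P * exp (- (v^2))\<bar>" using P(1) assms by (simp add: abs_mult)
  also have "\<dots> \<le> r ^ j * (3 * 60 * exp (- \<bar>v\<bar>))"
    using poly_gauss_bound[OF P(2)] assms by (intro mult_left_mono) auto
  finally show ?thesis using v by (simp add: mult_ac)
qed

text \<open>The periodization of the Gaussian (\<open>j = 0\<close>) and of its derivatives.\<close>

definition gauss_lattice_sum :: "real \<Rightarrow> nat \<Rightarrow> real \<Rightarrow> real" where
  "gauss_lattice_sum r j \<alpha> = (\<Sum>\<^sub>\<infinity>x::int. gauss_deriv r j (real_of_int x + \<alpha>))"

lemma gauss_deriv_summable:
  assumes "0 < r" "r \<le> 1" "j \<le> 3"
  shows "(\<lambda>x::int. gauss_deriv r j (real_of_int x + \<alpha>)) summable_on UNIV"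
    and "\<bar>gauss_lattice_sum r j \<alpha>\<bar> \<le> 2160 * r ^ j / r"
proof -
  have sm: "(\<lambda>x::int. 180 * r ^ j * exp (- r * \<bar>real_of_int x + \<alpha>\<bar>)) summable_on UNIV"
    by (intro summable_on_cmult_right exp_abs_shift_bound assms)
  have abs: "(\<lambda>x::int. norm (gauss_deriv r j (real_of_int x + \<alpha>))) summable_on UNIV"
    by (rule summable_on_comparison_test[OF sm]) (use gauss_deriv_bound[OF assms(1,3)] in auto)
  thus "(\<lambda>x::int. gauss_deriv r j (real_of_int x + \<alpha>)) summable_on UNIV"
    by (rule abs_summable_summable)
  have "\<bar>gauss_lattice_sum r j \<alpha>\<bar> \<le> (\<Sum>\<^sub>\<infinity>x::int. \<bar>gauss_deriv r j (real_of_int x + \<alpha>)\<bar>)"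
    using norm_infsum_bound[OF abs] by (simp add: gauss_lattice_sum_def)
  also have "\<dots> \<le> (\<Sum>\<^sub>\<infinity>x::int. 180 * r ^ j * exp (- r * \<bar>real_of_int x + \<alpha>\<bar>))"
    by (rule infsum_mono) (use abs sm gauss_deriv_bound[OF assms(1,3)] in auto)
  also have "\<dots> = 180 * r ^ j * (\<Sum>\<^sub>\<infinity>x::int. exp (- r * \<bar>real_of_int x + \<alpha>\<bar>))"
    by (rule infsum_cmult_right')
  also have "\<dots> \<le> 180 * r ^ j * (12 / r)"
    by (intro mult_left_mono exp_abs_shift_bound assms) (use assms in auto)
  finally show "\<bar>gauss_lattice_sum r j \<alpha>\<bar> \<le> 2160 * r ^ j / r" by simp
qed

lemma gauss_lattice_sum_periodic: "gauss_lattice_sum r j (\<alpha> + of_int k) = gauss_lattice_sum r j \<alpha>"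
  unfolding gauss_lattice_sum_def
  by (rule infsum_reindex_bij_witness[of _ "\<lambda>x. x - k" "\<lambda>x. x + k"]) (auto simp: algebra_simps)

text \<open>The third order remainder: \<open>180/6\<close> comes from the bound on the third derivative, and a factor \<open>3\<close> from
moving the intermediate point back to \<open>u\<close>.\<close>

lemma gauss_taylor_term:
  assumes "0 < r" "r \<le> 1" "\<bar>\<beta>\<bar> \<le> 1"
  shows "\<bar>gauss_deriv r 0 (u + \<beta>) - gauss_deriv r 0 u - \<beta> * gauss_deriv r 1 u - \<beta>^2 / 2 * gauss_deriv r 2 u\<bar>
         \<le> 90 * r ^ 3 * exp (- r * \<bar>u\<bar>)"
proof -
  have "\<exists>t. \<bar>t\<bar> \<le> \<bar>\<beta>\<bar> \<and> gauss_deriv r 0 (\<beta> + u) =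
     (\<Sum>m<3. gauss_deriv r m (0 + u) / fact m * \<beta> ^ m) + gauss_deriv r 3 (t + u) / fact 3 * \<beta> ^ 3"
  proof (rule Maclaurin_bi_le[where f = "\<lambda>x. gauss_deriv r 0 (x + u)" and diff = "\<lambda>m x. gauss_deriv r m (x + u)"])
    show "\<forall>m t. m < 3 \<and> \<bar>t\<bar> \<le> \<bar>\<beta>\<bar> \<longrightarrow>
        ((\<lambda>x. gauss_deriv r m (x + u)) has_real_derivative gauss_deriv r (Suc m) (t + u)) (at t)"
      using gauss_deriv_DERIV DERIV_shift by blast
  qed simp
  then obtain t where t: "\<bar>t\<bar> \<le> \<bar>\<beta>\<bar>" "gauss_deriv r 0 (u + \<beta>) =
     (\<Sum>m<3. gauss_deriv r m (u + 0) / fact m * \<beta> ^ m) + gauss_deriv r 3 (u + t) / fact 3 * \<beta> ^ 3"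
    by (auto simp: add.commute)
  have "(\<Sum>m<3. gauss_deriv r m (u + 0) / fact m * \<beta> ^ m)
      = gauss_deriv r 0 u + \<beta> * gauss_deriv r 1 u + \<beta>^2 / 2 * gauss_deriv r 2 u"
    by (simp add: eval_nat_numeral)
  hence "\<bar>gauss_deriv r 0 (u + \<beta>) - gauss_deriv r 0 u - \<beta> * gauss_deriv r 1 u - \<beta>^2 / 2 * gauss_deriv r 2 u\<bar>
      = \<bar>gauss_deriv r 3 (u + t)\<bar> / 6 * \<bar>\<beta>\<bar> ^ 3"
    using t(2) by (simp add: abs_mult power_abs fact_numeral)
  also have "\<dots> \<le> (180 * r ^ 3 * exp (- r * \<bar>u + t\<bar>)) / 6 * 1"
    by (intro mult_mono divide_right_mono gauss_deriv_bound power_le_one) (use assms in auto)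
  also have "exp (- r * \<bar>u + t\<bar>) \<le> 3 * exp (- r * \<bar>u\<bar>)"
  proof -
    have "r * (\<bar>u\<bar> - 1) \<le> r * \<bar>u + t\<bar>" using assms t(1) by (intro mult_left_mono) auto
    hence "- r * \<bar>u + t\<bar> \<le> 1 + - r * \<bar>u\<bar>" using assms(2) by (simp add: algebra_simps)
    hence "exp (- r * \<bar>u + t\<bar>) \<le> exp 1 * exp (- r * \<bar>u\<bar>)" unfolding exp_add[symmetric] by simp
    also have "\<dots> \<le> 3 * exp (- r * \<bar>u\<bar>)" using exp_le by (intro mult_right_mono) auto
    finally show ?thesis .
  qed
  finally show ?thesis using assms by (simp add: mult_left_mono)
qed

text \<open>Summing the third order Taylor formula over all translates. Since \<open>r\<^sup>3\<close> meets only the \<open>1/r\<close> of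
\<open>exp_abs_shift_bound\<close>, the error is \<open>O(r\<^sup>2)\<close>, which is small against \<open>1/r\<close>, the size of the sum itself.\<close>

lemma gauss_lattice_sum_taylor:
  assumes "0 < r" "r \<le> 1" "\<bar>\<beta>\<bar> \<le> 1"
  shows "\<bar>gauss_lattice_sum r 0 (\<alpha> + \<beta>) - gauss_lattice_sum r 0 \<alpha> - \<beta> * gauss_lattice_sum r 1 \<alpha> - \<beta>^2 / 2 * gauss_lattice_sum r 2 \<alpha>\<bar>
         \<le> 1080 * r ^ 2"
proof -
  let ?d = "\<lambda>x::int. gauss_deriv r 0 (real_of_int x + (\<alpha> + \<beta>)) - gauss_deriv r 0 (real_of_int x + \<alpha>)
      - \<beta> * gauss_deriv r 1 (real_of_int x + \<alpha>) - \<beta>^2 / 2 * gauss_deriv r 2 (real_of_int x + \<alpha>)"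
  have sm: "(\<lambda>x::int. gauss_deriv r j (real_of_int x + \<gamma>)) summable_on UNIV" if "j \<le> 3" for j \<gamma>
    by (rule gauss_deriv_summable[OF assms(1,2) that])
  have hs: "((\<lambda>x::int. gauss_deriv r j (real_of_int x + \<gamma>)) has_sum gauss_lattice_sum r j \<gamma>) UNIV" if "j \<le> 3" for j \<gamma>
    unfolding gauss_lattice_sum_def by (rule has_sum_infsum[OF sm[OF that]])
  have "(?d has_sum (gauss_lattice_sum r 0 (\<alpha> + \<beta>) - gauss_lattice_sum r 0 \<alpha> - \<beta> * gauss_lattice_sum r 1 \<alpha> - \<beta>^2 / 2 * gauss_lattice_sum r 2 \<alpha>)) UNIV"
    by (intro has_sum_diff_real has_sum_cmult_right hs) auto
  moreover have e: "(\<lambda>x::int. 90 * r ^ 3 * exp (- r * \<bar>real_of_int x + \<alpha>\<bar>)) summable_on UNIV"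
    by (intro summable_on_cmult_right exp_abs_shift_bound assms)
  have le: "\<bar>?d x\<bar> \<le> 90 * r ^ 3 * exp (- r * \<bar>real_of_int x + \<alpha>\<bar>)" for x
    using gauss_taylor_term[OF assms, of "real_of_int x + \<alpha>"] by (simp add: add.assoc)
  have abs: "(\<lambda>x. norm (?d x)) summable_on UNIV"
    by (rule summable_on_comparison_test[OF e]) (use le in auto)
  ultimately have "\<bar>gauss_lattice_sum r 0 (\<alpha> + \<beta>) - gauss_lattice_sum r 0 \<alpha> - \<beta> * gauss_lattice_sum r 1 \<alpha> - \<beta>^2 / 2 * gauss_lattice_sum r 2 \<alpha>\<bar>
      \<le> (\<Sum>\<^sub>\<infinity>x. \<bar>?d x\<bar>)"
    using norm_infsum_bound[OF abs] by (simp add: infsumI)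
  also have "\<dots> \<le> (\<Sum>\<^sub>\<infinity>x::int. 90 * r ^ 3 * exp (- r * \<bar>real_of_int x + \<alpha>\<bar>))"
    by (rule infsum_mono) (use abs e le in auto)
  also have "\<dots> = 90 * r ^ 3 * (\<Sum>\<^sub>\<infinity>x::int. exp (- r * \<bar>real_of_int x + \<alpha>\<bar>))"
    by (rule infsum_cmult_right')
  also have "\<dots> \<le> 90 * r ^ 3 * (12 / r)"
    by (intro mult_left_mono exp_abs_shift_bound assms) (use assms in auto)
  also have "\<dots> = 1080 * r ^ 2" using assms by (simp add: power2_eq_square power3_eq_cube)
  finally show ?thesis .
qed

text \<open>Periodicity makes the Taylor formula prove more than it says: for the shifts \<open>\<beta> = 1\<close> and \<open>\<beta> = -1\<close> the
difference on its left vanishes, which forces the periodized first and second derivatives to be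
\<open>O(r\<^sup>2)\<close> themselves. Then all three contributions for a general shift in \<open>{0..<1}\<close> are at most
\<open>1080 r\<^sup>2\<close>.\<close>

lemma gauss_lattice_sum_variation:
  assumes "0 < r" "r \<le> 1"
  shows "\<bar>gauss_lattice_sum r 0 \<alpha> - gauss_lattice_sum r 0 0\<bar> \<le> 3240 * r ^ 2"
proof -
  have p: "gauss_lattice_sum r 0 1 = gauss_lattice_sum r 0 0" "gauss_lattice_sum r 0 (-1) = gauss_lattice_sum r 0 0"
    using gauss_lattice_sum_periodic[of r 0 0 1] gauss_lattice_sum_periodic[of r 0 0 "-1"] by simp_all
  define A where "A = gauss_lattice_sum r 1 0"
  define B where "B = gauss_lattice_sum r 2 0"
  \<comment> \<open>The shifts by \<open>1\<close> and \<open>-1\<close>, where the left hand side of the Taylor formula vanishes.\<close>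
  have AB: "\<bar>A + B / 2\<bar> \<le> 1080 * r ^ 2" "\<bar>- A + B / 2\<bar> \<le> 1080 * r ^ 2"
    using gauss_lattice_sum_taylor[OF assms, of 1 0] gauss_lattice_sum_taylor[OF assms, of "-1" 0] p
    by (simp_all add: A_def B_def abs_minus_commute)
  hence "\<bar>A\<bar> \<le> 1080 * r ^ 2" "\<bar>B / 2\<bar> \<le> 1080 * r ^ 2" by linarith+
  moreover define \<beta> where "\<beta> = frac \<alpha>"
  have b: "0 \<le> \<beta>" "\<beta> < 1" by (simp_all add: \<beta>_def frac_lt_1)
  have "\<beta>^2 \<le> 1" using b by (simp add: power_le_one)
  have "\<bar>\<beta> * A\<bar> \<le> 1 * \<bar>A\<bar>" "\<bar>\<beta>^2 * (B/2)\<bar> \<le> 1 * \<bar>B/2\<bar>"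
    unfolding abs_mult using b \<open>\<beta>^2 \<le> 1\<close> by (intro mult_right_mono; simp)+
  moreover have "\<bar>gauss_lattice_sum r 0 \<beta> - gauss_lattice_sum r 0 0 - \<beta> * A - \<beta>^2 * (B / 2)\<bar> \<le> 1080 * r ^ 2"
    using gauss_lattice_sum_taylor[OF assms, of \<beta> 0] b by (simp add: A_def B_def)
  ultimately have "\<bar>gauss_lattice_sum r 0 \<beta> - gauss_lattice_sum r 0 0\<bar> \<le> 3240 * r ^ 2" by linarith
  moreover have "gauss_lattice_sum r 0 \<alpha> = gauss_lattice_sum r 0 \<beta>"
    using gauss_lattice_sum_periodic[of r 0 \<beta> "\<lfloor>\<alpha>\<rfloor>"] by (simp add: \<beta>_def frac_def)
  ultimately show ?thesis by simp
qed

text \<open>Halving \<open>r\<close> refines the lattice to two cosets, the even and the odd integers, whose sums almost agree.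
This scaling law stands in for the asymptotics of the sum, a multiple of \<open>1/r\<close>.\<close>

lemma gauss_lattice_sum_half:
  assumes "0 < r" "r \<le> 1"
  shows "\<bar>gauss_lattice_sum (r / 2) 0 0 - 2 * gauss_lattice_sum r 0 0\<bar> \<le> 3240 * r ^ 2"
proof -
  let ?g = "\<lambda>x::int. gauss_deriv (r/2) 0 (real_of_int x + 0)"
  have sm: "(\<lambda>x::int. gauss_deriv r 0 (real_of_int x + \<gamma>)) summable_on UNIV" for \<gamma>
    by (rule gauss_deriv_summable) (use assms in auto)
  have hs: "((\<lambda>x::int. gauss_deriv r 0 (real_of_int x + \<gamma>)) has_sum gauss_lattice_sum r 0 \<gamma>) UNIV" for \<gamma>
    unfolding gauss_lattice_sum_def by (rule has_sum_infsum[OF sm])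
  have "(?g has_sum gauss_lattice_sum r 0 0) {x. even x}"
    by (rule has_sum_reindex_bij_witness[of UNIV "\<lambda>x. x div 2" "\<lambda>x. 2 * x", THEN iffD1, OF _ _ _ _ _ _ hs[of 0]])
       (auto simp: gauss_deriv_def)
  moreover have "(?g has_sum gauss_lattice_sum r 0 (1/2)) {x. odd x}"
    by (rule has_sum_reindex_bij_witness[of UNIV "\<lambda>x. x div 2" "\<lambda>x. 2 * x + 1", THEN iffD1, OF _ _ _ _ _ _ hs[of "1/2"]])
       (auto simp: gauss_deriv_def algebra_simps elim!: oddE)
  ultimately have "(?g has_sum (gauss_lattice_sum r 0 0 + gauss_lattice_sum r 0 (1/2))) ({x. even x} \<union> {x. odd x})"
    by (rule has_sum_Un_disjoint) auto
  moreover have "{x. even x} \<union> {x. odd x} = (UNIV :: int set)" by auto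
  ultimately have "gauss_lattice_sum (r/2) 0 0 = gauss_lattice_sum r 0 0 + gauss_lattice_sum r 0 (1/2)"
    by (simp add: gauss_lattice_sum_def infsumI)
  thus ?thesis using gauss_lattice_sum_variation[OF assms, of "1/2"] by simp
qed

section \<open>Binary theta series near 0\<close>

definition theta :: "int \<Rightarrow> int \<Rightarrow> int \<Rightarrow> real \<Rightarrow> real" where
  "theta a b c t = (\<Sum>\<^sub>\<infinity>(x, y)\<in>UNIV. exp (- t * real_of_int (a * x^2 + b * x * y + c * y^2)))"

text \<open>Completing the square, \<open>a x\<^sup>2 + b x y + c y\<^sup>2 = a (x + \<beta> y)\<^sup>2 + \<delta> y\<^sup>2\<close>. For each \<open>y\<close> the sum over \<open>x\<close> is a periodized
Gaussian whose shift \<open>\<beta> y\<close> may be replaced by \<open>0\<close>; after that the double sum factors.\<close>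

lemma theta_approx:
  fixes a b c :: int and t :: real
  assumes "a > 0" "4 * a * c - b^2 > 0"
  defines "\<delta> \<equiv> real_of_int (4 * a * c - b^2) / (4 * a)"
  assumes t: "t > 0" "t * a \<le> 1" "t * \<delta> \<le> 1"
  shows "(\<lambda>(x, y). exp (- t * real_of_int (a * x^2 + b * x * y + c * y^2))) summable_on UNIV"
    and "\<bar>theta a b c t - gauss_lattice_sum (sqrt (t * a)) 0 0 * gauss_lattice_sum (sqrt (t * \<delta>)) 0 0\<bar>
         \<le> 3240 * (t * a) * gauss_lattice_sum (sqrt (t * \<delta>)) 0 0"
proof -
  have d: "\<delta> > 0" unfolding \<delta>_def using assms(1,2) by (intro divide_pos_pos of_int_0_less_iff[THEN iffD2]) simp_all
  let ?r = "sqrt (t * a)" and ?s = "sqrt (t * \<delta>)"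
  have r: "0 < ?r" "?r \<le> 1" "0 < ?s" "?s \<le> 1" using t d assms(1) by auto
  define \<beta> where "\<beta> = real_of_int b / (2 * a)"
  let ?f = "\<lambda>(y, x). exp (- t * real_of_int (a * x^2 + b * x * y + c * y^2))"
  have f: "?f (y, x) = gauss_deriv ?s 0 (real_of_int y + 0) * gauss_deriv ?r 0 (real_of_int x + \<beta> * y)" for x y
  proof -
    have Q: "real_of_int (a * x^2 + b * x * y + c * y^2) = a * (x + \<beta> * y)^2 + \<delta> * y^2"
      using assms(1) by (simp add: \<beta>_def \<delta>_def field_simps power2_eq_square)
    have "?f (y, x) = exp (- t * (a * (x + \<beta> * y)^2 + \<delta> * y^2))" by (simp only: prod.case Q)
    also have "\<dots> = exp (- ((t * \<delta>) * (real_of_int y)^2)) * exp (- ((t * a) * (real_of_int x + \<beta> * y)^2))"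
      unfolding exp_add[symmetric] by (simp add: algebra_simps)
    also have "\<dots> = gauss_deriv ?s 0 (real_of_int y + 0) * gauss_deriv ?r 0 (real_of_int x + \<beta> * y)"
      using t d assms(1) by (simp add: gauss_deriv_def power_mult_distrib)
    finally show ?thesis .
  qed
  have gsm: "((\<lambda>x::int. gauss_deriv ?r 0 (real_of_int x + \<gamma>)) has_sum gauss_lattice_sum ?r 0 \<gamma>) UNIV" for \<gamma>
    unfolding gauss_lattice_sum_def by (intro has_sum_infsum gauss_deriv_summable r) auto
  have gsm2: "((\<lambda>y::int. gauss_deriv ?s 0 (real_of_int y + 0)) has_sum gauss_lattice_sum ?s 0 0) UNIV"
    unfolding gauss_lattice_sum_def by (intro has_sum_infsum gauss_deriv_summable r) auto
  have nn: "0 \<le> gauss_deriv q 0 u" for q u by (simp add: gauss_deriv_def)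
  have inner: "((\<lambda>x. ?f (y, x)) has_sum (gauss_deriv ?s 0 (real_of_int y + 0) * gauss_lattice_sum ?r 0 (\<beta> * y))) UNIV" for y
    unfolding f by (intro has_sum_cmult_right gsm)
  have outer: "(\<lambda>y::int. gauss_deriv ?s 0 (real_of_int y + 0) * gauss_lattice_sum ?r 0 (\<beta> * y)) summable_on UNIV"
  proof (rule summable_on_comparison_test)
    show "(\<lambda>y::int. gauss_deriv ?s 0 (real_of_int y + 0) * (2160 * ?r ^ 0 / ?r)) summable_on UNIV"
      by (intro summable_on_cmult_left has_sum_imp_summable[OF gsm2])
    fix y :: int
    have "gauss_lattice_sum ?r 0 (\<beta> * y) \<le> 2160 * ?r ^ 0 / ?r"
      using gauss_deriv_summable(2)[OF r(1,2), of 0 "\<beta> * y"] by linarith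
    thus "gauss_deriv ?s 0 (real_of_int y + 0) * gauss_lattice_sum ?r 0 (\<beta> * y)
       \<le> gauss_deriv ?s 0 (real_of_int y + 0) * (2160 * ?r ^ 0 / ?r)"
      using nn by (intro mult_left_mono) auto
    show "0 \<le> gauss_deriv ?s 0 (real_of_int y + 0) * gauss_lattice_sum ?r 0 (\<beta> * y)"
      using nn by (auto simp: gauss_lattice_sum_def intro!: mult_nonneg_nonneg infsum_nonneg)
  qed
  have sum2: "?f summable_on UNIV \<times> UNIV"
    by (rule summable_on_SigmaI[OF inner outer]) auto
  have hs: "(?f has_sum (\<Sum>\<^sub>\<infinity>y::int. gauss_deriv ?s 0 (real_of_int y + 0) * gauss_lattice_sum ?r 0 (\<beta> * y))) (UNIV \<times> UNIV)"
    by (rule has_sum_SigmaI[OF inner has_sum_infsum[OF outer] sum2])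
  have swap: "((\<lambda>(x, y). exp (- t * real_of_int (a * x^2 + b * x * y + c * y^2))) has_sum S) UNIV \<longleftrightarrow> (?f has_sum S) (UNIV \<times> UNIV)" for S
    by (rule has_sum_reindex_bij_witness[of _ prod.swap prod.swap]) auto
  have hs': "((\<lambda>(x, y). exp (- t * real_of_int (a * x^2 + b * x * y + c * y^2))) has_sum
      (\<Sum>\<^sub>\<infinity>y::int. gauss_deriv ?s 0 (real_of_int y + 0) * gauss_lattice_sum ?r 0 (\<beta> * y))) UNIV"
    unfolding swap by (rule hs)
  thus "(\<lambda>(x, y). exp (- t * real_of_int (a * x^2 + b * x * y + c * y^2))) summable_on UNIV"
    by (rule has_sum_imp_summable)
  have th: "theta a b c t = (\<Sum>\<^sub>\<infinity>y::int. gauss_deriv ?s 0 (real_of_int y + 0) * gauss_lattice_sum ?r 0 (\<beta> * y))"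
    unfolding theta_def by (rule infsumI[OF hs'])
  let ?e = "\<lambda>y::int. gauss_deriv ?s 0 (real_of_int y + 0) * (gauss_lattice_sum ?r 0 (\<beta> * y) - gauss_lattice_sum ?r 0 0)"
  have "((\<lambda>y::int. gauss_deriv ?s 0 (real_of_int y + 0) * gauss_lattice_sum ?r 0 (\<beta> * y) - gauss_deriv ?s 0 (real_of_int y + 0) * gauss_lattice_sum ?r 0 0)
      has_sum (theta a b c t - gauss_lattice_sum ?s 0 0 * gauss_lattice_sum ?r 0 0)) UNIV"
    unfolding th by (intro has_sum_diff_real has_sum_infsum[OF outer] has_sum_cmult_left gsm2)
  hence es: "(?e has_sum (theta a b c t - gauss_lattice_sum ?s 0 0 * gauss_lattice_sum ?r 0 0)) UNIV"
    by (simp add: right_diff_distrib)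
  have maj: "((\<lambda>y::int. gauss_deriv ?s 0 (real_of_int y + 0) * (3240 * (t * a))) has_sum (gauss_lattice_sum ?s 0 0 * (3240 * (t * a)))) UNIV"
    by (intro has_sum_cmult_left gsm2)
  have le: "\<bar>?e y\<bar> \<le> gauss_deriv ?s 0 (real_of_int y + 0) * (3240 * (t * a))" for y
  proof -
    have "?r ^ 2 = t * a" using t assms(1) by simp
    thus ?thesis using gauss_lattice_sum_variation[OF r(1,2), of "\<beta> * y"] nn unfolding abs_mult
      by (intro mult_mono) auto
  qed
  have up: "theta a b c t - gauss_lattice_sum ?s 0 0 * gauss_lattice_sum ?r 0 0 \<le> gauss_lattice_sum ?s 0 0 * (3240 * (t * a))"
    by (rule has_sum_mono[OF es maj]) (use le abs_le_D1 in blast)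
  have "- (theta a b c t - gauss_lattice_sum ?s 0 0 * gauss_lattice_sum ?r 0 0) \<le> gauss_lattice_sum ?s 0 0 * (3240 * (t * a))"
    by (rule has_sum_mono[OF has_sum_uminusI[OF es] maj]) (use le abs_le_D2 in blast)
  with up show "\<bar>theta a b c t - gauss_lattice_sum ?r 0 0 * gauss_lattice_sum ?s 0 0\<bar> \<le> 3240 * (t * a) * gauss_lattice_sum ?s 0 0"
    by (simp add: abs_le_iff mult_ac)
qed

lemma gauss_lattice_sum_le:
  assumes "0 < r" "r \<le> 1"
  shows "0 \<le> gauss_lattice_sum r 0 0" "gauss_lattice_sum r 0 0 \<le> 2160 / r"
proof -
  show "gauss_lattice_sum r 0 0 \<le> 2160 / r"
    using gauss_deriv_summable(2)[OF assms, of 0 0] by simp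
  show "0 \<le> gauss_lattice_sum r 0 0"
    unfolding gauss_lattice_sum_def by (rule infsum_nonneg) (simp add: gauss_deriv_def)
qed

text \<open>With \<open>G(s)\<close> the Gaussian sum of parameter \<open>sqrt s\<close>, \<open>theta\<close> is \<open>G(t a) G(t \<delta>)\<close> up to \<open>O(sqrt t)\<close>, and
\<open>G(s) = 2 G(4 s) + O(s)\<close> while \<open>G(s) = O(1 / sqrt s)\<close>. Hence the product is multiplied by \<open>4\<close>, up to
\<open>O(sqrt t)\<close>, when \<open>4 t\<close> is replaced by \<open>t\<close>.\<close>

lemma theta_limit:
  fixes a b c :: int
  assumes a: "a > 0" and disc: "4 * a * c - b^2 > 0"
  shows "((\<lambda>t. 4 * theta a b c (4 * t) - theta a b c t) \<longlongrightarrow> 0) (at_right 0)"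
proof -
  define \<delta> where "\<delta> = real_of_int (4 * a * c - b^2) / (4 * a)"
  have d: "\<delta> > 0" unfolding \<delta>_def using a disc by (intro divide_pos_pos of_int_0_less_iff[THEN iffD2]) simp_all
  define G where "G = (\<lambda>s. gauss_lattice_sum (sqrt s) 0 0)"
  define A where "A = real_of_int a"
  have A: "A > 0" using a by (simp add: A_def)
  have G0: "0 \<le> G s" and G1: "G s \<le> 2160 / sqrt s" and G2: "\<bar>G s - 2 * G (4 * s)\<bar> \<le> 3240 * (4 * s)"
    if "0 < s" "4 * s \<le> 1" for s
  proof -
    show "0 \<le> G s" "G s \<le> 2160 / sqrt s"
      unfolding G_def by (intro gauss_lattice_sum_le; use that in simp)+
    have half: "sqrt (4 * s) / 2 = sqrt s" by (simp add: real_sqrt_mult)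
    have "0 < sqrt (4 * s)" "sqrt (4 * s) \<le> 1" "(sqrt (4 * s))^2 = 4 * s"
      using that by simp_all
    with gauss_lattice_sum_half[of "sqrt (4 * s)"] show "\<bar>G s - 2 * G (4 * s)\<bar> \<le> 3240 * (4 * s)"
      unfolding G_def half by simp
  qed
  have G4: "0 \<le> G (4 * s)" "G (4 * s) \<le> 2160 / sqrt s" if "0 < s" "4 * s \<le> 1" for s
  proof -
    show "0 \<le> G (4 * s)"
      unfolding G_def by (intro gauss_lattice_sum_le; use that in simp)+
    have "G (4 * s) \<le> 2160 / sqrt (4 * s)"
      unfolding G_def by (intro gauss_lattice_sum_le; use that in simp)+
    also have "\<dots> \<le> 2160 / sqrt s" using that by (intro divide_left_mono) (auto simp: real_sqrt_mult)
    finally show "G (4 * s) \<le> 2160 / sqrt s" .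
  qed
  define e where "e = (\<lambda>t. 3240 * (t * A) * (2160 / sqrt (t * \<delta>)))"
  \<comment> \<open>The errors of \<open>theta\<close> at \<open>4 t\<close> and at \<open>t\<close>, and that of the scaling law for \<open>G(t a) G(t \<delta>)\<close>.\<close>
  define E where "E = (\<lambda>t. 4 * (4 * e t) + e t + (3240 * (4 * (t * A)) * (2160 / sqrt (t * \<delta>))
     + 2 * (2160 / sqrt (t * A)) * (3240 * (4 * (t * \<delta>)))))"
  have bound: "\<bar>4 * theta a b c (4 * t) - theta a b c t\<bar> \<le> E t"
    if t: "0 < t" "4 * (t * A) \<le> 1" "4 * (t * \<delta>) \<le> 1" for t
  proof -
    have tA: "0 < t * A" "0 < t * \<delta>" using t A d by auto
    have th1: "\<bar>theta a b c t - G (t * A) * G (t * \<delta>)\<bar> \<le> e t"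
    proof -
      have "\<bar>theta a b c t - G (t * A) * G (t * \<delta>)\<bar> \<le> 3240 * (t * A) * G (t * \<delta>)"
        unfolding G_def A_def \<delta>_def
        by (rule theta_approx(2)[OF a disc t(1)]; unfold A_def[symmetric] \<delta>_def[symmetric]) (use t tA in linarith)+
      also have "\<dots> \<le> e t" unfolding e_def using G1[of "t * \<delta>"] tA t by (intro mult_left_mono) auto
      finally show ?thesis .
    qed
    have th4: "\<bar>theta a b c (4 * t) - G (4 * (t * A)) * G (4 * (t * \<delta>))\<bar> \<le> 4 * e t"
    proof -
      have "\<bar>theta a b c (4 * t) - G (4 * t * A) * G (4 * t * \<delta>)\<bar> \<le> 3240 * (4 * t * A) * G (4 * t * \<delta>)"
        unfolding G_def A_def \<delta>_def
        by (rule theta_approx(2)[OF a disc mult_pos_pos[OF zero_less_numeral t(1)]]; unfold A_def[symmetric] \<delta>_def[symmetric]) (use t tA in \<open>simp_all add: mult_ac\<close>)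
      also have "\<dots> \<le> 3240 * (4 * t * A) * (2160 / sqrt (t * \<delta>))"
        using G4(2)[of "t * \<delta>"] tA t by (intro mult_left_mono) (auto simp: mult_ac)
      also have "\<dots> = 4 * e t" by (simp add: e_def)
      finally show ?thesis by (simp add: mult_ac)
    qed
    let ?x = "G (t * A)" and ?y = "G (t * \<delta>)" and ?x4 = "G (4 * (t * A))" and ?y4 = "G (4 * (t * \<delta>))"
    \<comment> \<open>Change one factor at a time, so that each small difference meets one large factor.\<close>
    have "?x * ?y - 4 * (?x4 * ?y4) = (?x - 2 * ?x4) * ?y + 2 * ?x4 * (?y - 2 * ?y4)"
      by (simp add: algebra_simps)
    hence "\<bar>?x * ?y - 4 * (?x4 * ?y4)\<bar> \<le> \<bar>(?x - 2 * ?x4) * ?y\<bar> + \<bar>2 * ?x4 * (?y - 2 * ?y4)\<bar>"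
      by (simp add: abs_triangle_ineq)
    also have "\<bar>(?x - 2 * ?x4) * ?y\<bar> \<le> 3240 * (4 * (t * A)) * (2160 / sqrt (t * \<delta>))"
      unfolding abs_mult
      by (rule mult_mono) (use G2[of "t * A"] G0[of "t * \<delta>"] G1[of "t * \<delta>"] t tA in auto)
    also have "\<bar>2 * ?x4 * (?y - 2 * ?y4)\<bar> \<le> 2 * (2160 / sqrt (t * A)) * (3240 * (4 * (t * \<delta>)))"
      unfolding abs_mult
      by (rule mult_mono) (use G2[of "t * \<delta>"] G4[of "t * A"] t tA in auto)
    finally have "\<bar>?x * ?y - 4 * (?x4 * ?y4)\<bar> \<le> 3240 * (4 * (t * A)) * (2160 / sqrt (t * \<delta>))
     + 2 * (2160 / sqrt (t * A)) * (3240 * (4 * (t * \<delta>)))" by simp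
    thus ?thesis using th1 th4 unfolding E_def by linarith
  qed
  have E: "E t = sqrt t * ((17 * 3240 * 2160 + 4 * 3240 * 2160) * (A / sqrt \<delta>) + 8 * 3240 * 2160 * (\<delta> / sqrt A))" if "t > 0" for t
  proof -
    have *: "t / (sqrt t * z) = sqrt t / z" for z
      using that by (metis divide_divide_eq_left real_div_sqrt less_imp_le)
    define P where "P = (t * A) * (2160 / sqrt (t * \<delta>))"
    define R where "R = (2160 / sqrt (t * A)) * (t * \<delta>)"
    have "P = 2160 * (A * (t / (sqrt t * sqrt \<delta>)))" "R = 2160 * (\<delta> * (t / (sqrt t * sqrt A)))"
      by (simp_all add: P_def R_def real_sqrt_mult)
    hence PR: "P = 2160 * (A * (sqrt t / sqrt \<delta>))" "R = 2160 * (\<delta> * (sqrt t / sqrt A))"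
      unfolding * by simp_all
    have "E t = 21 * 3240 * P + 8 * 3240 * R" by (simp add: E_def e_def P_def R_def)
    thus ?thesis unfolding PR by (simp add: algebra_simps)
  qed
  have "((\<lambda>t. sqrt t * ((17 * 3240 * 2160 + 4 * 3240 * 2160) * (A / sqrt \<delta>) + 8 * 3240 * 2160 * (\<delta> / sqrt A))) \<longlongrightarrow>
      sqrt 0 * ((17 * 3240 * 2160 + 4 * 3240 * 2160) * (A / sqrt \<delta>) + 8 * 3240 * 2160 * (\<delta> / sqrt A))) (at_right 0)"
    by (intro tendsto_intros)
  hence lim: "((\<lambda>t. sqrt t * ((17 * 3240 * 2160 + 4 * 3240 * 2160) * (A / sqrt \<delta>) + 8 * 3240 * 2160 * (\<delta> / sqrt A))) \<longlongrightarrow> 0) (at_right 0)"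
    by simp
  define t0 where "t0 = min (1 / (4 * A)) (1 / (4 * \<delta>))"
  have t0: "t0 > 0" using A d by (simp add: t0_def)
  have "\<forall>\<^sub>F t in at_right 0. norm (4 * theta a b c (4 * t) - theta a b c t)
      \<le> sqrt t * ((17 * 3240 * 2160 + 4 * 3240 * 2160) * (A / sqrt \<delta>) + 8 * 3240 * 2160 * (\<delta> / sqrt A))"
    using eventually_at_right_less eventually_at_right_real[OF t0]
  proof eventually_elim
    case (elim t)
    hence "t \<le> 1 / (4 * A)" "t \<le> 1 / (4 * \<delta>)" "t > 0" by (auto simp: t0_def)
    hence "4 * (t * A) \<le> 1" "4 * (t * \<delta>) \<le> 1" using A d by (simp_all add: field_simps)
    thus ?case using bound[of t] E[of t] \<open>t > 0\<close> by simp
  qed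
  thus ?thesis by (rule Lim_null_comparison[OF _ lim])
qed

section \<open>Lambert series with periodic coefficients\<close>

lemma partial_sums_periodic:
  fixes f :: "nat \<Rightarrow> real"
  assumes per: "\<And>n. f (n + N) = f n" and zero: "(\<Sum>n<N. f n) = 0"
  shows "(\<Sum>k<n + N. f k) = (\<Sum>k<n. f k)"
proof (induction n)
  case (Suc n)
  thus ?case using per[of n] by simp
qed (simp add: zero)

lemma periodic_bounded:
  fixes F :: "nat \<Rightarrow> real"
  assumes per: "\<And>n. F (n + N) = F n" and N: "N > 0"
  shows "\<exists>B\<ge>0. \<forall>n. \<bar>F n\<bar> \<le> B"
proof -
  have step: "F (n + k * N) = F n" for n k
    by (induction k) (auto simp: per add.assoc[symmetric] add.commute[of N])
  have "F n = F (n mod N)" for n using step[of "n mod N" "n div N"] by simp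
  moreover have "\<bar>F (n mod N)\<bar> \<le> (\<Sum>k<N. \<bar>F k\<bar>)" for n
    by (rule member_le_sum[of "n mod N" "{..<N}" "\<lambda>k. \<bar>F k\<bar>"]) (use N in auto)
  ultimately show ?thesis by (intro exI[of _ "\<Sum>k<N. \<bar>F k\<bar>"]) (auto intro: sum_nonneg)
qed

lemma summation_by_parts:
  fixes f g :: "nat \<Rightarrow> real"
  shows "(\<Sum>n\<le>M. f n * g n) = (\<Sum>n\<le>M. (\<Sum>k\<le>n. f k) * (g n - g (Suc n))) + (\<Sum>k\<le>M. f k) * g (Suc M)"
  by (induction M) (auto simp: algebra_simps)

text \<open>Two summations by parts. The first replaces \<open>f\<close> by its partial sums, whose mean \<open>L\<close> contributes
\<open>L (g 0)\<close>; the deviations from the mean have bounded partial sums again, so by the second one they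
contribute at most a multiple of the first difference of the convex sequence \<open>g\<close>. The point is that \<open>B\<close>
depends on \<open>f\<close> alone.\<close>

lemma periodic_convex_sum:
  fixes f :: "nat \<Rightarrow> real"
  assumes per: "\<And>n. f (n + N) = f n" and N: "N > 0" and zero: "(\<Sum>n<N. f n) = 0"
  defines "L \<equiv> (\<Sum>n<N. \<Sum>k\<le>n. f k) / N"
  shows "\<exists>B\<ge>0. \<forall>g S. g \<longlonglongrightarrow> 0 \<longrightarrow> (\<forall>n. g (Suc n) - g (Suc (Suc n)) \<le> g n - g (Suc n)) \<longrightarrow>
      (\<lambda>n. f n * g n) sums S \<longrightarrow> \<bar>S - L * g 0\<bar> \<le> B * (g 0 - g 1)"
proof -
  define X where "X = (\<lambda>n. \<Sum>k\<le>n. f k)"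
  have Xper: "X (n + N) = X n" for n
    unfolding X_def using partial_sums_periodic[OF per zero, of "Suc n"] by (simp add: lessThan_Suc_atMost)
  define x where "x = (\<lambda>n. X n - L)"
  have xper: "x (n + N) = x n" for n by (simp add: x_def Xper)
  have xzero: "(\<Sum>n<N. x n) = 0"
    unfolding x_def using N by (simp add: sum_subtractf L_def X_def)
  obtain B where B: "B \<ge> 0" "\<And>n. \<bar>\<Sum>k<n. x k\<bar> \<le> B"
    using periodic_bounded[of "\<lambda>n. \<Sum>k<n. x k" N, OF partial_sums_periodic[OF xper xzero] N] by blast
  obtain B' where B': "B' \<ge> 0" "\<And>n. \<bar>X n\<bar> \<le> B'"
    using periodic_bounded[of X N, OF Xper N] by blast
  show ?thesis
  proof (intro exI[of _ B] conjI B allI impI)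
    fix g :: "nat \<Rightarrow> real" and S
    assume g: "g \<longlonglongrightarrow> 0" and conv: "\<forall>n. g (Suc n) - g (Suc (Suc n)) \<le> g n - g (Suc n)"
      and S: "(\<lambda>n. f n * g n) sums S"
    define D where "D = (\<lambda>n. g n - g (Suc n))"
    have D: "D (Suc n) \<le> D n" for n using conv by (simp add: D_def)
    have "D \<longlonglongrightarrow> 0 - 0" unfolding D_def by (intro tendsto_intros g LIMSEQ_Suc)
    hence D0: "D n \<ge> 0" for n
      using decseq_ge[of D 0 n] D by (simp add: decseq_SucI)
    have Deq: "(\<Sum>n\<le>M. D n) = g 0 - g (Suc M)" for M by (induction M) (auto simp: D_def)
    have "\<bar>(\<Sum>n\<le>M. f n * g n) - L * g 0\<bar> \<le> B * D 0 + (\<bar>L\<bar> + B') * \<bar>g (Suc M)\<bar>" for M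
    proof -
      have "(\<Sum>n\<le>M. f n * g n) = (\<Sum>n\<le>M. X n * D n) + X M * g (Suc M)"
        unfolding X_def D_def by (rule summation_by_parts)
      also have "(\<Sum>n\<le>M. X n * D n) = (\<Sum>n\<le>M. x n * D n) + L * (g 0 - g (Suc M))"
        unfolding x_def Deq[symmetric] by (simp add: algebra_simps sum_distrib_left sum.distrib[symmetric])
      finally have eq: "(\<Sum>n\<le>M. f n * g n) - L * g 0 = (\<Sum>n\<le>M. x n * D n) + (X M - L) * g (Suc M)"
        by (simp add: algebra_simps)
      have "\<bar>\<Sum>n\<le>M. x n * D n\<bar> \<le> B * D 0"
      proof -
        have sl: "\<bar>\<Sum>k\<le>n. x k\<bar> \<le> B" for n using B(2)[of "Suc n"] by (simp add: lessThan_Suc_atMost)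
        have "\<bar>\<Sum>n\<le>M. x n * D n\<bar> \<le> \<bar>\<Sum>n\<le>M. (\<Sum>k\<le>n. x k) * (D n - D (Suc n))\<bar> + \<bar>(\<Sum>k\<le>M. x k) * D (Suc M)\<bar>"
          unfolding summation_by_parts[of x D M] by (rule abs_triangle_ineq)
        also have "\<bar>\<Sum>n\<le>M. (\<Sum>k\<le>n. x k) * (D n - D (Suc n))\<bar> \<le> (\<Sum>n\<le>M. B * (D n - D (Suc n)))"
          by (rule order_trans[OF sum_abs sum_mono])
             (use sl D B(1) in \<open>auto simp: abs_mult intro!: mult_mono\<close>)
        also have "(\<Sum>n\<le>M. B * (D n - D (Suc n))) = B * (D 0 - D (Suc M))"
          by (induction M) (auto simp: algebra_simps)
        also have "\<bar>(\<Sum>k\<le>M. x k) * D (Suc M)\<bar> \<le> B * D (Suc M)"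
          unfolding abs_mult using sl D0 by (intro mult_mono) (auto simp: B)
        finally show ?thesis by (simp add: algebra_simps)
      qed
      moreover have "\<bar>(X M - L) * g (Suc M)\<bar> \<le> (\<bar>L\<bar> + B') * \<bar>g (Suc M)\<bar>"
        unfolding abs_mult using B'(2)[of M] by (intro mult_right_mono) auto
      ultimately show ?thesis unfolding eq by linarith
    qed
    moreover have "(\<lambda>M. \<bar>(\<Sum>n\<le>M. f n * g n) - L * g 0\<bar>) \<longlonglongrightarrow> \<bar>S - L * g 0\<bar>"
      using S unfolding sums_def_le by (intro tendsto_intros)
    moreover have "(\<lambda>M. B * D 0 + (\<bar>L\<bar> + B') * \<bar>g (Suc M)\<bar>) \<longlonglongrightarrow> B * D 0 + (\<bar>L\<bar> + B') * \<bar>0\<bar>"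
      by (intro tendsto_intros LIMSEQ_Suc g)
    ultimately have "\<bar>S - L * g 0\<bar> \<le> B * D 0 + (\<bar>L\<bar> + B') * \<bar>0\<bar>"
      by (intro LIMSEQ_le) auto
    thus "\<bar>S - L * g 0\<bar> \<le> B * (g 0 - g 1)" by (simp add: D_def)
  qed
qed

definition fermi :: "real \<Rightarrow> real" where "fermi u = 1 / (exp u + 1)"

lemma fermi_convex:
  assumes "u \<ge> 0" "h \<ge> 0"
  shows "fermi (u + h) - fermi (u + 2 * h) \<le> fermi u - fermi (u + h)"
proof -
  define x r where "x = exp u" and "r = exp h"
  have x: "x \<ge> 1" "r \<ge> 1" using assms by (simp_all add: x_def r_def)
  have e: "exp (u + h) = x * r" "exp (u + 2 * h) = x * r^2"
    by (simp_all add: x_def r_def exp_add exp_double)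
  have pos: "x + 1 > 0" "x * r + 1 > 0" "x * r^2 + 1 > 0" using x by (auto intro!: add_nonneg_pos)
  have "1 / (x + 1) + 1 / (x * r^2 + 1) - 2 / (x * r + 1)
      = x * (1 - r)^2 * (x * r - 1) / ((x + 1) * (x * r^2 + 1) * (x * r + 1))"
  proof -
    have "1 / a + 1 / b - 2 / c = (b * c + a * c - 2 * a * b) / (a * b * c)"
      if "a > 0" "b > 0" "c > 0" for a b c :: real
      using that by (simp add: field_simps)
    from this[OF pos(1,3,2)] have "1 / (x + 1) + 1 / (x * r^2 + 1) - 2 / (x * r + 1)
      = ((x * r^2 + 1) * (x * r + 1) + (x + 1) * (x * r + 1) - 2 * (x + 1) * (x * r^2 + 1))
        / ((x + 1) * (x * r^2 + 1) * (x * r + 1))" .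
    also have "(x * r^2 + 1) * (x * r + 1) + (x + 1) * (x * r + 1) - 2 * (x + 1) * (x * r^2 + 1)
      = x * (1 - r)^2 * (x * r - 1)"
      by (simp add: power2_eq_square algebra_simps)
    finally show ?thesis .
  qed
  also have "\<dots> \<ge> 0"
    using pos x mult_mono[of 1 x 1 r] by (intro divide_nonneg_nonneg mult_nonneg_nonneg) auto
  finally show ?thesis unfolding fermi_def e x_def[symmetric] by simp
qed

text \<open>The combination that cancels the pole of \<open>1 / (exp u - 1)\<close> at \<open>0\<close>.\<close>

lemma lambert_fermi:
  assumes "u > 0"
  shows "1 / (exp u - 1) - 4 / (exp (4 * u) - 1) = fermi u + 2 * fermi (2 * u)"
proof -
  define x where "x = exp u"
  have x: "x > 1" using assms by (simp add: x_def)
  have e: "exp (2 * u) = x^2" "exp (4 * u) = x^4"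
    by (simp_all add: x_def exp_of_nat_mult[symmetric])
  have nz: "x - 1 \<noteq> 0" "x^4 - 1 \<noteq> 0" "x + 1 \<noteq> 0" "x^2 + 1 \<noteq> 0"
  proof -
    show "x - 1 \<noteq> 0" "x + 1 \<noteq> 0" using x by auto
    show "x^4 - 1 \<noteq> 0" using one_less_power[OF x, of 4] by linarith
    show "x^2 + 1 \<noteq> 0" using zero_le_power2[of x] by linarith
  qed
  have f: "x^4 - 1 = (x - 1) * (x + 1) * (x^2 + 1)" by (simp add: algebra_simps eval_nat_numeral)
  have p: "1 / p - 4 / (p * q * r) = 1 / q + 2 * (1 / r)"
    if "p \<noteq> 0" "q \<noteq> 0" "r \<noteq> 0" "q * r - 4 = p * r + 2 * (p * q)" for p q r :: real
  proof -
    have "1 / p - 4 / (p * q * r) = (q * r - 4) / (p * q * r)"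
      using that(1-3) by (simp add: divide_simps)
    also have "\<dots> = 1 / q + 2 * (1 / r)"
      unfolding that(4) using that(1-3) by (simp add: divide_simps) (simp add: algebra_simps)
    finally show ?thesis .
  qed
  show ?thesis unfolding fermi_def e x_def[symmetric] f
    by (rule p) (use nz in \<open>simp_all add: power2_eq_square algebra_simps\<close>)
qed

text \<open>Expand \<open>1 / (exp (d t) - 1)\<close> as a geometric series and collect the pairs \<open>(d, m)\<close> with the same
product.\<close>

lemma lambert_series:
  fixes f :: "nat \<Rightarrow> real"
  assumes f: "\<And>n. \<bar>f n\<bar> \<le> 1" and t: "t > 0"
  shows "((\<lambda>n::nat. (\<Sum>d | d dvd n. f d) * exp (- t * real n)) has_sum (\<Sum>\<^sub>\<infinity>d\<in>{1..}. f d / (exp (d * t) - 1))) {1..}"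
    and "(\<lambda>d. f d / (exp (d * t) - 1)) summable_on {1..}"
proof -
  let ?P = "{1::nat..} \<times> {1::nat..}"
  let ?F = "\<lambda>(d::nat, m::nat). f d * exp (- t * (d * m))"
  define q where "q = exp (- t)"
  have q: "0 < q" "q < 1" using t by (simp_all add: q_def)
  have pw: "exp (- t * real n) = q ^ n" for n
    unfolding q_def exp_of_nat_mult[symmetric] by (simp add: mult.commute)
  have geo: "((\<lambda>n::nat. q ^ n) has_sum (q / (1 - q))) {1..}"
    using has_sum_geometric_from_1[of q] q by simp
  have "(\<lambda>(d::nat, m::nat). exp t * (q ^ d * q ^ m)) summable_on ?P"
  proof (rule summable_on_SigmaI)
    show "((\<lambda>m. (\<lambda>(d::nat, m::nat). exp t * (q ^ d * q ^ m)) (d, m)) has_sum (exp t * (q ^ d * (q / (1 - q))))) {1..}" for d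
      unfolding prod.case by (intro has_sum_cmult_right geo)
    show "(\<lambda>d. exp t * (q ^ d * (q / (1 - q)))) summable_on {1..}"
      by (intro summable_on_cmult_right summable_on_cmult_left has_sum_imp_summable[OF geo])
  qed (use q in auto)
  hence "(\<lambda>z. norm (?F z)) summable_on ?P"
  proof (rule summable_on_comparison_test)
    fix z assume "z \<in> ?P"
    then obtain d m where z: "z = (d, m)" "d \<ge> 1" "m \<ge> 1" by auto
    have "0 \<le> (real d - 1) * (real m - 1)" using z by (intro mult_nonneg_nonneg) auto
    hence "real d + real m - 1 \<le> real (d * m)" by (simp add: algebra_simps)
    hence "t * (real d + real m - 1) \<le> t * real (d * m)" using t by (intro mult_left_mono) auto
    hence "exp (- t * real (d * m)) \<le> exp (t + (- t * real d + - t * real m))"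
      by (simp add: algebra_simps)
    also have "\<dots> = exp t * (q ^ d * q ^ m)" unfolding exp_add pw ..
    finally have "exp (- t * real (d * m)) \<le> exp t * (q ^ d * q ^ m)" .
    moreover have "\<bar>f d\<bar> * exp (- t * real (d * m)) \<le> 1 * exp (- t * real (d * m))"
      using f by (intro mult_right_mono) auto
    ultimately have "\<bar>f d\<bar> * exp (- t * real (d * m)) \<le> exp t * (q ^ d * q ^ m)" by linarith
    thus "norm (?F z) \<le> (case z of (d, m) \<Rightarrow> exp t * (q ^ d * q ^ m))"
      by (simp add: z abs_mult)
  qed simp
  hence sm: "?F summable_on ?P" by (rule abs_summable_summable)
  have inner: "((\<lambda>m. ?F (d, m)) has_sum (f d / (exp (d * t) - 1))) {1..}" if "d \<in> {1..}" for d
  proof -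
    define z where "z = exp (- t * d)"
    have z: "0 < z" "z < 1" using that t by (simp_all add: z_def)
    have zi: "exp (d * t) = 1 / z" by (simp add: z_def exp_minus field_simps)
    have "exp (- t * real (d * m)) = z ^ m" for m
      unfolding z_def exp_of_nat_mult[symmetric] by (simp add: mult_ac)
    moreover have "z / (1 - z) = 1 / (exp (d * t) - 1)"
      unfolding zi using z by (simp add: field_simps)
    moreover have "((\<lambda>m. f d * z ^ m) has_sum (f d * (z / (1 - z)))) {1..}"
      using has_sum_geometric_from_1[of z] z by (intro has_sum_cmult_right) simp
    ultimately show ?thesis by simp
  qed
  have hs: "((\<lambda>d. f d / (exp (d * t) - 1)) has_sum (infsum ?F ?P)) {1..}"
    by (rule has_sum_SigmaD[where f = ?F, OF has_sum_infsum[OF sm] inner])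
  thus "(\<lambda>d. f d / (exp (d * t) - 1)) summable_on {1..}" by (rule has_sum_imp_summable)
  let ?Q = "SIGMA n:{1::nat..}. {d. d dvd n}"
  let ?H = "\<lambda>(n::nat, d::nat). f d * exp (- t * n)"
  have "(?F has_sum (infsum ?F ?P)) ?P \<longleftrightarrow> (?H has_sum (infsum ?F ?P)) ?Q"
  proof (rule has_sum_reindex_bij_witness[where i = "\<lambda>(n, d). (d, n div d)" and j = "\<lambda>(d, m). (d * m, d)"])
    fix b assume "b \<in> ?Q"
    then obtain n d where b: "b = (n, d)" "n \<ge> 1" "d dvd n" by auto
    hence "d > 0" "n div d > 0" by (auto intro!: Nat.gr0I simp: dvd_div_eq_0_iff)
    thus "(case b of (n, d) \<Rightarrow> (d, n div d)) \<in> ?P" using b by auto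
    show "(case case b of (n, d) \<Rightarrow> (d, n div d) of (d, m) \<Rightarrow> (d * m, d)) = b" using b by simp
  qed auto
  hence "(?H has_sum (infsum ?F ?P)) ?Q" using has_sum_infsum[OF sm] by blast
  moreover have "((\<lambda>d. ?H (n, d)) has_sum ((\<Sum>d | d dvd n. f d) * exp (- t * n))) {d. d dvd n}" if "n \<in> {1..}" for n
    unfolding prod.case sum_distrib_right by (rule has_sum_finite) (use that in auto)
  ultimately have "((\<lambda>n::nat. (\<Sum>d | d dvd n. f d) * exp (- t * real n)) has_sum (infsum ?F ?P)) {1..}"
    by (rule has_sum_SigmaD)
  thus "((\<lambda>n::nat. (\<Sum>d | d dvd n. f d) * exp (- t * real n)) has_sum (\<Sum>\<^sub>\<infinity>d\<in>{1..}. f d / (exp (d * t) - 1))) {1..}"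
    using hs by (simp add: infsumI)
qed

text \<open>By \<open>lambert_fermi\<close> the difference is a sum of \<open>f\<close> against values at the points \<open>n t\<close> of a convex function
that is \<open>3/2\<close> at \<open>0\<close>, so \<open>periodic_convex_sum\<close> applies; its error term tends to \<open>0\<close> by continuity.\<close>

lemma lambert_limit:
  fixes f :: "nat \<Rightarrow> real"
  assumes f: "\<And>n. \<bar>f n\<bar> \<le> 1" and f0: "f 0 = 0"
    and per: "\<And>n. f (n + N) = f n" and N: "N > 0" and zero: "(\<Sum>n<N. f n) = 0"
  defines "A \<equiv> \<lambda>t. \<Sum>\<^sub>\<infinity>d\<in>{1..}. f d / (exp (real d * t) - 1)"
  shows "((\<lambda>t. A t - 4 * A (4 * t)) \<longlongrightarrow> 3 / 2 * ((\<Sum>n<N. \<Sum>k\<le>n. f k) / N)) (at_right 0)"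
proof -
  define L where "L = (\<Sum>n<N. \<Sum>k\<le>n. f k) / N"
  define g where "g = (\<lambda>t n. fermi (real n * t) + 2 * fermi (2 * (real n * t)))"
  from periodic_convex_sum[OF per N zero, folded L_def] obtain B where B: "B \<ge> 0"
    "\<And>g S. g \<longlonglongrightarrow> 0 \<Longrightarrow> (\<forall>n. g (Suc n) - g (Suc (Suc n)) \<le> g n - g (Suc n)) \<Longrightarrow>
      (\<lambda>n. f n * g n) sums S \<Longrightarrow> \<bar>S - L * g 0\<bar> \<le> B * (g 0 - g 1)" by blast
  have bd: "\<bar>(A t - 4 * A (4 * t)) - L * g t 0\<bar> \<le> B * (g t 0 - g t 1)" if t: "t > 0" for t
  proof (rule B(2))
    show "g t \<longlonglongrightarrow> 0"
    proof -
      have lim: "(\<lambda>n. fermi (c * real n)) \<longlonglongrightarrow> 0" if "c > 0" for c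
      proof -
        have "filterlim (\<lambda>n. c * real n) at_top sequentially"
          by (rule filterlim_tendsto_pos_mult_at_top[OF tendsto_const that filterlim_real_sequentially])
        hence "filterlim (\<lambda>n. exp (c * real n)) at_top sequentially"
          by (rule filterlim_compose[OF exp_at_top])
        hence "filterlim (\<lambda>n. exp (c * real n) + 1) at_top sequentially"
          by (rule filterlim_at_top_mono) simp
        thus ?thesis unfolding fermi_def
          by (intro tendsto_divide_0[OF tendsto_const] filterlim_at_top_imp_at_infinity)
      qed
      have "(\<lambda>n. fermi (t * real n) + 2 * fermi ((2 * t) * real n)) \<longlonglongrightarrow> 0 + 2 * 0"
        by (intro tendsto_intros lim) (use t in auto)
      thus ?thesis by (simp add: g_def [abs_def] mult_ac)
    qed
    show "\<forall>n. g t (Suc n) - g t (Suc (Suc n)) \<le> g t n - g t (Suc n)"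
    proof
      fix n :: nat
      have "fermi (n * t + t) - fermi (n * t + 2 * t) \<le> fermi (n * t) - fermi (n * t + t)"
        using t by (intro fermi_convex) simp_all
      moreover have "fermi (2 * (n * t) + 2 * t) - fermi (2 * (n * t) + 2 * (2 * t)) \<le> fermi (2 * (n * t)) - fermi (2 * (n * t) + 2 * t)"
        using t by (intro fermi_convex) simp_all
      ultimately show "g t (Suc n) - g t (Suc (Suc n)) \<le> g t n - g t (Suc n)"
        by (simp add: g_def algebra_simps)
    qed
    have "((\<lambda>d. f d / (exp (d * t) - 1) - 4 * (f d / (exp (d * (4 * t)) - 1))) has_sum (A t - 4 * A (4 * t))) {1..}"
      unfolding A_def using t
      by (intro has_sum_diff_real has_sum_cmult_right has_sum_infsum lambert_series(2) f) auto
    also have "?this \<longleftrightarrow> ((\<lambda>d. f d * g t d) has_sum (A t - 4 * A (4 * t))) UNIV"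
    proof (rule has_sum_cong_neutral)
      fix d assume "d \<in> {1::nat..} \<inter> UNIV"
      hence "real d * t > 0" using t by simp
      from lambert_fermi[OF this]
      have gd: "g t d = 1 / (exp (d * t) - 1) - 4 / (exp (d * (4 * t)) - 1)" by (simp add: g_def mult_ac)
      thus "f d / (exp (d * t) - 1) - 4 * (f d / (exp (d * (4 * t)) - 1)) = f d * g t d"
        unfolding gd by (simp add: right_diff_distrib)
    next
      fix d assume "d \<in> UNIV - {1::nat..}"
      hence "d = 0" by auto
      thus "f d * g t d = 0" using f0 by simp
    qed auto
    finally show "(\<lambda>d. f d * g t d) sums (A t - 4 * A (4 * t))" by (rule has_sum_imp_sums)
  qed
  have g0: "g t 0 = 3 / 2" for t by (simp add: g_def fermi_def)
  have "((\<lambda>t. B * (3 / 2 - (1 / (exp t + 1) + 2 * (1 / (exp (2 * t) + 1))))) \<longlongrightarrow>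
      B * (3 / 2 - (1 / (exp 0 + 1) + 2 * (1 / (exp (2 * 0) + 1))))) (at_right 0)"
    by (intro tendsto_intros) auto
  hence lim: "((\<lambda>t. B * (g t 0 - g t 1)) \<longlongrightarrow> 0) (at_right 0)"
    unfolding g0 by (simp add: g_def fermi_def)
  have "((\<lambda>t. (A t - 4 * A (4 * t)) - L * (3 / 2)) \<longlongrightarrow> 0) (at_right 0)"
  proof (rule Lim_null_comparison[OF _ lim])
    show "\<forall>\<^sub>F t in at_right 0. norm ((A t - 4 * A (4 * t)) - L * (3 / 2)) \<le> B * (g t 0 - g t 1)"
      using eventually_at_right_less by eventually_elim (use bd in \<open>simp add: g0\<close>)
  qed
  from tendsto_add[OF this tendsto_const[of "L * (3 / 2)"]] show ?thesis
    by (simp add: L_def mult.commute)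
qed

section \<open>The ring of integers of an imaginary quadratic field\<close>

text \<open>If \<open>x = a/b\<close> in lowest terms then every power of \<open>b\<close> divides \<open>d\<close>.\<close>

lemma Ints_of_bounded_denominator:
  fixes x :: real
  assumes "x \<in> \<rat>" "d > 0" "\<And>k. real d * x ^ k \<in> \<int>"
  shows "x \<in> \<int>"
proof -
  from assms(1) obtain a b where ab: "b > 0" "coprime a b" "x = of_int a / of_int b"
    by (rule Rats_cases')
  have dv: "b ^ k dvd int d" for k
  proof -
    obtain z where z: "real d * x ^ k = of_int z" using assms(3)[of k] by (auto elim: Ints_cases)
    hence "real_of_int (int d * a ^ k) = real_of_int (z * b ^ k)"
      using ab by (simp add: power_divide field_simps)
    hence "int d * a ^ k = z * b ^ k" by (simp only: of_int_eq_iff)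
    hence "b ^ k dvd int d * a ^ k" by simp
    moreover have "coprime (b ^ k) (a ^ k)" using ab(2) by (simp add: coprime_commute)
    ultimately show ?thesis by (simp add: coprime_dvd_mult_left_iff)
  qed
  have "b < 2"
  proof (rule ccontr)
    assume "\<not> b < 2"
    have "int d < 2 ^ d" using less_exp[of d] by (metis of_nat_less_iff of_nat_numeral of_nat_power)
    also have "(2::int) ^ d \<le> b ^ d" using \<open>\<not> b < 2\<close> by (intro power_mono) auto
    also have "b ^ d \<le> int d" using dv[of d] assms(2) by (intro zdvd_imp_le) auto
    finally show False by simp
  qed
  thus ?thesis using ab by (cases "b = 1") auto
qed

lemma squarefree_mult_square_Ints:
  fixes x :: real
  assumes "squarefree (N::nat)" "x \<in> \<rat>" "real N * x^2 \<in> \<int>"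
  shows "x \<in> \<int>"
proof -
  from assms(2) obtain a b where ab: "b > 0" "coprime a b" "x = of_int a / of_int b"
    by (rule Rats_cases')
  obtain z where z: "real N * x ^ 2 = of_int z" using assms(3) by (auto elim: Ints_cases)
  hence "real_of_int (int N * a ^ 2) = real_of_int (z * b ^ 2)"
    using ab by (simp add: power_divide field_simps)
  hence "int N * a ^ 2 = z * b ^ 2" by (simp only: of_int_eq_iff)
  hence "b ^ 2 dvd int N * a ^ 2" by simp
  moreover have "coprime (b ^ 2) (a ^ 2)" using ab(2) by (simp add: coprime_commute)
  ultimately have "b ^ 2 dvd int N" by (simp add: coprime_dvd_mult_left_iff)
  hence "int (nat b ^ 2) dvd int N" using ab(1) by simp
  hence "nat b ^ 2 dvd N" by (simp only: int_dvd_int_iff)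
  hence "nat b dvd 1" using assms(1) by (auto simp: squarefree_def)
  hence "b = 1" using ab(1) by simp
  thus ?thesis using ab by simp
qed

lemma Ints_common_denominator:
  assumes "finite A" "\<And>x. x \<in> A \<Longrightarrow> x \<in> \<rat>"
  shows "\<exists>d::nat. d > 0 \<and> (\<forall>x\<in>A. real d * x \<in> \<int>)"
  using assms
proof (induction A rule: finite_induct)
  case empty
  thus ?case by (intro exI[of _ 1]) auto
next
  case (insert x A)
  then obtain d where d: "d > 0" "\<forall>x\<in>A. real d * x \<in> \<int>" by auto
  have "x \<in> \<rat>" using insert.prems by simp
  then obtain a b where ab: "b > 0" "coprime a b" "x = of_int a / of_int b" by (rule Rats_cases')
  have bb: "real (nat b) = of_int b" using ab(1) by simp
  have "real (nat b * d) * y \<in> \<int>" if "y \<in> insert x A" for y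
  proof (cases "y = x")
    case True
    have "real (nat b * d) * x = of_int (int d * a)" using ab bb by simp
    thus ?thesis using True by (metis Ints_of_int)
  next
    case False
    hence "real d * y \<in> \<int>" using that d by auto
    hence "of_int b * (real d * y) \<in> \<int>" by simp
    thus ?thesis using bb by (simp add: mult_ac)
  qed
  thus ?case using d ab by (intro exI[of _ "nat b * d"]) auto
qed

text \<open>
The field is that of \<open>sqrt (-N)\<close>, and \<open>m\<close> is the norm of \<open>(1 + sqrt (-N))/2\<close>. The bound on \<open>N\<close> excludes the field
of \<open>sqrt (-3)\<close>, which has six units.
\<close>

locale imag_quadratic =
  fixes N :: nat and m :: int
  assumes m_eq: "4 * m = int N + 1" and squarefree_N: "squarefree N" and N_gt: "N > 4"
begin

definition omega :: complex where "omega = Complex (1 / 2) (sqrt (real N) / 2)"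

text \<open>The coordinates of \<open>z\<close> with respect to the real basis \<open>1, \<omega>\<close> of the complex numbers. The field is the set of
points with rational coordinates, its ring of integers (as it turns out) that of points with integral
coordinates.\<close>

definition cP :: "complex \<Rightarrow> real" where "cP z = Re z - Im z / sqrt (real N)"
definition cQ :: "complex \<Rightarrow> real" where "cQ z = 2 * Im z / sqrt (real N)"

lemma N_pos [simp]: "N > 0" "N \<noteq> 0"
  using N_gt by auto

lemma sqrt_N [simp]: "sqrt (real N) > 0" "sqrt (real N) \<noteq> 0" "sqrt (real N) * sqrt (real N) = real N"
  using N_gt by auto

lemma m_real: "real_of_int m = (real N + 1) / 4"
proof -
  have "real_of_int (4 * m) = real_of_int (int N + 1)" using m_eq by simp
  thus ?thesis by simp
qed

lemma coords: "z = of_real (cP z) + of_real (cQ z) * omega"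
  by (auto simp: complex_eq_iff cP_def cQ_def omega_def field_simps)

lemma coords_iff: "z = w \<longleftrightarrow> cP z = cP w \<and> cQ z = cQ w"
  using coords by metis

lemma coords_add [simp]: "cP (z + w) = cP z + cP w" "cQ (z + w) = cQ z + cQ w"
  by (simp_all add: cP_def cQ_def add_divide_distrib)

lemma coords_diff [simp]: "cP (z - w) = cP z - cP w" "cQ (z - w) = cQ z - cQ w"
  by (simp_all add: cP_def cQ_def diff_divide_distrib)

lemma coords_uminus [simp]: "cP (- z) = - cP z" "cQ (- z) = - cQ z"
  by (simp_all add: cP_def cQ_def)

lemma coords_of_real [simp]: "cP (of_real x) = x" "cQ (of_real x) = 0"
  by (simp_all add: cP_def cQ_def)

lemma coords_consts [simp]: "cP 0 = 0" "cQ 0 = 0" "cP 1 = 1" "cQ 1 = 0"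
    "cP (of_int k) = of_int k" "cQ (of_int k) = 0" "cP (of_nat n) = of_nat n" "cQ (of_nat n) = 0"
    "cP (numeral w) = numeral w" "cQ (numeral w) = 0"
  by (simp_all add: cP_def cQ_def)

lemma coords_omega [simp]: "cP omega = 0" "cQ omega = 1"
  by (simp_all add: cP_def cQ_def omega_def)

text \<open>Read off from \<open>\<omega>\<^sup>2 = \<omega> - m\<close>.\<close>

lemma coords_mult: "cP (z * w) = cP z * cP w - of_int m * cQ z * cQ w"
    "cQ (z * w) = cP z * cQ w + cQ z * cP w + cQ z * cQ w"
proof -
  define s where "s = sqrt (real N)"
  have s: "s > 0" "real N = s * s" by (simp_all add: s_def)
  show "cP (z * w) = cP z * cP w - of_int m * cQ z * cQ w"
       "cQ (z * w) = cP z * cQ w + cQ z * cP w + cQ z * cQ w"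
    unfolding cP_def cQ_def m_real unfolding s_def[symmetric] s(2)
    using s(1) by (simp_all add: field_simps)
qed

lemma coords_scale [simp]: "cP (of_real x * z) = x * cP z" "cQ (of_real x * z) = x * cQ z"
  by (simp_all add: coords_mult)

lemma coords_scale_int [simp]: "cP (of_int x * z) = of_int x * cP z" "cQ (of_int x * z) = of_int x * cQ z"
  by (simp_all add: coords_mult)

lemma coords_scale_nat [simp]: "cP (of_nat x * z) = of_nat x * cP z" "cQ (of_nat x * z) = of_nat x * cQ z"
  by (simp_all add: coords_mult)

lemma coords_cnj: "cP (cnj z) = cP z + cQ z" "cQ (cnj z) = - cQ z"
  by (simp_all add: cP_def cQ_def)

lemma coords_norm: "(cmod z)^2 = cP z ^ 2 + cP z * cQ z + of_int m * cQ z ^ 2"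
proof -
  have "complex_of_real ((cmod z)^2) = z * cnj z" by (rule complex_norm_square)
  hence "(cmod z)^2 = cP (z * cnj z)" by (metis coords_of_real(1))
  thus ?thesis by (simp add: coords_mult coords_cnj power2_eq_square algebra_simps)
qed

lemma coords_Re: "2 * Re z = 2 * cP z + cQ z" by (simp add: cP_def cQ_def)

lemma Im_cnj_mult: "Im (cnj u * v) = (cP u * cQ v - cQ u * cP v) * (sqrt (real N) / 2)"
proof -
  have "cQ (cnj u * v) = cP u * cQ v - cQ u * cP v"
    by (simp add: coords_mult coords_cnj algebra_simps)
  moreover have "Im w = cQ w * (sqrt (real N) / 2)" for w by (simp add: cQ_def)
  ultimately show ?thesis by (simp only:)
qed

abbreviation K :: "complex set" where "K \<equiv> quadratic_field (- int N)"
abbreviation OK :: "complex set" where "OK \<equiv> ring_of_integers (- int N)"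

lemma K_iff: "z \<in> K \<longleftrightarrow> cP z \<in> \<rat> \<and> cQ z \<in> \<rat>"
proof -
  have cs: "csqrt (of_int (- int N)) = \<i> * of_real (sqrt (real N))" by simp
  have el: "of_rat a + of_rat b * csqrt (of_int (- int N)) = of_real (of_rat a) + of_real (of_rat b) * (\<i> * of_real (sqrt (real N)))" for a b
    unfolding cs by (cases a, cases b) (simp add: of_rat_rat)
  have PQ: "cP (of_real p + of_real q * (\<i> * of_real (sqrt (real N)))) = p - q"
      "cQ (of_real p + of_real q * (\<i> * of_real (sqrt (real N)))) = 2 * q" for p q
    by (simp_all add: cP_def cQ_def)
  show ?thesis
  proof
    assume "z \<in> K"
    then obtain a b where "z = of_rat a + of_rat b * csqrt (of_int (- int N))"
      unfolding quadratic_field_def by blast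
    thus "cP z \<in> \<rat> \<and> cQ z \<in> \<rat>" unfolding el by (simp only: PQ) simp
  next
    assume *: "cP z \<in> \<rat> \<and> cQ z \<in> \<rat>"
    hence "cP z + cQ z / 2 \<in> \<rat>" "cQ z / 2 \<in> \<rat>" by simp_all
    then obtain a b where ab: "cP z + cQ z / 2 = of_rat a" "cQ z / 2 = of_rat b"
      by (metis Rats_cases)
    have "z = of_real (of_rat a) + of_real (of_rat b) * (\<i> * of_real (sqrt (real N)))"
      unfolding coords_iff PQ using ab by simp
    thus "z \<in> K" unfolding quadratic_field_def el[symmetric] by blast
  qed
qed

lemma K_closed:
  "z \<in> K \<Longrightarrow> w \<in> K \<Longrightarrow> z + w \<in> K" "z \<in> K \<Longrightarrow> w \<in> K \<Longrightarrow> z * w \<in> K"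
  "z \<in> K \<Longrightarrow> inverse z \<in> K" "of_int k \<in> K" "of_nat n \<in> K" "1 \<in> K"
proof -
  show "z \<in> K \<Longrightarrow> w \<in> K \<Longrightarrow> z + w \<in> K" "z \<in> K \<Longrightarrow> w \<in> K \<Longrightarrow> z * w \<in> K" "of_int k \<in> K" "of_nat n \<in> K" "1 \<in> K"
    by (simp_all add: K_iff coords_mult)
  assume z: "z \<in> K"
  have "(cmod z)^2 \<in> \<rat>" using z by (simp add: K_iff coords_norm)
  moreover have "inverse z = of_real (inverse ((cmod z)^2)) * cnj z"
    using complex_norm_square[of z] by (cases "z = 0") (simp_all add: field_simps)
  ultimately show "inverse z \<in> K" using z by (simp only: K_iff coords_scale coords_cnj) simp
qed

text \<open>The powers of an algebraic integer have coordinates of bounded denominator, as the monic equation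
expresses all of them by finitely many; the same holds for the powers of \<open>z + 1\<close>. As the norm is
multiplicative, \<open>Ints_of_bounded_denominator\<close> shows that the norms of \<open>z\<close> and \<open>z + 1\<close>, hence also the trace
of \<open>z\<close>, are integers. The rest is the classical computation with the discriminant.\<close>

lemma OK_integral_subset:
  assumes "z \<in> K" "algebraic_int z"
  shows "cP z \<in> \<int>" "cQ z \<in> \<int>"
proof -
  from assms(2) obtain p where p: "lead_coeff p = 1" "\<forall>i. coeff p i \<in> \<int>" "poly p z = 0"
    by (auto elim: algebraic_int.cases)
  define n where "n = degree p"
  have zK: "z ^ k \<in> K" for k by (induction k) (auto simp: K_closed assms(1))
  obtain d where d: "d > 0" "\<forall>x\<in>(\<lambda>i. cP (z ^ i)) ` {..<n} \<union> (\<lambda>i. cQ (z ^ i)) ` {..<n}. real d * x \<in> \<int>"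
    using Ints_common_denominator[of "(\<lambda>i. cP (z ^ i)) ` {..<n} \<union> (\<lambda>i. cQ (z ^ i)) ` {..<n}"] zK
    by (auto simp: K_iff)
  define S where "S = {w. real d * cP w \<in> \<int> \<and> real d * cQ w \<in> \<int>}"
  have S_add: "v + w \<in> S" if "v \<in> S" "w \<in> S" for v w
    using that by (simp add: S_def distrib_left)
  have S_sum: "sum f A \<in> S" if "\<And>i. i \<in> A \<Longrightarrow> f i \<in> S" for f and A :: "nat set"
  proof -
    have "0 \<in> S" by (simp add: S_def)
    with that show ?thesis
      by (induction A rule: infinite_finite_induct) (auto intro!: S_add)
  qed
  have S_int: "c * w \<in> S" if "c \<in> \<int>" "w \<in> S" for c w
  proof -
    from that(1) obtain i where c: "c = of_int i" by (rule Ints_cases)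
    have "of_int i * (real d * cP w) \<in> \<int>" "of_int i * (real d * cQ w) \<in> \<int>" using that(2) by (auto simp: S_def)
    thus ?thesis by (simp add: S_def c mult.left_commute[of "real d"])
  qed
  \<comment> \<open>The denominator \<open>d\<close> works for the powers below the degree by choice, and for the others by the equation.\<close>
  have zS: "z ^ k \<in> S" for k
  proof (induction k rule: less_induct)
    case (less k)
    show ?case
    proof (cases "k < n")
      case True
      thus ?thesis using d by (auto simp: S_def)
    next
      case False
      have "0 = poly p z * z ^ (k - n)" using p by simp
      also have "\<dots> = (\<Sum>i\<le>n. coeff p i * z ^ i * z ^ (k - n))"
        by (simp add: poly_altdef n_def sum_distrib_right)
      also have "\<dots> = (\<Sum>i<n. coeff p i * z ^ i * z ^ (k - n)) + z ^ n * z ^ (k - n)"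
        unfolding lessThan_Suc_atMost[symmetric] using p(1) by (simp add: n_def)
      also have "z ^ n * z ^ (k - n) = z ^ k" using False by (simp add: power_add[symmetric])
      finally have "z ^ k = (\<Sum>i<n. (- coeff p i) * z ^ (i + (k - n)))"
        by (simp add: power_add sum_negf mult.assoc eq_neg_iff_add_eq_0 add.commute)
      also have "\<dots> \<in> S"
        using p(2) less.IH False by (intro S_sum S_int) auto
      finally show ?thesis .
    qed
  qed
  have zS1: "z ^ j * (z + 1) ^ k \<in> S" for j k
  proof (induction k arbitrary: j)
    case (Suc k)
    have "z ^ j * (z + 1) ^ Suc k = z ^ Suc j * (z + 1) ^ k + z ^ j * (z + 1) ^ k"
      by (simp add: algebra_simps)
    thus ?case using S_add[OF Suc[of "Suc j"] Suc[of j]] by (simp only:)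
  qed (simp add: zS)
  have norm_int: "(cmod w)^2 \<in> \<int>" if w: "w \<in> K" "\<And>k. w ^ k \<in> S" for w
  proof (rule Ints_of_bounded_denominator)
    show "(cmod w)^2 \<in> \<rat>" using w(1) by (simp add: K_iff coords_norm)
    show "d * d > 0" using d by simp
    fix k
    have e: "((cmod w)^2) ^ k = (cmod (w ^ k))^2" by (simp add: norm_power power_mult[symmetric] mult.commute)
    have "real (d * d) * ((cmod w)^2) ^ k = (real d * cP (w^k))^2 + (real d * cP (w^k)) * (real d * cQ (w^k)) + of_int m * (real d * cQ (w^k))^2"
      unfolding e unfolding coords_norm by (simp add: power2_eq_square algebra_simps)
    also have "\<dots> \<in> \<int>" using w(2)[of k] by (simp add: S_def)
    finally show "real (d * d) * ((cmod w)^2) ^ k \<in> \<int>" .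
  qed
  have n1: "(cmod z)^2 \<in> \<int>" by (rule norm_int) (use assms zS in auto)
  have n2: "(cmod (z + 1))^2 \<in> \<int>" by (rule norm_int) (use assms zS1[of 0] K_closed in auto)
  \<comment> \<open>The trace of \<open>z\<close>.\<close>
  have "2 * cP z + cQ z = (cmod (z + 1))^2 - (cmod z)^2 - 1"
    unfolding coords_norm by (simp add: power2_eq_square algebra_simps)
  also have "\<dots> \<in> \<int>" using n1 n2 by simp
  finally have t: "2 * cP z + cQ z \<in> \<int>" .
  have four: "real N * cQ z ^ 2 = 4 * (cmod z)^2 - (2 * cP z + cQ z)^2"
    unfolding coords_norm m_real by (simp add: power2_eq_square algebra_simps)
  have "real N * cQ z ^ 2 \<in> \<int>" unfolding four using n1 t by simp
  moreover have "cQ z \<in> \<rat>" using assms(1) unfolding K_iff by blast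
  ultimately show Q: "cQ z \<in> \<int>" by (rule squarefree_mult_square_Ints[OF squarefree_N, rotated])
  obtain t' q' n' where tq: "2 * cP z + cQ z = of_int t'" "cQ z = of_int q'" "(cmod z)^2 = of_int n'"
    using t Q n1 unfolding Ints_def by blast
  have "real_of_int (int N * q'^2) = real_of_int (4 * n' - t'^2)"
    using four unfolding tq(1) tq(3) unfolding tq(2) by simp
  hence eq: "int N * q'^2 = 4 * n' - t'^2" by (simp only: of_int_eq_iff)
  \<comment> \<open>Modulo \<open>2\<close> the equation reads \<open>q' + t' = 0\<close> as \<open>N\<close> is odd.\<close>
  have "even (t' - q')"
  proof -
    have "odd N" using m_eq by presburger
    have "even (int N * q'^2 + t'^2)" using eq by simp
    thus ?thesis using \<open>odd N\<close> by simp
  qed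
  then obtain r where "t' - q' = 2 * r" by (elim evenE)
  hence "real_of_int t' = of_int q' + 2 * of_int r" by (metis diff_eq_eq add.commute of_int_add of_int_mult of_int_numeral)
  hence "cP z = of_int r" using tq by simp
  thus "cP z \<in> \<int>" by simp
qed

lemma OK_iff: "z \<in> OK \<longleftrightarrow> cP z \<in> \<int> \<and> cQ z \<in> \<int>"
proof
  assume "z \<in> OK"
  thus "cP z \<in> \<int> \<and> cQ z \<in> \<int>" using OK_integral_subset by (auto simp: ring_of_integers_def)
next
  assume *: "cP z \<in> \<int> \<and> cQ z \<in> \<int>"
  then obtain u v where uv: "cP z = of_int u" "cQ z = of_int v" by (auto elim!: Ints_cases)
  have "z \<in> K" using * Ints_subset_Rats by (auto simp: K_iff)
  moreover have "algebraic_int z"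
  proof
    let ?p = "[: of_int (u^2 + u * v + m * v^2), - of_int (2 * u + v), 1 :] :: complex poly"
    show "lead_coeff ?p = 1" by simp
    show "\<forall>i. coeff ?p i \<in> \<int>" by (auto simp: coeff_pCons split: nat.splits)
    have "z * z - of_int (2 * u + v) * z + of_int (u^2 + u * v + m * v^2) = 0"
      unfolding coords_iff by (simp add: coords_mult uv power2_eq_square algebra_simps)
    thus "poly ?p z = 0" by (simp add: algebra_simps)
  qed
  ultimately show "z \<in> OK" by (simp add: ring_of_integers_def)
qed

end

section \<open>Fractional ideals containing 1\<close>

text \<open>A discrete subgroup of the line is generated by its least positive element \<open>g/M\<close>; as the subgroup
contains \<open>1\<close>, this generator is the inverse of an integer.\<close>

lemma rational_subgroup_cyclic:
  fixes S :: "real set"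
  assumes one: "1 \<in> S" and diff: "\<And>x y. x \<in> S \<Longrightarrow> y \<in> S \<Longrightarrow> x - y \<in> S"
    and M: "M > 0" "\<And>x. x \<in> S \<Longrightarrow> real M * x \<in> \<int>"
  shows "\<exists>k::nat. k > 0 \<and> S = {of_int u / real k | u. True}"
proof -
  have zero: "0 \<in> S" using diff[OF one one] by simp
  have neg: "- x \<in> S" if "x \<in> S" for x using diff[OF zero that] by simp
  have add: "x + y \<in> S" if "x \<in> S" "y \<in> S" for x y using diff[OF that(1) neg[OF that(2)]] by simp
  have scale: "of_int i * x \<in> S" if "x \<in> S" for i x
  proof -
    have nat: "of_nat n * x \<in> S" for n
      by (induction n) (auto simp: zero algebra_simps intro: add that)
    show ?thesis using nat[of "nat i"] neg[OF nat[of "nat (- i)"]] by (cases "i \<ge> 0") auto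
  qed
  define g where "g = (LEAST n::nat. n > 0 \<and> real n / real M \<in> S)"
  have "M > 0 \<and> real M / real M \<in> S" using one M by simp
  hence g: "g > 0" "real g / real M \<in> S"
    and min: "\<And>n. n > 0 \<Longrightarrow> real n / real M \<in> S \<Longrightarrow> g \<le> n"
    unfolding g_def by (metis (mono_tags, lifting) LeastI, metis (mono_tags, lifting) LeastI, auto intro: Least_le)
  have mult: "\<exists>u. x = of_int u * (real g / real M)" if x: "x \<in> S" for x
  proof -
    obtain i where i: "real M * x = of_int i" using M(2)[OF x] by (auto elim: Ints_cases)
    define r where "r = nat (i mod int g)"
    have r: "int r = i mod int g" "r < g" using g(1) by (simp_all add: r_def nat_less_iff)
    have ir: "i = (i div int g) * int g + int r" using r(1) by simp
    have "x = of_int i / real M" using i M(1) by (simp add: field_simps)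
    also have "of_int i = of_int (i div int g) * real g + real r" using arg_cong[OF ir, of real_of_int] by simp
    also have "(of_int (i div int g) * real g + real r) / real M = of_int (i div int g) * (real g / real M) + real r / real M"
      by (simp add: add_divide_distrib)
    finally have x_eq: "x = of_int (i div int g) * (real g / real M) + real r / real M" .
    have "x - of_int (i div int g) * (real g / real M) \<in> S" by (intro diff x scale g(2))
    hence "real r / real M \<in> S" using x_eq by simp
    hence "r = 0" using min[of r] r(2) by (cases "r = 0") auto
    thus ?thesis using x_eq by auto
  qed
  obtain k where k: "1 = of_int k * (real g / real M)" using mult[OF one] by blast
  have "0 < real g / real M" using g M by simp
  have "k > 0"
  proof (rule ccontr)
    assume "\<not> k > 0"
    hence "of_int k * (real g / real M) \<le> 0" using \<open>0 < real g / real M\<close> by (intro mult_nonpos_nonneg) auto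
    thus False using k by linarith
  qed
  have gM: "real g / real M = 1 / of_int k" using k \<open>k > 0\<close> g(1) by (simp add: field_simps)
  have "S = {of_int u / real (nat k) | u. True}"
  proof (intro equalityI subsetI)
    fix x assume "x \<in> S"
    then obtain u where "x = of_int u * (real g / real M)" using mult by blast
    thus "x \<in> {of_int u / real (nat k) | u. True}" using \<open>k > 0\<close> by (auto simp: gM)
  next
    fix x assume "x \<in> {of_int u / real (nat k) | u. True}"
    then obtain u where "x = of_int u * (real g / real M)" using \<open>k > 0\<close> by (auto simp: gM)
    thus "x \<in> S" using scale[OF g(2)] by simp
  qed
  thus ?thesis using \<open>k > 0\<close> by (intro exI[of _ "nat k"]) auto
qed

context imag_quadratic
begin

lemma OK_closed: "omega \<in> OK" "of_int k \<in> OK" "of_nat n \<in> OK" "1 \<in> OK" "-1 \<in> OK"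
  "x \<in> OK \<Longrightarrow> y \<in> OK \<Longrightarrow> x * y \<in> OK" "x \<in> OK \<Longrightarrow> y \<in> OK \<Longrightarrow> x + y \<in> OK" "x \<in> OK \<Longrightarrow> cnj x \<in> OK"
  by (simp_all add: OK_iff coords_mult coords_cnj)

abbreviation FI :: "complex set \<Rightarrow> bool" where "FI \<equiv> fractional_ideal (- int N)"

definition scale :: "complex \<Rightarrow> complex set \<Rightarrow> complex set" where "scale c J = (\<lambda>z. c * z) ` J"

lemma scale_scale [simp]: "scale a (scale b J) = scale (a * b) J"
  by (simp add: scale_def image_image mult.assoc)

lemma scale_1 [simp]: "scale 1 J = J" by (simp add: scale_def)

lemma mem_scale: "c \<noteq> 0 \<Longrightarrow> z \<in> scale c J \<longleftrightarrow> z / c \<in> J"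
  by (auto simp: scale_def image_iff intro!: bexI[of _ "z / c"])

lemma FI_D:
  assumes "FI J"
  shows "J \<subseteq> K" "0 \<in> J" "\<And>x y. x \<in> J \<Longrightarrow> y \<in> J \<Longrightarrow> x + y \<in> J" "\<And>x y. x \<in> J \<Longrightarrow> y \<in> J \<Longrightarrow> x - y \<in> J"
    "\<And>r x. r \<in> OK \<Longrightarrow> x \<in> J \<Longrightarrow> r * x \<in> J" "\<And>i x. x \<in> J \<Longrightarrow> of_int i * x \<in> J"
proof -
  show "J \<subseteq> K" "0 \<in> J" "\<And>x y. x \<in> J \<Longrightarrow> y \<in> J \<Longrightarrow> x + y \<in> J" and
    mul: "\<And>r x. r \<in> OK \<Longrightarrow> x \<in> J \<Longrightarrow> r * x \<in> J"
    using assms unfolding fractional_ideal_def by blast+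
  thus "\<And>i x. x \<in> J \<Longrightarrow> of_int i * x \<in> J" using OK_closed by blast
  fix x y assume "x \<in> J" "y \<in> J"
  hence "x + (-1) * y \<in> J" using mul[OF OK_closed(5), of y] assms unfolding fractional_ideal_def by blast
  thus "x - y \<in> J" by simp
qed

lemma FI_scale:
  assumes "FI J" "c \<in> K" "c \<noteq> 0"
  shows "FI (scale c J)"
  unfolding fractional_ideal_def
proof (intro conjI ballI)
  note J = FI_D[OF assms(1)]
  show "scale c J \<subseteq> K" using J(1) assms(2) K_closed by (auto simp: scale_def)
  show "0 \<in> scale c J" using J(2) by (auto simp: scale_def)
  have "J \<noteq> {0}" using assms(1) by (simp add: fractional_ideal_def)
  then obtain x where "x \<in> J" "x \<noteq> 0" using J(2) by blast
  hence "c * x \<in> scale c J" "c * x \<noteq> 0" using assms(3) by (auto simp: scale_def)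
  thus "scale c J \<noteq> {0}" by blast
  fix x y assume "x \<in> scale c J" "y \<in> scale c J"
  then obtain x' y' where "x = c * x'" "y = c * y'" "x' \<in> J" "y' \<in> J" by (auto simp: scale_def)
  thus "x + y \<in> scale c J" using J(3) by (auto simp: scale_def distrib_left[symmetric])
next
  note J = FI_D[OF assms(1)]
  fix r x assume "r \<in> OK" "x \<in> scale c J"
  then obtain x' where "x = c * x'" "x' \<in> J" by (auto simp: scale_def)
  hence "r * x = c * (r * x')" "r * x' \<in> J" using J(5) \<open>r \<in> OK\<close> by auto
  thus "r * x \<in> scale c J" by (auto simp: scale_def)
next
  obtain d where d: "d \<in> OK" "d \<noteq> 0" "\<forall>x\<in>J. d * x \<in> OK"
    using assms(1) unfolding fractional_ideal_def by blast
  have "inverse c \<in> K" using assms K_closed by blast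
  have "finite {cP (inverse c), cQ (inverse c)}" "\<And>x. x \<in> {cP (inverse c), cQ (inverse c)} \<Longrightarrow> x \<in> \<rat>"
    using \<open>inverse c \<in> K\<close> by (auto simp: K_iff)
  from Ints_common_denominator[OF this] obtain e :: nat where
    e: "e > 0" "real e * cP (inverse c) \<in> \<int>" "real e * cQ (inverse c) \<in> \<int>" by auto
  have e': "of_nat e * inverse c \<in> OK" using e by (simp add: OK_iff)
  show "\<exists>d\<in>OK. d \<noteq> 0 \<and> (\<forall>x\<in>scale c J. d * x \<in> OK)"
  proof (intro bexI conjI ballI)
    show "of_nat e * inverse c * d \<in> OK" using e' d OK_closed by blast
    show "of_nat e * inverse c * d \<noteq> 0" using e d assms(3) by simp
    fix x assume "x \<in> scale c J"
    then obtain x' where "x = c * x'" "x' \<in> J" by (auto simp: scale_def)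
    hence eq: "of_nat e * inverse c * d * x = of_nat e * (d * x')" using assms(3) by simp
    have "d * x' \<in> OK" using d(3) \<open>x' \<in> J\<close> by blast
    thus "of_nat e * inverse c * d * x \<in> OK" unfolding eq using OK_closed(6)[OF OK_closed(3)] by blast
  qed
qed

text \<open>Hermite normal form: the lattice with \<open>\<int>\<close>-basis \<open>1/k\<close> and \<open>(y + \<omega>)/(a k)\<close>.\<close>

definition lat :: "nat \<Rightarrow> nat \<Rightarrow> int \<Rightarrow> complex set" where
  "lat k a y = {(of_int u + of_int v * ((of_int y + omega) / of_nat a)) / of_nat k | u v. True}"

text \<open>The parameters for which \<open>lat k a y\<close> is an ideal, normalized to make them unique.\<close>

definition lat_param :: "nat \<Rightarrow> nat \<Rightarrow> int \<Rightarrow> bool" where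
  "lat_param k a y \<longleftrightarrow> k > 0 \<and> a > 0 \<and> y \<in> {0..<int a} \<and> int a dvd y^2 + y + m"

lemma coords_div [simp]: "cP (z / of_nat n) = cP z / of_nat n" "cQ (z / of_nat n) = cQ z / of_nat n"
  using coords_scale[of "inverse (real n)" z] by (simp_all add: field_simps)

lemma mem_lat_iff:
  assumes "k > 0" "a > 0"
  shows "z \<in> lat k a y \<longleftrightarrow> (\<exists>u v. cP z = (of_int u + of_int v * of_int y / real a) / real k \<and> cQ z = of_int v / (real a * real k))"
proof -
  have "z = (of_int u + of_int v * ((of_int y + omega) / of_nat a)) / of_nat k \<longleftrightarrow>
     cP z = (of_int u + of_int v * of_int y / real a) / real k \<and> cQ z = of_int v / (real a * real k)" for u v
    unfolding coords_iff by (auto simp: coords_scale_int)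
  thus ?thesis unfolding lat_def by blast
qed

lemma one_in_lat: "k > 0 \<Longrightarrow> 1 \<in> lat k a y"
  unfolding lat_def by (rule CollectI, rule exI[of _ "int k"], rule exI[of _ 0]) simp

lemma of_real_in_lat:
  assumes "k > 0" "a > 0"
  shows "of_real s \<in> lat k a y \<longleftrightarrow> real k * s \<in> \<int>"
proof
  assume "of_real s \<in> lat k a y"
  then obtain u v where "s = (of_int u + of_int v * of_int y / real a) / real k" "0 = of_int v / (real a * real k)"
    unfolding mem_lat_iff[OF assms] by auto
  hence "real k * s = of_int u" using assms by simp
  thus "real k * s \<in> \<int>" by simp
next
  assume "real k * s \<in> \<int>"
  then obtain u where "real k * s = of_int u" by (auto elim: Ints_cases)
  thus "of_real s \<in> lat k a y" unfolding mem_lat_iff[OF assms]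
    using assms by (intro exI[of _ u] exI[of _ 0]) (auto simp: field_simps)
qed

lemma lat_scale: "k > 0 \<Longrightarrow> scale (of_nat k) (lat k a y) = lat 1 a y"
proof -
  assume "k > 0"
  hence "z \<in> scale (of_nat k) (lat k a y) \<longleftrightarrow> z \<in> lat 1 a y" for z
    by (simp add: mem_scale lat_def)
  thus ?thesis by blast
qed

lemma lat_shift:
  assumes "a > 0"
  shows "lat k a (y + int a * q) = lat k a y"
proof -
  have sub: "lat k a (y + int a * q) \<subseteq> lat k a y" for y q
  proof
    fix z assume "z \<in> lat k a (y + int a * q)"
    then obtain u v where "z = (of_int u + of_int v * ((of_int (y + int a * q) + omega) / of_nat a)) / of_nat k"
      unfolding lat_def by blast
    moreover have eq: "(of_int (y + int a * q) + omega) / of_nat a = of_int q + (of_int y + omega) / of_nat a"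
      using assms by (simp add: field_simps)
    ultimately have "z = (of_int (u + v * q) + of_int v * ((of_int y + omega) / of_nat a)) / of_nat k"
      unfolding eq by (simp only: of_int_add of_int_mult distrib_left add.assoc)
    thus "z \<in> lat k a y" unfolding lat_def by blast
  qed
  show ?thesis using sub[of y q] sub[of "y + int a * q" "- q"] by auto
qed

text \<open>Stability under \<open>\<omega>\<close> is where \<open>a dvd y\<^sup>2 + y + m\<close> enters: for \<open>\<tau> = (y + \<omega>)/a\<close> one has
\<open>\<omega> \<tau> = (y + 1) \<tau> - (y\<^sup>2 + y + m)/a\<close>.\<close>

lemma FI_lat:
  assumes "k > 0" "a > 0" "int a dvd y^2 + y + m"
  shows "FI (lat k a y)"
  unfolding fractional_ideal_def
proof (intro conjI ballI)
  note mem = mem_lat_iff[OF assms(1,2)]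
  show "lat k a y \<subseteq> K" by (auto simp: K_iff mem)
  show "0 \<in> lat k a y" unfolding mem by (rule exI[of _ 0], rule exI[of _ 0]) simp
  show "lat k a y \<noteq> {0}" using one_in_lat[OF assms(1), of a y] by auto
  have add: "z + w \<in> lat k a y" if zw: "z \<in> lat k a y" "w \<in> lat k a y" for z w
  proof -
    obtain u v u' v' where "cP z = (of_int u + of_int v * of_int y / real a) / real k" "cQ z = of_int v / (real a * real k)"
      "cP w = (of_int u' + of_int v' * of_int y / real a) / real k" "cQ w = of_int v' / (real a * real k)"
      using zw unfolding mem by blast
    thus ?thesis unfolding mem
      by (intro exI[of _ "u + u'"] exI[of _ "v + v'"]) (simp add: add_divide_distrib distrib_right)
  qed
  thus "\<And>x y'. x \<in> lat k a y \<Longrightarrow> y' \<in> lat k a y \<Longrightarrow> x + y' \<in> lat k a y" .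
  show "\<exists>d\<in>OK. d \<noteq> 0 \<and> (\<forall>x\<in>lat k a y. d * x \<in> OK)"
  proof (intro bexI conjI ballI)
    show "of_nat (a * k) \<in> OK" by (rule OK_closed)
    show "of_nat (a * k) \<noteq> (0::complex)" using assms by simp
    fix x assume "x \<in> lat k a y"
    then obtain u v where uv: "cP x = (of_int u + of_int v * of_int y / real a) / real k" "cQ x = of_int v / (real a * real k)"
      unfolding mem by blast
    have "real (a * k) * cP x = of_int (int a * u + v * y)" "real (a * k) * cQ x = of_int v"
      using assms uv by (simp_all add: field_simps)
    hence "real (a * k) * cP x \<in> \<int>" "real (a * k) * cQ x \<in> \<int>" by (simp_all only: Ints_of_int)
    thus "of_nat (a * k) * x \<in> OK" unfolding OK_iff coords_scale_nat by simp
  qed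
  have int: "of_int i * z \<in> lat k a y" if z: "z \<in> lat k a y" for i z
  proof -
    obtain u v where "cP z = (of_int u + of_int v * of_int y / real a) / real k" "cQ z = of_int v / (real a * real k)"
      using z unfolding mem by blast
    thus ?thesis unfolding mem coords_scale_int
      by (intro exI[of _ "i * u"] exI[of _ "i * v"]) (simp add: algebra_simps)
  qed
  have om: "omega * z \<in> lat k a y" if z: "z \<in> lat k a y" for z
  proof -
    obtain u v where uv: "cP z = (of_int u + of_int v * of_int y / real a) / real k" "cQ z = of_int v / (real a * real k)"
      using z unfolding mem by blast
    obtain c where c: "y^2 + y + m = int a * c" using assms(3) by (elim dvdE)
    have c': "real_of_int m = real a * of_int c - of_int y ^ 2 - of_int y"
      using arg_cong[OF c, of real_of_int] by simp
    have "cP (omega * z) = - of_int m * cQ z" "cQ (omega * z) = cP z + cQ z" by (simp_all add: coords_mult)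
    hence "cP (omega * z) = (of_int (- u * y - v * c) + of_int (int a * u + v * y + v) * of_int y / real a) / real k"
          "cQ (omega * z) = of_int (int a * u + v * y + v) / (real a * real k)"
      unfolding uv c' using assms by (simp_all add: field_simps power2_eq_square)
    thus ?thesis unfolding mem by blast
  qed
  fix r z assume r: "r \<in> OK" and z: "z \<in> lat k a y"
  obtain u v where uv: "cP r = of_int u" "cQ r = of_int v" using r by (auto simp: OK_iff elim!: Ints_cases)
  have "r * z = of_int u * z + of_int v * (omega * z)"
    using coords[of r] by (simp add: uv algebra_simps)
  thus "r * z \<in> lat k a y" using add int om z by metis
qed

text \<open>The real points of \<open>J\<close> form a group \<open>(1/k) \<int>\<close>. After scaling by \<open>k\<close>, the \<open>\<omega>\<close>-coordinates form a group
\<open>(1/a) \<int>\<close>, which contains \<open>1\<close> because \<open>\<omega>\<close> is in the ideal. An element \<open>t\<close> with \<open>\<omega>\<close>-coordinate \<open>1/a\<close> completes the basis; since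
\<open>a t - \<omega>\<close> is real, it is an integer \<open>y\<close>.\<close>

lemma FI_containing_one_is_lat:
  assumes J: "FI J" and one: "1 \<in> J"
  shows "\<exists>k a y. lat_param k a y \<and> J = lat k a y"
proof -
  note JD = FI_D[OF J]
  obtain d where d: "d \<in> OK" "d \<noteq> 0" "\<forall>x\<in>J. d * x \<in> OK"
    using J unfolding fractional_ideal_def by blast
  have "cnj d * d \<in> OK" by (rule OK_closed(6)[OF OK_closed(8)[OF d(1)] d(1)])
  moreover have dd: "cnj d * d = of_real ((cmod d)^2)" unfolding complex_norm_square by (rule mult.commute)
  ultimately have "(cmod d)^2 \<in> \<int>" unfolding dd OK_iff coords_of_real by blast
  then obtain M' where M': "(cmod d)^2 = of_int M'" by (auto elim: Ints_cases)
  have "M' > 0" using d(2) M' by (metis of_int_0_less_iff zero_less_norm_iff zero_less_power)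
  define M where "M = nat M'"
  have M: "M > 0" "real M = (cmod d)^2" using \<open>M' > 0\<close> M' by (simp_all add: M_def)
  have MJ: "real M * cP z \<in> \<int>" "real M * cQ z \<in> \<int>" if "z \<in> J" for z
  proof -
    have "d * z \<in> OK" using d that by blast
    hence "cnj d * (d * z) \<in> OK" by (rule OK_closed(6)[OF OK_closed(8)[OF d(1)]])
    also have "cnj d * (d * z) = of_real ((cmod d)^2) * z" by (simp only: dd mult.assoc[symmetric])
    also have "\<dots> = of_nat M * z" unfolding M(2)[symmetric] by simp
    finally show "real M * cP z \<in> \<int>" "real M * cQ z \<in> \<int>" by (simp_all add: OK_iff)
  qed
  define S where "S = {s::real. of_real s \<in> J}"
  have "\<exists>k::nat. k > 0 \<and> S = {of_int u / real k | u. True}"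
  proof (rule rational_subgroup_cyclic)
    show "1 \<in> S" using one by (simp add: S_def)
    show "x - y \<in> S" if "x \<in> S" "y \<in> S" for x y using that JD(4) by (simp add: S_def)
    show "real M * x \<in> \<int>" if "x \<in> S" for x using MJ(1)[of "of_real x"] that by (simp add: S_def)
  qed (rule M)
  then obtain k :: nat where k: "k > 0" "S = {of_int u / real k | u. True}" by blast
  define L where "L = scale (of_nat k) J"
  have L: "FI L" unfolding L_def by (rule FI_scale[OF J]) (use k K_closed in auto)
  note LD = FI_D[OF L]
  have memL: "z \<in> L \<longleftrightarrow> z / of_nat k \<in> J" for z unfolding L_def using k by (simp add: mem_scale)
  have oneL: "1 \<in> L" unfolding memL
  proof -
    have "1 / real k \<in> S" unfolding k(2) by (rule CollectI, rule exI[of _ 1]) simp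
    thus "1 / of_nat k \<in> J" by (simp add: S_def)
  qed
  have realL: "s \<in> \<int>" if "of_real s \<in> L" for s
  proof -
    have "s / real k \<in> S" using that by (simp add: S_def memL)
    then obtain u where "s / real k = of_int u / real k" unfolding k(2) by blast
    thus ?thesis using k(1) by simp
  qed
  have omL: "omega \<in> L" using LD(5)[OF OK_closed(1) oneL] by simp
  have "\<exists>a::nat. a > 0 \<and> cQ ` L = {of_int u / real a | u. True}"
  proof (rule rational_subgroup_cyclic)
    show "1 \<in> cQ ` L" using omL coords_omega by (metis imageI)
    show "x - y \<in> cQ ` L" if xy: "x \<in> cQ ` L" "y \<in> cQ ` L" for x y
    proof -
      from xy obtain z w where zw: "z \<in> L" "w \<in> L" "x = cQ z" "y = cQ w" by blast
      hence "z - w \<in> L" "x - y = cQ (z - w)" using LD(4) by simp_all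
      thus ?thesis by blast
    qed
    show "real M * x \<in> \<int>" if "x \<in> cQ ` L" for x
    proof -
      obtain z where z: "z \<in> L" "x = cQ z" using \<open>x \<in> cQ ` L\<close> by blast
      have "real M * (cQ z / real k) \<in> \<int>" using MJ(2)[of "z / of_nat k"] z(1) by (simp add: memL)
      hence "of_nat k * (real M * (cQ z / real k)) \<in> \<int>" by (rule Ints_mult[OF Ints_of_nat])
      also have "of_nat k * (real M * (cQ z / real k)) = real M * x" using k(1) z(2) by simp
      finally show ?thesis .
    qed
  qed (rule M)
  then obtain a :: nat where a: "a > 0" "cQ ` L = {of_int u / real a | u. True}" by blast
  have "1 / real a \<in> cQ ` L" unfolding a(2) by (rule CollectI, rule exI[of _ 1]) simp
  then obtain t where t: "t \<in> L" "cQ t = 1 / real a" by auto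
  have "of_nat a * t - omega \<in> L" using LD(4)[OF LD(6)[OF t(1), of "int a"] omL] by simp
  moreover have eq: "of_nat a * t - omega = of_real (real a * cP t)" unfolding coords_iff using t a(1) by simp
  ultimately have "real a * cP t \<in> \<int>" using realL by metis
  then obtain y where y: "real a * cP t = of_int y" by (auto elim: Ints_cases)
  have t_eq: "t = (of_int y + omega) / of_nat a"
    unfolding coords_iff using t(2) y a(1) by (simp add: field_simps)
  have JL: "J = lat k a y"
  proof (intro equalityI subsetI)
    fix z assume "z \<in> J"
    hence z: "of_nat k * z \<in> L" using k(1) by (simp add: memL)
    then obtain v where v: "cQ (of_nat k * z) = of_int v / real a" using a(2) by blast
    have "of_nat k * z - of_int v * t \<in> L" using LD(4)[OF z LD(6)[OF t(1)]] .
    moreover have e: "of_nat k * z - of_int v * t = of_real (cP (of_nat k * z - of_int v * t))"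
      unfolding coords_iff using v t(2) by simp
    ultimately have "cP (of_nat k * z - of_int v * t) \<in> \<int>" using realL by metis
    then obtain u where "cP (of_nat k * z - of_int v * t) = of_int u" by (auto elim: Ints_cases)
    hence "of_nat k * z = of_int u + of_int v * t" using e by (simp add: algebra_simps)
    hence "z = (of_int u + of_int v * t) / of_nat k" using k(1) by (simp add: field_simps)
    thus "z \<in> lat k a y" unfolding lat_def t_eq by blast
  next
    fix z assume "z \<in> lat k a y"
    then obtain u v where "z = (of_int u + of_int v * t) / of_nat k" unfolding lat_def t_eq by blast
    moreover have "of_int u + of_int v * t \<in> L" using LD(3)[OF LD(6)[OF oneL, of u] LD(6)[OF t(1), of v]] by simp
    ultimately show "z \<in> J" by (simp add: memL)
  qed
  \<comment> \<open>The element \<open>\<omega> t - (y + 1) t\<close> of the ideal is real, hence an integer.\<close>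
  have dvd: "int a dvd y^2 + y + m"
  proof -
    have "omega * t - of_int (y + 1) * t \<in> L" using LD(4)[OF LD(5)[OF OK_closed(1) t(1)] LD(6)[OF t(1)]] .
    moreover have e: "omega * t - of_int (y + 1) * t = of_real (- of_int (y^2 + y + m) / real a)"
    proof -
      have ct: "cP t = of_int y / real a" "cQ t = 1 / real a" using y t(2) a(1) by (simp_all add: field_simps)
      show ?thesis unfolding coords_iff coords_diff coords_mult(1)[of omega] coords_mult(2)[of omega] coords_scale_int
          coords_omega coords_of_real ct
        using a(1) by (simp add: field_simps power2_eq_square)
    qed
    ultimately have "- of_int (y^2 + y + m) / real a \<in> \<int>" using realL by metis
    then obtain c where "- of_int (y^2 + y + m) / real a = of_int c" by (auto elim: Ints_cases)
    hence "real_of_int (y^2 + y + m) = of_int (int a * (- c))" using a(1) by (simp add: field_simps)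
    hence "y^2 + y + m = int a * (- c)" by (simp only: of_int_eq_iff)
    thus ?thesis by simp
  qed
  have "J = lat k a (y mod int a)"
  proof -
    have "y = y mod int a + int a * (y div int a)" by simp
    thus ?thesis using JL lat_shift[OF a(1), of k "y mod int a" "y div int a"] by simp
  qed
  moreover have "lat_param k a (y mod int a)"
    unfolding lat_param_def using k a(1) dvd root_poly_cong[of "y mod int a" y "int a" m] by auto
  ultimately show ?thesis by blast
qed

text \<open>The values of the symplectic form on \<open>J\<close>. For a lattice this is the group generated by the covolume, so it
serves as a basis-free covolume.\<close>

definition area :: "complex set \<Rightarrow> real set" where
  "area J = {Im (cnj u * v) | u v. u \<in> J \<and> v \<in> J}"

lemma area_scale: "area (scale c J) = (\<lambda>x. (cmod c)^2 * x) ` area J"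
proof -
  have e: "Im (cnj (c * u) * (c * v)) = (cmod c)^2 * Im (cnj u * v)" for u v
  proof -
    have "cnj (c * u) * (c * v) = of_real ((cmod c)^2) * (cnj u * v)"
      using complex_norm_square[of c] by (simp add: mult_ac)
    moreover have "Im (of_real r * w) = r * Im w" for r w by simp
    ultimately show ?thesis by (simp only:)
  qed
  show ?thesis
  proof (intro equalityI subsetI)
    fix x assume "x \<in> area (scale c J)"
    then obtain u v where "u \<in> J" "v \<in> J" "x = Im (cnj (c * u) * (c * v))"
      unfolding area_def scale_def by blast
    thus "x \<in> (\<lambda>x. (cmod c)^2 * x) ` area J" unfolding e area_def by blast
  next
    fix x assume "x \<in> (\<lambda>x. (cmod c)^2 * x) ` area J"
    then obtain u v where "u \<in> J" "v \<in> J" "x = (cmod c)^2 * Im (cnj u * v)"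
      unfolding area_def by blast
    thus "x \<in> area (scale c J)" unfolding e[symmetric] area_def scale_def by blast
  qed
qed

lemma area_lat:
  assumes "k > 0" "a > 0"
  shows "area (lat k a y) = {of_int n * (sqrt (real N) / (2 * real (k^2 * a))) | n. True}"
proof (intro equalityI subsetI)
  fix x assume "x \<in> area (lat k a y)"
  then obtain p q where pq: "p \<in> lat k a y" "q \<in> lat k a y" "x = Im (cnj p * q)" by (auto simp: area_def)
  then obtain u v u' v' where uv: "cP p = (of_int u + of_int v * of_int y / real a) / real k" "cQ p = of_int v / (real a * real k)"
      "cP q = (of_int u' + of_int v' * of_int y / real a) / real k" "cQ q = of_int v' / (real a * real k)"
    unfolding mem_lat_iff[OF assms] by blast
  have "x = of_int (u * v' - v * u') * (sqrt (real N) / (2 * real (k^2 * a)))"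
    unfolding pq(3) Im_cnj_mult uv using assms by (simp add: field_simps power2_eq_square)
  thus "x \<in> {of_int n * (sqrt (real N) / (2 * real (k^2 * a))) | n. True}" by blast
next
  fix x assume "x \<in> {of_int n * (sqrt (real N) / (2 * real (k^2 * a))) | n. True}"
  then obtain n where n: "x = of_int n * (sqrt (real N) / (2 * real (k^2 * a)))" by blast
  define p where "p = complex_of_real (1 / real k)"
  define q where "q = of_int n * ((of_int y + omega) / of_nat a) / of_nat k"
  have "p \<in> lat k a y" unfolding p_def of_real_in_lat[OF assms] using assms by simp
  moreover have "q \<in> lat k a y" unfolding q_def lat_def by (rule CollectI, rule exI[of _ 0], rule exI[of _ n]) simp
  moreover have "Im (cnj p * q) = x"
  proof -
    have p: "cP p = 1 / real k" "cQ p = 0" unfolding p_def by (rule coords_of_real)+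
    have q: "cQ q = of_int n / (real a * real k)"
      by (simp only: q_def coords_div coords_scale_int coords_add coords_omega coords_consts) simp
    show ?thesis
      unfolding Im_cnj_mult n p q using assms by (simp add: field_simps power2_eq_square)
  qed
  ultimately show "x \<in> area (lat k a y)" by (auto simp: area_def)
qed

lemma multiples_eq_imp_eq:
  fixes x y :: real
  assumes "x > 0" "y > 0" "{of_int n * x | n. True} = {of_int n * y | n. True}"
  shows "x = y"
proof -
  have "x \<in> {of_int n * x | n. True}" "y \<in> {of_int n * y | n. True}" by (rule CollectI, rule exI[of _ 1], simp)+
  then obtain i j where ij: "x = of_int i * y" "y = of_int j * x" using assms(3) by blast
  have "i > 0" using ij(1) assms by (metis of_int_0_less_iff zero_less_mult_pos2)
  have "j > 0" using ij(2) assms by (metis of_int_0_less_iff zero_less_mult_pos2)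
  have "1 * y \<le> of_int i * y" "1 * x \<le> of_int j * x"
    using \<open>i > 0\<close> \<open>j > 0\<close> assms by (intro mult_right_mono; simp)+
  thus ?thesis using ij by linarith
qed

text \<open>Covolumes scale by \<open>\<bar>c\<bar>\<^sup>2\<close>, and \<open>k\<^sup>2 a\<close> is the covolume of the ring of integers divided by that of
\<open>lat k a y\<close>.\<close>

lemma index_scale:
  assumes "k > 0" "a > 0" "k' > 0" "a' > 0" "c \<noteq> 0" "lat k' a' y' = scale c (lat k a y)"
  shows "(cmod c)^2 * real (k'^2 * a') = real (k^2 * a)"
proof -
  define A where "A = sqrt (real N) / (2 * real (k^2 * a))"
  define A' where "A' = sqrt (real N) / (2 * real (k'^2 * a'))"
  have pos: "A > 0" "A' > 0" "(cmod c)^2 > 0" using assms by (simp_all add: A_def A'_def)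
  have "{of_int n * A' | n. True} = (\<lambda>x. (cmod c)^2 * x) ` {of_int n * A | n. True}"
    using area_lat[OF assms(3,4), of y'] area_scale[of c "lat k a y"] area_lat[OF assms(1,2), of y]
    unfolding assms(6) A_def A'_def by simp
  also have "\<dots> = {of_int n * ((cmod c)^2 * A) | n. True}" by (auto simp: image_iff mult_ac)
  finally have "A' = (cmod c)^2 * A" using pos by (intro multiples_eq_imp_eq) auto
  thus ?thesis unfolding A_def A'_def using assms by (simp add: field_simps)
qed

lemma lat_eq_imp:
  assumes "lat_param k a y" "lat_param k' a' y'" "lat k a y = lat k' a' y'"
  shows "k = k' \<and> a = a' \<and> y = y'"
proof -
  have v: "k > 0" "a > 0" "k' > 0" "a' > 0" using assms by (auto simp: lat_param_def)
  have r: "real k * s \<in> \<int> \<longleftrightarrow> real k' * s \<in> \<int>" for s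
    using of_real_in_lat[OF v(1,2), of s y] of_real_in_lat[OF v(3,4), of s y'] assms(3) by simp
  have dv: "p dvd q" if "real q / real p \<in> \<int>" "p > 0" for p q :: nat
  proof -
    obtain c where "real q / real p = of_int c" using \<open>real q / real p \<in> \<int>\<close> by (auto elim: Ints_cases)
    hence "real_of_int (int q) = of_int (int p * c)" using that by (simp add: field_simps)
    hence "int q = int p * c" by (simp only: of_int_eq_iff)
    hence "int p dvd int q" by simp
    thus ?thesis by simp
  qed
  have "k dvd k'" using r[of "1 / real k"] v by (intro dv) auto
  moreover have "k' dvd k" using r[of "1 / real k'"] v by (intro dv) auto
  ultimately have kk: "k = k'" by (rule dvd_antisym)
  have "lat k' a' y' = scale 1 (lat k a y)" using assms(3) by simp
  from index_scale[OF v _ this] have "real (k'^2 * a') = real (k^2 * a)" by simp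
  hence "k'^2 * a' = k^2 * a" by (simp only: of_nat_eq_iff)
  hence aa: "a = a'" using kk v by simp
  define z where "z = ((of_int y + omega) / of_nat a) / of_nat k"
  have "z \<in> lat k a y" unfolding z_def lat_def by (rule CollectI, rule exI[of _ 0], rule exI[of _ 1]) simp
  hence "z \<in> lat k a y'" using assms(3) kk aa by simp
  then obtain u v' where "cP z = (of_int u + of_int v' * of_int y' / real a) / real k" "cQ z = of_int v' / (real a * real k)"
    unfolding mem_lat_iff[OF v(1,2)] by blast
  moreover have "cP z = (of_int y / real a) / real k" "cQ z = 1 / (real a * real k)"
    by (simp_all only: z_def coords_div coords_add coords_omega coords_consts) simp_all
  ultimately have "(of_int y / real a) / real k = (of_int u + of_int v' * of_int y' / real a) / real k"
    and "1 / (real a * real k) = of_int v' / (real a * real k)" by simp_all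
  moreover have "real k \<noteq> 0" "real a * real k \<noteq> 0" using v by simp_all
  ultimately have "of_int y / real a = of_int u + of_int v' * of_int y' / real a" and "1 = real_of_int v'"
    unfolding divide_cancel_right by blast+
  hence "real_of_int y = of_int (int a * u + y')" using v by (simp add: field_simps)
  hence "y = int a * u + y'" by (simp only: of_int_eq_iff)
  hence "[y = y'] (mod int a)" by (simp add: cong_def)
  hence "y = y'" using assms aa by (auto simp: lat_param_def cong_def)
  thus ?thesis using kk aa by simp
qed

end

section \<open>Ideal classes and representations by forms\<close>

lemma norm_inverse_mult_cancel:
  assumes "(cmod (inverse z))^2 * x = y" "z \<noteq> 0"
  shows "x = y * (cmod z)^2"
  unfolding assms(1)[symmetric] norm_inverse using assms(2) by (simp add: power_inverse)

context imag_quadratic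
begin

definition ideal_class :: "complex set \<Rightarrow> complex set set" where
  "ideal_class J = {scale c J | c. c \<in> K \<and> c \<noteq> 0}"

definition ideal_classes :: "complex set set set" where
  "ideal_classes = ideal_class ` {J. FI J}"

lemma ideal_product_principal:
  assumes "FI J"
  shows "ideal_product ((\<lambda>r. a * r) ` OK) J = scale a J"
proof (intro equalityI subsetI)
  fix x assume "x \<in> ideal_product ((\<lambda>r. a * r) ` OK) J"
  then obtain n :: nat and g h where x: "x = (\<Sum>i<n. g i * h i)"
    and gh: "\<forall>i<n. g i \<in> (\<lambda>r. a * r) ` OK \<and> h i \<in> J"
    unfolding ideal_product_def by blast
  have "\<forall>i. \<exists>r. i < n \<longrightarrow> g i = a * r \<and> r \<in> OK" using gh by blast
  from choice[OF this] obtain r where r: "\<forall>i<n. g i = a * r i \<and> r i \<in> OK" by blast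
  have "(\<Sum>i<k. r i * h i) \<in> J" if "k \<le> n" for k
    using that
  proof (induction k)
    case 0 thus ?case using FI_D(2)[OF assms] by simp
  next
    case (Suc k)
    have "r k * h k \<in> J" using FI_D(5)[OF assms] r gh Suc.prems by simp
    thus ?case using FI_D(3)[OF assms] Suc by simp
  qed
  hence "(\<Sum>i<n. r i * h i) \<in> J" by simp
  moreover have "x = a * (\<Sum>i<n. r i * h i)"
    unfolding x sum_distrib_left using r by (intro sum.cong) (auto simp: mult.assoc)
  ultimately show "x \<in> scale a J" unfolding scale_def by blast
next
  fix x assume "x \<in> scale a J"
  then obtain z where z: "z \<in> J" "x = a * z" by (auto simp: scale_def)
  have "a \<in> (\<lambda>r. a * r) ` OK" using OK_closed(4) by (metis image_eqI mult.right_neutral)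
  thus "x \<in> ideal_product ((\<lambda>r. a * r) ` OK) J"
    unfolding ideal_product_def
    by (intro CollectI exI[of _ "1::nat"] exI[of _ "\<lambda>_. a"] exI[of _ "\<lambda>_. z"]) (simp add: z)
qed

text \<open>The product with the principal ideal of \<open>a\<close> is multiplication by \<open>a\<close>, so the cosets of the principal
ideals are the classes of ideals up to scaling.\<close>

lemma class_number_eq: "class_number (- int N) = card ideal_classes"
proof -
  have "(\<Union>h\<in>principal_fractional_ideals (- int N). {ideal_product h J}) = ideal_class J" if "FI J" for J
    unfolding principal_fractional_ideals_def ideal_class_def using ideal_product_principal[OF that]
    by (auto simp del: scale_def)
  hence "carrier (ideal_class_group (- int N)) = ideal_classes"
    unfolding ideal_class_group_def FactGroup_def RCOSETS_def r_coset_def fractional_ideal_group_def ideal_classes_def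
    by auto
  thus ?thesis by (simp add: class_number_def Coset.order_def)
qed

lemma ideal_class_self: "J \<in> ideal_class J"
  unfolding ideal_class_def by (rule CollectI, rule exI[of _ 1]) (simp add: K_closed)

lemma ideal_class_eq:
  assumes "J' \<in> ideal_class J"
  shows "ideal_class J' = ideal_class J"
proof -
  obtain c where c: "J' = scale c J" "c \<in> K" "c \<noteq> 0" using assms by (auto simp: ideal_class_def)
  show ?thesis
  proof (intro equalityI subsetI)
    fix I assume "I \<in> ideal_class J'"
    then obtain d where "I = scale d J'" "d \<in> K" "d \<noteq> 0" by (auto simp: ideal_class_def)
    hence "I = scale (d * c) J" "d * c \<in> K" "d * c \<noteq> 0" using c K_closed by auto
    thus "I \<in> ideal_class J" unfolding ideal_class_def by blast
  next
    fix I assume "I \<in> ideal_class J"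
    then obtain d where d: "I = scale d J" "d \<in> K" "d \<noteq> 0" by (auto simp: ideal_class_def)
    hence "I = scale (d * inverse c) J'" using c by (simp add: mult.assoc)
    moreover have "d * inverse c \<in> K" "d * inverse c \<noteq> 0" using c d K_closed by auto
    ultimately show "I \<in> ideal_class J'" unfolding ideal_class_def by blast
  qed
qed

lemma ideal_class_scale: "c \<in> K \<Longrightarrow> c \<noteq> 0 \<Longrightarrow> ideal_class (scale c J) = ideal_class J"
  by (rule ideal_class_eq) (auto simp: ideal_class_def)

lemma FI_ideal_class: "FI J \<Longrightarrow> I \<in> ideal_class J \<Longrightarrow> FI I"
  using FI_scale by (auto simp: ideal_class_def)

lemma ideal_classes_eqI: "C \<in> ideal_classes \<Longrightarrow> J \<in> C \<Longrightarrow> FI J \<and> C = ideal_class J"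
  unfolding ideal_classes_def using ideal_class_eq FI_ideal_class by blast

definition point :: "nat \<Rightarrow> int \<Rightarrow> int \<Rightarrow> int \<Rightarrow> complex" where
  "point a y u v = of_int u + of_int v * ((of_int y + omega) / of_nat a)"

definition coeff_c :: "nat \<Rightarrow> int \<Rightarrow> int" where
  "coeff_c a y = (y^2 + y + m) div int a"

text \<open>The norm form of \<open>lat 1 a y\<close> in the basis \<open>1, (y + \<omega>)/a\<close>, divided by the norm \<open>1/a\<close> of this
ideal.\<close>

definition form :: "nat \<Rightarrow> int \<Rightarrow> int \<Rightarrow> int \<Rightarrow> int" where
  "form a y u v = int a * u^2 + (2 * y + 1) * u * v + coeff_c a y * v^2"

lemma coords_point: "cP (point a y u v) = of_int u + of_int v * of_int y / real a"
    "cQ (point a y u v) = of_int v / real a"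
  unfolding point_def by (simp_all only: coords_add coords_consts coords_scale_int coords_div coords_omega) simp_all

lemma lat_1_points: "lat 1 a y = {point a y u v | u v. True}" "lat (Suc 0) a y = {point a y u v | u v. True}"
  by (simp_all add: lat_def point_def)

lemma form_norm:
  assumes "a > 0" "int a dvd y^2 + y + m"
  shows "real_of_int (form a y u v) = real a * (cmod (point a y u v))^2"
proof -
  have "y^2 + y + m = int a * coeff_c a y" using assms(2) by (simp add: coeff_c_def)
  from arg_cong[OF this, of real_of_int]
  have mm: "real_of_int m = real a * of_int (coeff_c a y) - of_int y ^ 2 - of_int y" by simp
  show ?thesis unfolding coords_norm coords_point mm form_def using assms(1)
    by (simp add: field_simps power2_eq_square)
qed

lemma form_disc:
  assumes "int a dvd y^2 + y + m"
  shows "4 * int a * coeff_c a y - (2 * y + 1)^2 = int N"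
proof -
  have "y^2 + y + m = int a * coeff_c a y" using assms by (simp add: coeff_c_def)
  thus ?thesis using root_disc[OF m_eq, of y] by simp
qed

lemma point_eq_iff: "a > 0 \<Longrightarrow> point a y u v = point a y u' v' \<longleftrightarrow> u = u' \<and> v = v'"
  unfolding coords_iff coords_point by auto

lemma point_uminus: "- point a y u v = point a y (- u) (- v)"
  unfolding coords_iff coords_uminus coords_point by simp

lemma point_eq_0_iff: "a > 0 \<Longrightarrow> point a y u v = 0 \<longleftrightarrow> u = 0 \<and> v = 0"
  unfolding coords_iff coords_point coords_consts by auto

lemma point_in_K: "point a y u v \<in> K"
  unfolding K_iff coords_point by simp

text \<open>The fractional ideals that contain the ring of integers with index \<open>n\<close>.\<close>

definition ideals_of_index :: "nat \<Rightarrow> complex set set" where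
  "ideals_of_index n = {lat k a y | k a y. lat_param k a y \<and> k^2 * a = n}"

lemma FI_lat_param: "lat_param k a y \<Longrightarrow> FI (lat k a y)"
  using FI_lat by (auto simp: lat_param_def)

lemma scaled_by_point_in_ideals_of_index:
  assumes "lat_param 1 a y" "form a y u v = int n" "n > 0"
  shows "scale (inverse (point a y u v)) (lat 1 a y) \<in> ideals_of_index n"
proof -
  have a: "a > 0" "int a dvd y^2 + y + m" using assms(1) by (auto simp: lat_param_def)
  let ?z = "point a y u v"
  have nz: "?z \<noteq> 0" using assms(2,3) a(1) by (auto simp: point_eq_0_iff form_def)
  have "FI (scale (inverse ?z) (lat 1 a y))"
    using FI_lat_param[OF assms(1)] nz point_in_K K_closed(3) by (intro FI_scale) auto
  moreover have "1 \<in> scale (inverse ?z) (lat 1 a y)"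
    using nz by (subst mem_scale) (auto simp: lat_1_points inverse_eq_divide)
  ultimately obtain k' a' y' where v: "lat_param k' a' y'" "scale (inverse ?z) (lat 1 a y) = lat k' a' y'"
    using FI_containing_one_is_lat by blast
  have "(cmod (inverse ?z))^2 * real (k'^2 * a') = real (1^2 * a)"
    by (rule index_scale[of 1 a k' a' _ y' y]) (use a v nz in \<open>auto simp: lat_param_def\<close>)
  from norm_inverse_mult_cancel[OF this nz] have "real (k'^2 * a') = real a * (cmod ?z)^2" by simp
  also have "\<dots> = real n" using form_norm[OF a, of u v] assms(2) by simp
  finally have "k'^2 * a' = n" by (simp only: of_nat_eq_iff)
  thus ?thesis using v unfolding ideals_of_index_def by blast
qed

lemma ideals_of_index_in_class:
  assumes "lat_param 1 a y" "J \<in> ideals_of_index n" "J \<in> ideal_class (lat 1 a y)"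
  shows "\<exists>u v. form a y u v = int n \<and> J = scale (inverse (point a y u v)) (lat 1 a y)"
proof -
  have a: "a > 0" "int a dvd y^2 + y + m" using assms(1) by (auto simp: lat_param_def)
  obtain k' a' y' where J: "J = lat k' a' y'" "lat_param k' a' y'" "k'^2 * a' = n"
    using assms(2) unfolding ideals_of_index_def by blast
  have v': "k' > 0" "a' > 0" using J(2) by (auto simp: lat_param_def)
  obtain c where c: "J = scale c (lat 1 a y)" "c \<noteq> 0" using assms(3) by (auto simp: ideal_class_def)
  have "1 \<in> J" unfolding J(1) by (rule one_in_lat[OF v'(1)])
  hence "1 / c \<in> lat 1 a y" unfolding c(1) using c(2) by (simp add: mem_scale)
  then obtain u v where uv: "1 / c = point a y u v" by (auto simp: lat_1_points)
  hence c_eq: "c = inverse (point a y u v)" using c(2) by (metis inverse_eq_divide inverse_inverse_eq)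
  have nz: "point a y u v \<noteq> 0" using uv c(2) by auto
  have "(cmod c)^2 * real (k'^2 * a') = real (1^2 * a)"
    by (rule index_scale[of 1 a k' a' _ y' y]) (use a v' c J(1) in auto)
  from norm_inverse_mult_cancel[OF this[unfolded J(3) c_eq] nz]
  have "real n = real a * (cmod (point a y u v))^2" by simp
  hence "real_of_int (form a y u v) = real_of_int (int n)" using form_norm[OF a, of u v] by simp
  hence "form a y u v = int n" by (simp only: of_int_eq_iff)
  thus ?thesis using c(1) c_eq by blast
qed

text \<open>Such a \<open>c\<close> has absolute value \<open>1\<close>, so its conjugate is its inverse and preserves the lattice as well.
Hence \<open>s = 2 Re c\<close> is a real lattice point, an integer, and \<open>4 = s\<^sup>2 + N q\<^sup>2\<close> for the \<open>\<omega>\<close>-coordinate \<open>q\<close>,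
which is integral because \<open>N\<close> is square-free. As \<open>N > 4\<close>, \<open>q = 0\<close>.\<close>

lemma multiplier_unit:
  assumes "lat_param 1 a y" "c \<noteq> 0" "scale c (lat 1 a y) = lat 1 a y"
  shows "c = 1 \<or> c = -1"
proof -
  have a: "a > 0" "int a dvd y^2 + y + m" using assms(1) by (auto simp: lat_param_def)
  have "(cmod c)^2 * real (1^2 * a) = real (1^2 * a)"
    by (rule index_scale[of 1 a 1 a c y y]) (use a assms in auto)
  hence n1: "(cmod c)^2 = 1" using a(1) by simp
  hence ci: "inverse c = cnj c" using complex_norm_square[of c] assms(2) by (simp add: field_simps)
  have one: "1 \<in> lat 1 a y" by (rule one_in_lat) simp
  have cL: "c \<in> lat 1 a y" using one assms(2,3) by (metis mem_scale divide_self)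
  have "1 \<in> scale c (lat 1 a y)" using one assms(3) by simp
  hence "cnj c \<in> lat 1 a y" using assms(2) ci by (simp add: mem_scale inverse_eq_divide)
  hence "c + cnj c \<in> lat 1 a y" using cL FI_D(3)[OF FI_lat_param[OF assms(1)]] by blast
  hence "of_real (2 * Re c) \<in> lat 1 a y" by (simp add: complex_add_cnj)
  hence "2 * Re c \<in> \<int>" using of_real_in_lat[of 1 a "2 * Re c" y] a(1) by simp
  moreover have four: "(2 * Re c)^2 + real N * cQ c ^ 2 = 4"
  proof -
    have "4 = 4 * (cmod c)^2" using n1 by simp
    also have "\<dots> = (2 * Re c)^2 + real N * cQ c ^ 2"
      unfolding coords_norm coords_Re m_real by (simp add: power2_eq_square algebra_simps)
    finally show ?thesis by simp
  qed
  ultimately have NQ: "real N * cQ c ^ 2 \<in> \<int>"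
  proof -
    assume "2 * Re c \<in> \<int>" "(2 * Re c)^2 + real N * cQ c ^ 2 = 4"
    hence eq: "real N * cQ c ^ 2 = 4 - (2 * Re c)^2" by linarith
    show ?thesis unfolding eq by (intro Ints_diff Ints_power Ints_numeral \<open>2 * Re c \<in> \<int>\<close>)
  qed
  have "c \<in> K" using cL FI_D(1)[OF FI_lat_param[OF assms(1)]] by blast
  hence "cQ c \<in> \<int>" using squarefree_mult_square_Ints[OF squarefree_N _ NQ] by (simp add: K_iff)
  then obtain q where q: "cQ c = of_int q" by (auto elim: Ints_cases)
  have "q = 0"
  proof (rule ccontr)
    assume "q \<noteq> 0"
    hence "1 \<le> q^2" by (simp add: int_one_le_iff_zero_less)
    hence "1 \<le> (real_of_int q)^2" by (metis of_int_1_le_iff of_int_power)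
    hence "real N * 1 \<le> real N * cQ c ^ 2" unfolding q by (intro mult_left_mono) auto
    thus False using four N_gt zero_le_power2[of "2 * Re c"] by linarith
  qed
  hence "Im c = 0" using q by (simp add: cQ_def)
  moreover have "(Re c)^2 = 1" using n1 \<open>Im c = 0\<close> by (simp add: cmod_power2)
  hence "Re c = 1 \<or> Re c = -1" by (simp add: power2_eq_1_iff)
  ultimately show ?thesis by (auto simp: complex_eq_iff)
qed

lemma finite_lat_params: "finite {(k, a, y). lat_param k a y \<and> k^2 * a = n}" if "n > 0"
proof (rule finite_subset)
  show "{(k, a, y). lat_param k a y \<and> k^2 * a = n} \<subseteq> {..n} \<times> {..n} \<times> {0..<int n}"
  proof
    fix z assume "z \<in> {(k, a, y). lat_param k a y \<and> k^2 * a = n}"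
    then obtain k a y where z: "z = (k, a, y)" "lat_param k a y" "k^2 * a = n" by blast
    have "k > 0" "a > 0" "y \<in> {0..<int a}" using z(2) by (auto simp: lat_param_def)
    have "k \<le> k^2" using \<open>k > 0\<close> by (simp add: power2_eq_square)
    moreover have "k^2 \<le> n" "a \<le> n" using z(3) \<open>k > 0\<close> \<open>a > 0\<close> by auto
    ultimately show "z \<in> {..n} \<times> {..n} \<times> {0..<int n}" using z(1) \<open>y \<in> {0..<int a}\<close> by auto
  qed
qed simp

lemma ideals_of_index_image: "ideals_of_index n = (\<lambda>(k, a, y). lat k a y) ` {(k, a, y). lat_param k a y \<and> k^2 * a = n}"
  unfolding ideals_of_index_def by (auto simp: image_iff)

lemma finite_ideals_of_index: "n > 0 \<Longrightarrow> finite (ideals_of_index n)"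
  unfolding ideals_of_index_image by (intro finite_imageI finite_lat_params)

definition representations :: "nat \<Rightarrow> int \<Rightarrow> nat \<Rightarrow> (int \<times> int) set" where
  "representations a y n = {(u, v). form a y u v = int n}"

text \<open>Send \<open>(u, v)\<close> to the ideal \<open>L / x\<close> for \<open>L = lat 1 a y\<close> and \<open>x = point a y u v\<close>. Every ideal of the class
that contains \<open>1\<close> has this form, and by \<open>multiplier_unit\<close> the two points \<open>x\<close> and \<open>-x\<close> are the only ones
that lead to it.\<close>

lemma card_representations:
  assumes "lat_param 1 a y" "n > 0"
  shows "finite (representations a y n)" "card (representations a y n) = 2 * card (ideals_of_index n \<inter> ideal_class (lat 1 a y))"
proof -
  have a: "a > 0" "int a dvd y^2 + y + m" using assms(1) by (auto simp: lat_param_def)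
  define \<psi> where "\<psi> = (\<lambda>(u, v). scale (inverse (point a y u v)) (lat 1 a y))"
  let ?S = "ideals_of_index n \<inter> ideal_class (lat 1 a y)"
  have nz: "point a y u v \<noteq> 0" if "(u, v) \<in> representations a y n" for u v
    using that assms(2) a(1) by (auto simp: point_eq_0_iff representations_def form_def)
  have into: "\<psi> r \<in> ?S" if r: "r \<in> representations a y n" for r
  proof -
    obtain u v where uv: "r = (u, v)" "form a y u v = int n" using r by (auto simp: representations_def)
    have "inverse (point a y u v) \<in> K" "inverse (point a y u v) \<noteq> 0"
      using nz[of u v] r uv(1) point_in_K K_closed(3) by auto
    hence "\<psi> r \<in> ideal_class (lat 1 a y)" unfolding ideal_class_def \<psi>_def uv(1) by auto
    thus ?thesis using scaled_by_point_in_ideals_of_index[OF assms(1) uv(2) assms(2)] uv(1) by (simp add: \<psi>_def)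
  qed
  have fibre: "finite {r \<in> representations a y n. \<psi> r = J} \<and> card {r \<in> representations a y n. \<psi> r = J} = 2" if J: "J \<in> ?S" for J
  proof -
    obtain u v where uv: "form a y u v = int n" "J = scale (inverse (point a y u v)) (lat 1 a y)"
      using ideals_of_index_in_class[OF assms(1)] J by blast
    have r: "(u, v) \<in> representations a y n" using uv(1) by (simp add: representations_def)
    note z = nz[OF r]
    have "{r \<in> representations a y n. \<psi> r = J} = {(u, v), (- u, - v)}"
    proof (intro equalityI subsetI)
      fix r assume "r \<in> {r \<in> representations a y n. \<psi> r = J}"
      then obtain u' v' where r': "r = (u', v')" "(u', v') \<in> representations a y n"
        "scale (inverse (point a y u' v')) (lat 1 a y) = scale (inverse (point a y u v)) (lat 1 a y)"
        unfolding \<psi>_def uv(2) by (cases r) auto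
      note z' = nz[OF r'(2)]
      define c where "c = point a y u' v' * inverse (point a y u v)"
      have "scale (point a y u' v') (scale (inverse (point a y u' v')) (lat 1 a y)) = scale c (lat 1 a y)"
        unfolding r'(3) c_def by simp
      hence "scale c (lat 1 a y) = lat 1 a y" using z' by simp
      moreover have "c \<noteq> 0" using z z' by (simp add: c_def)
      ultimately have "c = 1 \<or> c = -1" using multiplier_unit[OF assms(1)] by blast
      hence "point a y u' v' = point a y u v \<or> point a y u' v' = point a y (- u) (- v)"
        using z unfolding point_uminus[symmetric] by (auto simp: c_def field_simps)
      thus "r \<in> {(u, v), (- u, - v)}" using r'(1) a(1) by (auto simp: point_eq_iff)
    next
      fix r assume "r \<in> {(u, v), (- u, - v)}"
      moreover have "(- u, - v) \<in> representations a y n" using uv(1) by (simp add: representations_def form_def)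
      moreover have "\<psi> (- u, - v) = J"
      proof -
        have "scale (- c) (lat 1 a y) = scale c (lat 1 a y)" for c
        proof -
          have "scale (-1) (lat 1 a y) = lat 1 a y"
          proof (intro equalityI subsetI)
            fix w assume "w \<in> scale (-1) (lat 1 a y)"
            then obtain w' where "w = - w'" "w' \<in> lat 1 a y" by (auto simp: scale_def)
            thus "w \<in> lat 1 a y" using FI_D(6)[OF FI_lat_param[OF assms(1)], of w' "-1"] by simp
          next
            fix w assume "w \<in> lat 1 a y"
            hence "- w \<in> lat 1 a y" using FI_D(6)[OF FI_lat_param[OF assms(1)], of w "-1"] by simp
            thus "w \<in> scale (-1) (lat 1 a y)" by (simp add: mem_scale)
          qed
          hence "scale c (scale (-1) (lat 1 a y)) = scale c (lat 1 a y)" by simp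
          thus ?thesis by simp
        qed
        thus ?thesis by (simp add: \<psi>_def uv(2) point_uminus[symmetric])
      qed
      moreover have "\<psi> (u, v) = J" by (simp add: \<psi>_def uv(2))
      ultimately show "r \<in> {r \<in> representations a y n. \<psi> r = J}" using r by auto
    qed
    moreover have "(u, v) \<noteq> (- u, - v)" using z a(1) by (auto simp: point_eq_0_iff)
    ultimately show ?thesis by simp
  qed
  have finS: "finite ?S" using finite_ideals_of_index[OF assms(2)] by blast
  have "representations a y n = (\<Union>J\<in>?S. {r \<in> representations a y n. \<psi> r = J})" using into by blast
  moreover have "finite (\<Union>J\<in>?S. {r \<in> representations a y n. \<psi> r = J})" using finS fibre by blast
  ultimately show fin: "finite (representations a y n)" by simp
  have "card (representations a y n) = (\<Sum>r\<in>representations a y n. 1)" by simp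
  also have "\<dots> = (\<Sum>J\<in>?S. \<Sum>r\<in>{r \<in> representations a y n. \<psi> r = J}. 1)"
    by (rule sum.group[symmetric]) (use fin finS into in auto)
  also have "\<dots> = (\<Sum>J\<in>?S. 2)" using fibre by (intro sum.cong refl) (simp add: card_eq_sum[symmetric])
  finally show "card (representations a y n) = 2 * card ?S" by simp
qed

text \<open>Reduction theory. Choose \<open>a\<close> minimal and shift \<open>y\<close> so that \<open>\<bar>2 y + 1\<bar> \<le> a\<close>. Dividing the lattice by its second
basis vector gives another ideal of the class containing \<open>1\<close>, of index \<open>c = (y\<^sup>2 + y + m)/a\<close>, so minimality gives
\<open>a \<le> c\<close>. Then \<open>4 a\<^sup>2 \<le> 4 a c = N + (2 y + 1)\<^sup>2 \<le> N + a\<^sup>2\<close>.\<close>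

lemma lat_param_rep_of_class:
  assumes "C \<in> ideal_classes"
  shows "\<exists>a y. lat_param 1 a y \<and> C = ideal_class (lat 1 a y) \<and> a \<le> N"
proof -
  have ex: "\<exists>a y. lat_param 1 a y \<and> ideal_class J = ideal_class (lat 1 a y)" if J: "FI J" "1 \<in> J" for J
  proof -
    obtain k a y where v: "lat_param k a y" "J = lat k a y" using FI_containing_one_is_lat[OF J] by blast
    have "k > 0" using v(1) by (simp add: lat_param_def)
    have "lat 1 a y = scale (of_nat k) J" unfolding v(2) by (rule lat_scale[OF \<open>k > 0\<close>, symmetric])
    hence "ideal_class (lat 1 a y) = ideal_class J" using \<open>k > 0\<close> K_closed by (simp add: ideal_class_scale)
    moreover have "lat_param 1 a y" using v(1) by (simp add: lat_param_def)
    ultimately show ?thesis by blast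
  qed
  obtain J0 where J0: "FI J0" "C = ideal_class J0" using assms by (auto simp: ideal_classes_def)
  have "J0 \<noteq> {0}" using J0(1) by (simp add: fractional_ideal_def)
  then obtain x where x: "x \<in> J0" "x \<noteq> 0" using FI_D(2)[OF J0(1)] by blast
  have xK: "inverse x \<in> K" using x FI_D(1)[OF J0(1)] K_closed(3) by blast
  have "FI (scale (inverse x) J0)" "1 \<in> scale (inverse x) J0" "ideal_class (scale (inverse x) J0) = C"
    using FI_scale[OF J0(1) xK] x xK J0(2) by (auto simp: mem_scale ideal_class_scale inverse_eq_divide)
  then obtain a1 y1 where "lat_param 1 a1 y1" "C = ideal_class (lat 1 a1 y1)" using ex by metis
  hence ex1: "\<exists>a. \<exists>y. lat_param 1 a y \<and> C = ideal_class (lat 1 a y)" by blast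
  define a where "a = (LEAST a. \<exists>y. lat_param 1 a y \<and> C = ideal_class (lat 1 a y))"
  have "\<exists>y. lat_param 1 a y \<and> C = ideal_class (lat 1 a y)" unfolding a_def by (rule LeastI_ex[OF ex1])
  then obtain y where y: "lat_param 1 a y" "C = ideal_class (lat 1 a y)" by blast
  have min: "a \<le> a'" if "lat_param 1 a' y'" "C = ideal_class (lat 1 a' y')" for a' y'
    unfolding a_def by (rule Least_le) (use that in blast)
  have a: "a > 0" "int a dvd y^2 + y + m" "0 \<le> y" "y < int a" using y(1) by (auto simp: lat_param_def)
  define q where "q = (if 2 * y + 1 \<le> int a then 0 else -1 :: int)"
  define y' where "y' = y + int a * q"
  have ay': "\<bar>2 * y' + 1\<bar> \<le> int a" using a by (auto simp: y'_def q_def)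
  have L': "lat 1 a y' = lat 1 a y" unfolding y'_def by (rule lat_shift[OF a(1)])
  have dvd': "int a dvd y'^2 + y' + m" using a(2) root_poly_cong[of y' y "int a" m] by (simp add: y'_def cong_def)
  define c where "c = coeff_c a y'"
  have disc: "4 * int a * c - (2 * y' + 1)^2 = int N" unfolding c_def by (rule form_disc[OF dvd'])
  have "int a * c > 0"
  proof -
    have "4 * (int a * c) = int N + (2 * y' + 1)^2" using disc by simp
    moreover have "(2 * y' + 1)^2 \<ge> 0" by simp
    ultimately show ?thesis using N_gt by linarith
  qed
  hence c0: "c > 0" using a(1) by (simp add: zero_less_mult_iff)
  have frm: "form a y' 0 1 = c" by (simp add: form_def c_def)
  define z where "z = point a y' 0 1"
  have nz: "z \<noteq> 0" using a(1) by (simp add: z_def point_eq_0_iff)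
  have zL: "z \<in> lat 1 a y" unfolding L'[symmetric] unfolding lat_1_points(1) z_def by blast
  have "FI (scale (inverse z) (lat 1 a y))"
    using FI_lat_param[OF y(1)] nz point_in_K K_closed(3) unfolding z_def by (intro FI_scale) auto
  moreover have "1 \<in> scale (inverse z) (lat 1 a y)" using nz zL by (subst mem_scale) (auto simp: inverse_eq_divide)
  ultimately obtain k' a' y'' where v: "lat_param k' a' y''" "scale (inverse z) (lat 1 a y) = lat k' a' y''"
    using FI_containing_one_is_lat by blast
  have v0: "k' > 0" "a' > 0" using v(1) by (auto simp: lat_param_def)
  have "(cmod (inverse z))^2 * real (k'^2 * a') = real (1^2 * a)"
    by (rule index_scale[of 1 a k' a' _ y'' y]) (use a v v0 nz in auto)
  from norm_inverse_mult_cancel[OF this nz] have "real (k'^2 * a') = real a * (cmod z)^2" by simp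
  also have "\<dots> = real_of_int c" using form_norm[OF a(1) dvd', of 0 1] frm by (simp add: z_def)
  finally have "real_of_int (int (k'^2 * a')) = real_of_int c" by simp
  hence kc: "int (k'^2 * a') = c" by (simp only: of_int_eq_iff)
  have "ideal_class (lat 1 a' y'') = C"
  proof -
    have "lat 1 a' y'' = scale (of_nat k') (scale (inverse z) (lat 1 a y))"
      unfolding v(2) by (rule lat_scale[OF v0(1), symmetric])
    hence "ideal_class (lat 1 a' y'') = ideal_class (scale (inverse z) (lat 1 a y))"
      using v0 K_closed by (simp add: ideal_class_scale del: scale_scale)
    also have "\<dots> = C" unfolding y(2) by (rule ideal_class_scale) (use nz point_in_K K_closed(3) in \<open>auto simp: z_def\<close>)
    finally show ?thesis .
  qed
  moreover have "lat_param 1 a' y''" using v(1) by (simp add: lat_param_def)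
  ultimately have "a \<le> a'" using min by blast
  also have "a' \<le> k'^2 * a'" using v0 by simp
  finally have "int a \<le> c" using kc by linarith
  hence "int a * int a \<le> int a * c" by (intro mult_left_mono) auto
  moreover have "(2 * y' + 1)^2 \<le> int a * int a"
  proof -
    have "\<bar>2 * y' + 1\<bar>^2 \<le> int a ^ 2" using ay' by (intro power_mono) auto
    thus ?thesis by (simp add: power2_eq_square)
  qed
  ultimately have "3 * (int a * int a) \<le> int N" using disc by linarith
  moreover have "int a * 1 \<le> int a * int a" using a(1) by (intro mult_left_mono) auto
  ultimately have "a \<le> N" by linarith
  thus ?thesis using y by blast
qed

lemma finite_ideal_classes: "finite ideal_classes"
proof (rule finite_subset)
  show "ideal_classes \<subseteq> (\<lambda>(a, y). ideal_class (lat 1 a y)) ` ({..N} \<times> {0..<int N})"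
  proof
    fix C assume "C \<in> ideal_classes"
    then obtain a y where ay: "lat_param 1 a y" "C = ideal_class (lat 1 a y)" "a \<le> N" using lat_param_rep_of_class by blast
    hence "(a, y) \<in> {..N} \<times> {0..<int N}" by (auto simp: lat_param_def)
    thus "C \<in> (\<lambda>(a, y). ideal_class (lat 1 a y)) ` ({..N} \<times> {0..<int N})" using ay(2) by force
  qed
qed simp

lemma sum_ideal_classes_card:
  assumes "n > 0"
  shows "(\<Sum>C\<in>ideal_classes. card (ideals_of_index n \<inter> C)) = card (ideals_of_index n)"
proof -
  have "card (\<Union>C\<in>ideal_classes. ideals_of_index n \<inter> C) = (\<Sum>C\<in>ideal_classes. card (ideals_of_index n \<inter> C))"
  proof (rule card_UN_disjoint)
    show "\<forall>C\<in>ideal_classes. \<forall>D\<in>ideal_classes. C \<noteq> D \<longrightarrow> (ideals_of_index n \<inter> C) \<inter> (ideals_of_index n \<inter> D) = {}"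
      using ideal_classes_eqI by blast
  qed (use finite_ideal_classes finite_ideals_of_index[OF assms] in auto)
  moreover have "(\<Union>C\<in>ideal_classes. ideals_of_index n \<inter> C) = ideals_of_index n"
  proof -
    have "J \<in> ideal_class J \<and> ideal_class J \<in> ideal_classes" if "J \<in> ideals_of_index n" for J
      using that ideal_class_self FI_lat_param unfolding ideals_of_index_def ideal_classes_def by blast
    thus ?thesis by blast
  qed
  ultimately show ?thesis by simp
qed

end

section \<open>The class number formula\<close>

lemma has_sum_finite_sum:
  fixes g :: "'c \<Rightarrow> 'a \<Rightarrow> real"
  assumes "finite S" "\<And>C. C \<in> S \<Longrightarrow> (g C has_sum s C) A"
  shows "((\<lambda>n. \<Sum>C\<in>S. g C n) has_sum (\<Sum>C\<in>S. s C)) A"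
  using assms
proof (induction S rule: finite_induct)
  case (insert C S)
  thus ?case by (simp add: has_sum_add)
qed simp

context imag_quadratic
begin

text \<open>By uniqueness of the normal form, an ideal of index \<open>n\<close> amounts to a divisor \<open>a\<close> of \<open>n\<close> with \<open>n/a\<close> a
square and a root of \<open>y\<^sup>2 + y + m\<close> modulo \<open>a\<close>.\<close>

lemma card_ideals_of_index:
  assumes n: "n > 0"
  shows "int (card (ideals_of_index n)) = (\<Sum>d | d dvd n. Jacobi (int d) N)"
proof -
  let ?V = "{(k, a, y). lat_param k a y \<and> k^2 * a = n}"
  let ?R = "\<lambda>a. {y \<in> {0..<int a}. int a dvd y^2 + y + m}"
  let ?D = "{a. a dvd n \<and> is_square (n div a)}"
  have "inj_on (\<lambda>(k, a, y). lat k a y) ?V"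
  proof (rule inj_onI)
    fix p q assume pq: "p \<in> ?V" "q \<in> ?V" "(case p of (k, a, y) \<Rightarrow> lat k a y) = (case q of (k, a, y) \<Rightarrow> lat k a y)"
    obtain k a y where p: "p = (k, a, y)" by (cases p)
    obtain k' a' y' where q: "q = (k', a', y')" by (cases q)
    show "p = q" using lat_eq_imp[of k a y k' a' y'] pq unfolding p q by simp
  qed
  hence "card (ideals_of_index n) = card ?V" unfolding ideals_of_index_image by (rule card_image)
  also have "bij_betw (\<lambda>(k, a, y). (a, y)) ?V (SIGMA a:?D. ?R a)"
    unfolding bij_betw_def
  proof (intro conjI equalityI subsetI)
    show "inj_on (\<lambda>(k, a, y). (a, y)) ?V"
    proof (rule inj_onI)
      fix p q assume pq: "p \<in> ?V" "q \<in> ?V" "(case p of (k, a, y) \<Rightarrow> (a, y)) = (case q of (k, a, y) \<Rightarrow> (a, y))"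
      obtain k a y where p: "p = (k, a, y)" by (cases p)
      obtain k' a' y' where q: "q = (k', a', y')" by (cases q)
      have "k^2 * a = k'^2 * a" "a > 0" "a = a'" "y = y'" using pq unfolding p q by (auto simp: lat_param_def)
      thus "p = q" unfolding p q by simp
    qed
  next
    fix z assume "z \<in> (\<lambda>(k, a, y). (a, y)) ` ?V"
    then obtain k a y where z: "z = (a, y)" "lat_param k a y" "n = k^2 * a" by auto
    thus "z \<in> (SIGMA a:?D. ?R a)" by (auto simp: lat_param_def)
  next
    fix z assume "z \<in> (SIGMA a:?D. ?R a)"
    then obtain a y where z: "z = (a, y)" "a dvd n" "is_square (n div a)" "y \<in> ?R a" by auto
    from z(3) obtain k where k: "n div a = k^2" by (auto simp: is_nth_power_def)
    have nk: "k^2 * a = n" using z(2) k by (metis dvd_div_mult_self)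
    hence "k > 0" "a > 0" using n by (auto intro: Nat.gr0I)
    hence "(k, a, y) \<in> ?V" using z(4) nk by (auto simp: lat_param_def)
    thus "z \<in> (\<lambda>(k, a, y). (a, y)) ` ?V" using z(1) by force
  qed
  hence "card ?V = card (SIGMA a:?D. ?R a)" by (rule bij_betw_same_card)
  also have fin: "finite {d. d dvd n}" using n by simp
  have "card (SIGMA a:?D. ?R a) = (\<Sum>a\<in>?D. root_count m a)"
    unfolding root_count_def by (rule card_SigmaI) (use fin in simp, intro ballI finite_roots)
  finally have "int (card (ideals_of_index n)) = (\<Sum>a\<in>?D. int (root_count m a))" by simp
  also have "\<dots> = dconv (\<lambda>a. int (root_count m a)) square_ind n"
    unfolding dconv_def square_ind_def
    by (rule sum.mono_neutral_cong_left) (use fin in auto)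
  also have "\<dots> = (\<Sum>d | d dvd n. Jacobi (int d) N)"
    by (rule divisor_sum_eq_root_sum[OF m_eq squarefree_N n])
  finally show ?thesis .
qed

lemma odd_N: "odd N" and N_mod_4: "N mod 4 = 3"
  using m_eq by presburger+

definition chi :: "nat \<Rightarrow> int" where "chi n = Jacobi (int n) N"

lemma chi_abs: "\<bar>chi n\<bar> \<le> 1"
  using Jacobi_values[of "int n" N] by (auto simp: chi_def)

lemma chi_0: "chi 0 = 0"
  unfolding chi_def by (rule Jacobi_eq_0) (use N_gt in auto)

lemma chi_periodic: "chi (n + N) = chi n"
  unfolding chi_def by (rule Jacobi_cong) (simp add: cong_def)

lemma chi_mult: "chi (a * b) = chi a * chi b"
  unfolding chi_def by (simp add: Jacobi_mult odd_N)

lemma chi_reflect: "n \<le> N \<Longrightarrow> chi (N - n) = - chi n"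
proof -
  assume "n \<le> N"
  hence "chi (N - n) = Jacobi (-1 * int n) N"
    unfolding chi_def by (intro Jacobi_cong) (simp add: of_nat_diff cong_def)
  also have "\<dots> = - chi n" unfolding Jacobi_mult[OF odd_N] chi_def
    using Jacobi_minus_one[OF odd_N] N_mod_4 by simp
  finally show ?thesis .
qed

lemma chi_sum_zero: "(\<Sum>n<N. chi n) = 0"
proof -
  have "(\<Sum>n\<in>{1..<N}. chi n) = (\<Sum>n\<in>{1..<N}. chi (N - n))"
    by (rule sum.reindex_bij_witness[of _ "\<lambda>n. N - n" "\<lambda>n. N - n"]) auto
  also have "\<dots> = - (\<Sum>n\<in>{1..<N}. chi n)"
    unfolding sum_negf[symmetric] by (intro sum.cong refl chi_reflect) auto
  finally have z: "(\<Sum>n\<in>{1..<N}. chi n) = 0" by simp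
  have "{..<N} = insert 0 {1..<N}" using N_gt by auto
  thus ?thesis using z chi_0 by simp
qed

abbreviation Theta :: "nat \<Rightarrow> int \<Rightarrow> real \<Rightarrow> real" where
  "Theta a y \<equiv> theta (int a) (2 * y + 1) (coeff_c a y)"

lemma form_pos:
  assumes "lat_param 1 a y" "(u, v) \<noteq> (0, 0)"
  shows "form a y u v > 0"
proof -
  have a: "a > 0" "int a dvd y^2 + y + m" using assms(1) by (auto simp: lat_param_def)
  have "point a y u v \<noteq> 0" using assms(2) a(1) by (auto simp: point_eq_0_iff)
  hence "real_of_int (form a y u v) > 0" unfolding form_norm[OF a] using a(1) by simp
  thus ?thesis by simp
qed

text \<open>Sort the nonzero points of \<open>\<int>\<^sup>2\<close> by the value of the form; the origin accounts for the \<open>1\<close>.\<close>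

lemma theta_reps:
  assumes v: "lat_param 1 a y" and aN: "a \<le> N" and t: "t > 0" "t \<le> 1 / N"
  shows "((\<lambda>n. real (card (representations a y n)) * exp (- t * real n)) has_sum (Theta a y t - 1)) {1..}"
proof -
  have a: "a > 0" "int a dvd y^2 + y + m" using v by (auto simp: lat_param_def)
  have disc: "4 * int a * coeff_c a y - (2 * y + 1)^2 = int N" by (rule form_disc[OF a(2)])
  let ?F = "\<lambda>(x, z). exp (- t * real_of_int (int a * x^2 + (2 * y + 1) * x * z + coeff_c a y * z^2))"
  have tN: "t * N \<le> 1" using t N_gt by (simp add: field_simps)
  have ta: "t * real_of_int (int a) \<le> 1"
  proof -
    have "t * real a \<le> t * real N" using aN t by (intro mult_left_mono) auto
    thus ?thesis using tN by simp
  qed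
  have td: "t * (real_of_int (4 * int a * coeff_c a y - (2 * y + 1)^2) / real_of_int (4 * int a)) \<le> 1"
  proof -
    have "real N / real_of_int (4 * int a) \<le> real N / 1" using a(1) by (intro divide_left_mono) auto
    hence "t * (real N / real_of_int (4 * int a)) \<le> t * real N" using t by (intro mult_left_mono) auto
    thus ?thesis unfolding disc using tN by simp
  qed
  have sm: "?F summable_on UNIV"
    by (rule theta_approx(1)[OF _ _ t(1) ta td]) (use a disc N_gt in auto)
  have "(?F has_sum Theta a y t) UNIV" unfolding theta_def by (rule has_sum_infsum[OF sm])
  moreover have "(?F has_sum 1) {(0, 0)}" by (rule has_sum_finiteI) auto
  ultimately have "(?F has_sum (Theta a y t - 1)) (UNIV - {(0, 0)})"
    by (rule has_sum_Diff) auto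
  also have "?this \<longleftrightarrow> ((\<lambda>(n, z). exp (- t * real n)) has_sum (Theta a y t - 1)) (SIGMA n:{1..}. representations a y n)"
  proof (rule has_sum_reindex_bij_witness[where i = snd and j = "\<lambda>(u, w). (nat (form a y u w), (u, w))"])
    fix z assume z: "z \<in> UNIV - {(0::int, 0::int)}"
    obtain u w where uw: "z = (u, w)" by (cases z)
    have p: "form a y u w > 0" using form_pos[OF v, of u w] z uw by auto
    show "snd (case z of (u, w) \<Rightarrow> (nat (form a y u w), (u, w))) = z" by (simp add: uw)
    show "(case z of (u, w) \<Rightarrow> (nat (form a y u w), (u, w))) \<in> (SIGMA n:{1..}. representations a y n)"
      using p by (auto simp: uw representations_def)
    show "(case (case z of (u, w) \<Rightarrow> (nat (form a y u w), (u, w))) of (n, z) \<Rightarrow> exp (- t * real n)) = ?F z"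
      using p by (simp add: uw form_def)
  next
    fix b assume b: "b \<in> (SIGMA n:{1..}. representations a y n)"
    then obtain n u w where nuw: "b = (n, (u, w))" "n \<ge> 1" "form a y u w = int n" by (auto simp: representations_def)
    show "(case snd b of (u, w) \<Rightarrow> (nat (form a y u w), (u, w))) = b" using nuw by simp
    show "snd b \<in> UNIV - {(0, 0)}" using nuw by (auto simp: form_def)
  qed auto
  finally have "((\<lambda>(n, z). exp (- t * real n)) has_sum (Theta a y t - 1)) (SIGMA n:{1..}. representations a y n)" .
  thus ?thesis
  proof (rule has_sum_SigmaD)
    fix n :: nat assume "n \<in> {1..}"
    hence "finite (representations a y n)" using card_representations(1)[OF v] by simp
    thus "((\<lambda>z. case (n, z) of (n, z) \<Rightarrow> exp (- t * real n)) has_sum real (card (representations a y n)) * exp (- t * real n)) (representations a y n)"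
      by (intro has_sum_finiteI) auto
  qed
qed

definition lambert :: "real \<Rightarrow> real" where
  "lambert t = (\<Sum>\<^sub>\<infinity>d\<in>{1..}. real_of_int (chi d) / (exp (real d * t) - 1))"

text \<open>The mean of the partial sums of \<open>\<chi>\<close> over a period, which is the value \<open>L(0, \<chi>)\<close>.\<close>

definition chi_mean :: real where
  "chi_mean = (\<Sum>n<N. \<Sum>k\<le>n. real_of_int (chi k)) / real N"

text \<open>Counting the ideals of each index once class by class and once altogether gives the identity \<open>key\<close>
between theta series and the Lambert series of \<open>\<chi>\<close>; letting \<open>t \<rightarrow> 0\<close> in the combination of its values at
\<open>4 t\<close> and \<open>t\<close> isolates the constant term.\<close>

lemma class_number_formula: "real (card ideal_classes) = chi_mean"
proof -
  have "\<forall>C. \<exists>p. C \<in> ideal_classes \<longrightarrow> (case p of (a, y) \<Rightarrow> lat_param 1 a y \<and> C = ideal_class (lat 1 a y) \<and> a \<le> N)"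
    using lat_param_rep_of_class by fast
  from choice[OF this] obtain p where
    p: "\<And>C. C \<in> ideal_classes \<Longrightarrow> (case p C of (a, y) \<Rightarrow> lat_param 1 a y \<and> C = ideal_class (lat 1 a y) \<and> a \<le> N)" by blast
  define A Y where "A C = fst (p C)" and "Y C = snd (p C)" for C
  have AY: "lat_param 1 (A C) (Y C)" "C = ideal_class (lat 1 (A C) (Y C))" "A C \<le> N" if "C \<in> ideal_classes" for C
    using p[OF that] by (auto simp: A_def Y_def split: prod.splits)
  have chi1: "\<bar>real_of_int (chi n)\<bar> \<le> 1" for n using chi_abs[of n] by linarith
  let ?h = "real (card ideal_classes)"
  have key: "(\<Sum>C\<in>ideal_classes. Theta (A C) (Y C) t) = ?h + 2 * lambert t" if t: "t > 0" "t \<le> 1 / N" for t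
  proof -
    have "((\<lambda>n. \<Sum>C\<in>ideal_classes. real (card (representations (A C) (Y C) n)) * exp (- t * real n)) has_sum
        (\<Sum>C\<in>ideal_classes. Theta (A C) (Y C) t - 1)) {1..}"
      by (intro has_sum_finite_sum finite_ideal_classes theta_reps AY t)
    also have "?this \<longleftrightarrow> ((\<lambda>n. 2 * ((\<Sum>d | d dvd n. real_of_int (chi d)) * exp (- t * real n))) has_sum
        (\<Sum>C\<in>ideal_classes. Theta (A C) (Y C) t - 1)) {1..}"
    proof (rule has_sum_cong)
      fix n :: nat assume "n \<in> {1..}"
      hence n: "n > 0" by simp
      have "(\<Sum>C\<in>ideal_classes. real (card (representations (A C) (Y C) n))) = (\<Sum>C\<in>ideal_classes. 2 * real (card (ideals_of_index n \<inter> C)))"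
      proof (rule sum.cong[OF refl])
        fix C assume C: "C \<in> ideal_classes"
        show "real (card (representations (A C) (Y C) n)) = 2 * real (card (ideals_of_index n \<inter> C))"
          using card_representations(2)[OF AY(1)[OF C] n] AY(2)[OF C] by simp
      qed
      also have "\<dots> = 2 * real (\<Sum>C\<in>ideal_classes. card (ideals_of_index n \<inter> C))" by (simp add: sum_distrib_left)
      also have "\<dots> = 2 * real_of_int (int (card (ideals_of_index n)))" unfolding sum_ideal_classes_card[OF n] by simp
      also have "\<dots> = 2 * (\<Sum>d | d dvd n. real_of_int (chi d))" unfolding card_ideals_of_index[OF n] chi_def by simp
      finally show "(\<Sum>C\<in>ideal_classes. real (card (representations (A C) (Y C) n)) * exp (- t * real n))
          = 2 * ((\<Sum>d | d dvd n. real_of_int (chi d)) * exp (- t * real n))"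
        by (simp add: sum_distrib_right[symmetric])
    qed
    finally have 1: "((\<lambda>n. 2 * ((\<Sum>d | d dvd n. real_of_int (chi d)) * exp (- t * real n))) has_sum
        (\<Sum>C\<in>ideal_classes. Theta (A C) (Y C) t - 1)) {1..}" .
    have 2: "((\<lambda>n. 2 * ((\<Sum>d | d dvd n. real_of_int (chi d)) * exp (- t * real n))) has_sum (2 * lambert t)) {1..}"
      unfolding lambert_def by (intro has_sum_cmult_right lambert_series(1) chi1 t)
    from has_sum_unique[OF 1 2] show ?thesis by (simp add: sum_subtractf)
  qed
  have "((\<lambda>t. \<Sum>C\<in>ideal_classes. 4 * Theta (A C) (Y C) (4 * t) - Theta (A C) (Y C) t) \<longlongrightarrow> (\<Sum>C\<in>ideal_classes. 0)) (at_right 0)"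
  proof (intro tendsto_sum theta_limit)
    fix C assume "C \<in> ideal_classes"
    hence "lat_param 1 (A C) (Y C)" by (rule AY)
    hence a: "A C > 0" "int (A C) dvd (Y C)^2 + Y C + m" by (auto simp: lat_param_def)
    thus "int (A C) > 0" by simp
    show "4 * int (A C) * coeff_c (A C) (Y C) - (2 * Y C + 1)^2 > 0"
      unfolding form_disc[OF a(2)] using N_gt by simp
  qed
  hence lim0: "((\<lambda>t. \<Sum>C\<in>ideal_classes. 4 * Theta (A C) (Y C) (4 * t) - Theta (A C) (Y C) t) \<longlongrightarrow> 0) (at_right 0)"
    by simp
  \<comment> \<open>The identity \<open>key\<close> is available at both \<open>t\<close> and \<open>4 t\<close> in this range.\<close>
  have N0: "1 / (4 * real N) > 0" by simp
  have ev: "\<forall>\<^sub>F t in at_right 0. (\<Sum>C\<in>ideal_classes. 4 * Theta (A C) (Y C) (4 * t) - Theta (A C) (Y C) t)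
      = 3 * ?h - 2 * (lambert t - 4 * lambert (4 * t))"
    using eventually_at_right_less eventually_at_right_real[OF N0]
  proof eventually_elim
    case (elim t)
    hence t: "0 < t" "t \<le> 1 / N" "0 < 4 * t" "4 * t \<le> 1 / N"
      by (auto simp: field_simps)
    have "(\<Sum>C\<in>ideal_classes. 4 * Theta (A C) (Y C) (4 * t) - Theta (A C) (Y C) t)
       = 4 * (\<Sum>C\<in>ideal_classes. Theta (A C) (Y C) (4 * t)) - (\<Sum>C\<in>ideal_classes. Theta (A C) (Y C) t)"
      by (simp add: sum_subtractf sum_distrib_left)
    thus ?case unfolding key[OF t(1,2)] key[OF t(3,4)] by simp
  qed
  have "((\<lambda>t. lambert t - 4 * lambert (4 * t)) \<longlongrightarrow> 3 / 2 * chi_mean) (at_right 0)"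
    unfolding lambert_def chi_mean_def
  proof (rule lambert_limit)
    show "\<bar>real_of_int (chi n)\<bar> \<le> 1" for n by (rule chi1)
    show "real_of_int (chi 0) = 0" by (simp add: chi_0)
    show "real_of_int (chi (n + N)) = real_of_int (chi n)" for n by (simp add: chi_periodic)
    show "(\<Sum>n<N. real_of_int (chi n)) = 0" using chi_sum_zero by (metis of_int_0 of_int_sum)
  qed simp
  hence "((\<lambda>t. 3 * ?h - 2 * (lambert t - 4 * lambert (4 * t))) \<longlongrightarrow> 3 * ?h - 2 * (3 / 2 * chi_mean)) (at_right 0)"
    by (intro tendsto_intros)
  moreover have "((\<lambda>t. 3 * ?h - 2 * (lambert t - 4 * lambert (4 * t))) \<longlongrightarrow> 0) (at_right 0)"
    by (rule Lim_transform_eventually[OF lim0 ev])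
  ultimately have "3 * ?h - 2 * (3 / 2 * chi_mean) = 0"
    by (rule tendsto_unique[OF trivial_limit_at_right_real])
  thus ?thesis by simp
qed

text \<open>Interchanging summations, \<open>\<chi>(k)\<close> occurs \<open>N - k\<close> times in the sum of the partial sums.\<close>

lemma class_number_moment: "int N * int (card ideal_classes) = - (\<Sum>k<N. int k * chi k)"
proof -
  have "(\<Sum>n<M. \<Sum>k\<le>n. chi k) = (\<Sum>k<M. (int M - int k) * chi k)" for M
  proof (induction M)
    case (Suc M)
    have "(\<Sum>k<Suc M. (int (Suc M) - int k) * chi k) = (\<Sum>k<M. (int M - int k) * chi k + chi k) + chi M"
      by (simp add: algebra_simps)
    also have "\<dots> = (\<Sum>k<M. (int M - int k) * chi k) + (\<Sum>k\<le>M. chi k)"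
      unfolding lessThan_Suc_atMost[symmetric] by (simp add: sum.distrib)
    finally show ?case using Suc by simp
  qed simp
  from this[of N] have "(\<Sum>n<N. \<Sum>k\<le>n. chi k) = int N * (\<Sum>k<N. chi k) - (\<Sum>k<N. int k * chi k)"
    by (simp add: algebra_simps sum_subtractf sum_distrib_left)
  hence 1: "(\<Sum>n<N. \<Sum>k\<le>n. chi k) = - (\<Sum>k<N. int k * chi k)" by (simp add: chi_sum_zero)
  have "real N * real (card ideal_classes) = (\<Sum>n<N. \<Sum>k\<le>n. real_of_int (chi k))"
    unfolding class_number_formula chi_mean_def by simp
  hence "real_of_int (int N * int (card ideal_classes)) = real_of_int (\<Sum>n<N. \<Sum>k\<le>n. chi k)" by simp
  thus ?thesis unfolding 1 by (simp only: of_int_eq_iff)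
qed

section \<open>Half and quarter sums of the character\<close>

text \<open>As \<open>N\<close> is odd, an odd number below \<open>N\<close> is \<open>N\<close> minus an even one.\<close>

lemma sum_even_odd:
  fixes g :: "nat \<Rightarrow> int"
  assumes "X \<subseteq> {1..<N}"
  shows "(\<Sum>k\<in>X. g k) = (\<Sum>k | 2 * k \<in> X. g (2 * k)) + (\<Sum>k | 2 * k < N \<and> N - 2 * k \<in> X. g (N - 2 * k))"
proof -
  have fin: "finite X" using assms finite_subset by blast
  have "(\<Sum>k\<in>X. g k) = (\<Sum>k\<in>{k\<in>X. even k} \<union> {k\<in>X. odd k}. g k)" by (rule sum.cong) auto
  also have "\<dots> = (\<Sum>k | k \<in> X \<and> even k. g k) + (\<Sum>k | k \<in> X \<and> odd k. g k)"
    by (rule sum.union_disjoint) (use fin in auto)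
  also have "(\<Sum>k | k \<in> X \<and> even k. g k) = (\<Sum>k | 2 * k \<in> X. g (2 * k))"
    by (rule sum.reindex_bij_witness[of _ "\<lambda>k. 2 * k" "\<lambda>k. k div 2"]) auto
  also have "(\<Sum>k | k \<in> X \<and> odd k. g k) = (\<Sum>k | 2 * k < N \<and> N - 2 * k \<in> X. g (N - 2 * k))"
  proof (rule sum.reindex_bij_witness[of _ "\<lambda>k. N - 2 * k" "\<lambda>k. (N - k) div 2"])
    fix k assume k: "k \<in> {k \<in> X. odd k}"
    hence b: "1 \<le> k" "k < N" using assms by auto
    have "even (N - k)" using k b odd_N by simp
    hence "2 * ((N - k) div 2) = N - k" by simp
    hence e: "N - 2 * ((N - k) div 2) = k" "2 * ((N - k) div 2) < N" using b by simp_all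
    show "N - 2 * ((N - k) div 2) = k" by (rule e)
    show "(N - k) div 2 \<in> {k. 2 * k < N \<and> N - 2 * k \<in> X}" using e k by simp
    show "g (N - 2 * ((N - k) div 2)) = g k" unfolding e(1) ..
  next
    fix k assume "k \<in> {k. 2 * k < N \<and> N - 2 * k \<in> X}"
    thus "(N - (N - 2 * k)) div 2 = k" "N - 2 * k \<in> {k \<in> X. odd k}" using odd_N by auto
  qed
  finally show ?thesis .
qed

text \<open>The moment \<open>M = (\<Sum>k<N. k \<chi>(k))\<close> is evaluated twice in terms of \<open>S = (\<Sum>k\<le>H. \<chi>(k))\<close> and \<open>A = (\<Sum>k\<le>H. k \<chi>(k))\<close>:
pairing \<open>k\<close> with \<open>N - k\<close> gives \<open>M = 2 A - N S\<close>, splitting by parity gives \<open>M = \<chi>(2) (4 A - N S)\<close>. Eliminating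
\<open>A\<close> leaves \<open>N S = (\<chi>(2) - 2) M\<close>.\<close>

lemma chi_half_sum:
  defines "H \<equiv> (N - 1) div 2"
  shows "(\<Sum>k\<in>{1..H}. chi k) = (2 - chi 2) * int (card ideal_classes)"
proof -
  define S where "S = (\<Sum>k\<in>{1..H}. chi k)"
  define A where "A = (\<Sum>k\<in>{1..H}. int k * chi k)"
  define M where "M = (\<Sum>k<N. int k * chi k)"
  have NH: "N = 2 * H + 1" using odd_N unfolding H_def by presburger
  have H0: "H > 0" using N_gt NH by simp
  have M: "M = (\<Sum>k\<in>{1..<N}. int k * chi k)"
  proof -
    have "{..<N} = insert 0 {1..<N}" using N_gt by auto
    thus ?thesis by (simp add: M_def)
  qed
  have reflected: "(\<Sum>k\<in>{1..H}. int (N - k) * chi (N - k)) = A - int N * S"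
  proof -
    have "(\<Sum>k\<in>{1..H}. int (N - k) * chi (N - k)) = (\<Sum>k\<in>{1..H}. int k * chi k - int N * chi k)"
    proof (intro sum.cong refl)
      fix k assume "k \<in> {1..H}"
      hence "k \<le> N" using NH by simp
      thus "int (N - k) * chi (N - k) = int k * chi k - int N * chi k"
        by (simp add: chi_reflect of_nat_diff algebra_simps)
    qed
    thus ?thesis by (simp add: sum_subtractf A_def S_def sum_distrib_left)
  qed
  have "M = A + (\<Sum>k\<in>{H + 1..<N}. int k * chi k)"
  proof -
    have split: "{1..<N} = {1..H} \<union> {H + 1..<N}" using NH H0 by auto
    show ?thesis unfolding M A_def split by (rule sum.union_disjoint) auto
  qed
  also have "(\<Sum>k\<in>{H + 1..<N}. int k * chi k) = (\<Sum>k\<in>{1..H}. int (N - k) * chi (N - k))"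
    by (rule sum.reindex_bij_witness[of _ "\<lambda>k. N - k" "\<lambda>k. N - k"]) (use NH in auto)
  finally have M1: "M = 2 * A - int N * S" unfolding reflected by simp
  have sets: "{k. 2 * k \<in> {1..<N}} = {1..H}" "{k. 2 * k < N \<and> N - 2 * k \<in> {1..<N}} = {1..H}"
    using NH by auto
  have "M = (\<Sum>k\<in>{1..H}. int (2 * k) * chi (2 * k)) + (\<Sum>k\<in>{1..H}. int (N - 2 * k) * chi (N - 2 * k))"
    unfolding M using sum_even_odd[of "{1..<N}" "\<lambda>k. int k * chi k"] unfolding sets by simp
  also have "(\<Sum>k\<in>{1..H}. int (2 * k) * chi (2 * k)) = chi 2 * (2 * A)"
    unfolding A_def sum_distrib_left by (rule sum.cong) (auto simp: chi_mult)
  also have "(\<Sum>k\<in>{1..H}. int (N - 2 * k) * chi (N - 2 * k)) = (\<Sum>k\<in>{1..H}. chi 2 * (2 * (int k * chi k) - int N * chi k))"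
  proof (intro sum.cong refl)
    fix k assume "k \<in> {1..H}"
    hence "2 * k \<le> N" using NH by simp
    hence "chi (N - 2 * k) = - (chi 2 * chi k)" "int (N - 2 * k) = int N - 2 * int k"
      using chi_reflect[of "2 * k"] by (simp_all add: chi_mult of_nat_diff)
    thus "int (N - 2 * k) * chi (N - 2 * k) = chi 2 * (2 * (int k * chi k) - int N * chi k)"
      by (simp add: algebra_simps)
  qed
  also have "\<dots> = chi 2 * (2 * A - int N * S)"
    by (simp add: sum_distrib_left[symmetric] sum_subtractf A_def S_def)
  finally have M2: "M = chi 2 * (4 * A - int N * S)" by (simp add: algebra_simps)
  have c: "chi 2 = 1 \<or> chi 2 = -1" using Jacobi_two[OF odd_N] by (simp add: chi_def)
  have "int N * S = (2 - chi 2) * (- M)" using c M1 M2 by auto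
  also have "- M = int N * int (card ideal_classes)" using class_number_moment by (simp add: M_def)
  finally have "int N * S = int N * ((2 - chi 2) * int (card ideal_classes))" by simp
  thus ?thesis unfolding S_def[symmetric] by simp
qed

text \<open>In the half sum the even arguments \<open>2 k\<close> belong to \<open>k < N/4\<close>, and the odd arguments \<open>N - 2 k\<close> to
\<open>N/4 < k < N/2\<close>.\<close>

lemma chi_quarter_sums:
  defines "E0 \<equiv> \<Sum>k | 1 \<le> k \<and> 4 * k < N. chi k" and "E1 \<equiv> \<Sum>k | N < 4 * k \<and> 2 * k < N. chi k"
  shows "E0 + E1 = (2 - chi 2) * int (card ideal_classes)" "E0 + E1 = chi 2 * (E0 - E1)"
proof -
  let ?Q = "{k. 1 \<le> k \<and> 4 * k < N}" and ?R = "{k. N < 4 * k \<and> 2 * k < N}"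
  define H where "H = (N - 1) div 2"
  have NH: "N = 2 * H + 1" using odd_N unfolding H_def by presburger
  have fin: "finite ?Q" "finite ?R" by (rule finite_subset[of _ "{..N}"]; auto)+
  have split: "{1..H} = ?Q \<union> ?R"
  proof (rule Set.set_eqI)
    fix k show "k \<in> {1..H} \<longleftrightarrow> k \<in> ?Q \<union> ?R" using NH by simp presburger
  qed
  have S: "(\<Sum>k\<in>{1..H}. chi k) = E0 + E1"
    unfolding E0_def E1_def split by (rule sum.union_disjoint) (use fin in auto)
  thus "E0 + E1 = (2 - chi 2) * int (card ideal_classes)" using chi_half_sum by (simp add: H_def)
  have sets: "{k. 2 * k \<in> {1..H}} = ?Q" "{k. 2 * k < N \<and> N - 2 * k \<in> {1..H}} = ?R"
    using NH by auto
  have "(\<Sum>k\<in>{1..H}. chi k) = (\<Sum>k\<in>?Q. chi (2 * k)) + (\<Sum>k\<in>?R. chi (N - 2 * k))"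
    by (rule sum_even_odd[of "{1..H}" chi, unfolded sets]) (use NH in auto)
  also have "(\<Sum>k\<in>?Q. chi (2 * k)) = chi 2 * E0"
    by (simp add: E0_def sum_distrib_left chi_mult)
  also have "(\<Sum>k\<in>?R. chi (N - 2 * k)) = (\<Sum>k\<in>?R. - (chi 2 * chi k))"
    by (intro sum.cong refl) (simp add: chi_reflect chi_mult)
  also have "\<dots> = - (chi 2 * E1)"
    by (simp add: E1_def sum_distrib_left sum_negf)
  finally show "E0 + E1 = chi 2 * (E0 - E1)" unfolding S by (simp add: algebra_simps)
qed

text \<open>The terms that are not coprime to \<open>N\<close> vanish anyway.\<close>

lemma character_sum_eq:
  "character_sum (- int N) u v = (\<Sum>k | 1 \<le> k \<and> k \<le> N \<and> u < real k \<and> real k < v. chi k)"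
proof -
  have "(\<Sum>k | 1 \<le> k \<and> k \<le> N \<and> u < real k \<and> real k < v. chi k)
      = (\<Sum>x | 1 \<le> x \<and> x \<le> int N \<and> u < of_int x \<and> of_int x < v. Jacobi x N)"
    by (rule sum.reindex_bij_witness[of _ nat int]) (auto simp: chi_def)
  also have "\<dots> = (\<Sum>x | 1 \<le> x \<and> x \<le> int N \<and> coprime x (int N) \<and> u < of_int x \<and> of_int x < v. Jacobi x N)"
  proof (rule sum.mono_neutral_right)
    show "finite {x. 1 \<le> x \<and> x \<le> int N \<and> u < of_int x \<and> of_int x < v}"
      by (rule finite_subset[of _ "{1..int N}"]) auto
  qed (auto intro: Jacobi_eq_0)
  finally show ?thesis by (simp add: character_sum_def quadratic_character_def)
qed

end

theorem theorem4p1: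
  fixes D N h E0 E1 :: int
  assumes "squarefree D" and "D < -4" and "[D = 1] (mod 4)"
    and "N = \<bar>D\<bar>"
    and "h = int (class_number D)"
    and "E0 = character_sum D 0 (of_int N / 4)"
    and "E1 = character_sum D (of_int N / 4) (of_int N / 2)"
  shows "([N = 7] (mod 8) \<longrightarrow> E0 = h \<and> E1 = 0) \<and>
         ([N = 3] (mod 8) \<longrightarrow> E0 = 0 \<and> E1 = 3 * h)"
proof -
  define n where "n = nat N"
  have N: "N = int n" "D = - int n" using assms(2,4) by (auto simp: n_def)
  have n4: "n > 4" using assms(2) N by simp
  have mod4: "(int n + 1) mod 4 = 0" using assms(3) unfolding N cong_def by presburger
  define m where "m = (int n + 1) div 4"
  have m: "4 * m = int n + 1" using mod4 unfolding m_def by presburger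
  have sqf: "squarefree n"
  proof (rule squarefreeI)
    fix x assume "x ^ 2 dvd n"
    hence "int x ^ 2 dvd D" unfolding N by (metis dvd_minus_iff int_dvd_int_iff of_nat_power)
    hence "int x dvd 1" using assms(1) by (rule squarefreeD[rotated])
    thus "x dvd 1" by simp
  qed
  interpret imag_quadratic n m
    by unfold_locales (fact m sqf n4)+
  have h: "h = int (card ideal_classes)" unfolding assms(5) N class_number_eq ..
  have E0: "E0 = (\<Sum>k | 1 \<le> k \<and> 4 * k < n. chi k)"
    unfolding assms(6) N character_sum_eq by (rule sum.cong) auto
  have E1: "E1 = (\<Sum>k | n < 4 * k \<and> 2 * k < n. chi k)"
    unfolding assms(7) N character_sum_eq by (rule sum.cong) auto
  note sums = chi_quarter_sums[folded E0 E1 h]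
  have c: "chi 2 = (if n mod 8 = 1 \<or> n mod 8 = 7 then 1 else -1)"
    using Jacobi_two[OF odd_N] by (simp add: chi_def)
  have e: "int n mod 8 = int (n mod 8)" "(7::int) mod 8 = 7" "(3::int) mod 8 = 3" by (simp_all add: zmod_int)
  have md: "[N = 7] (mod 8) \<longleftrightarrow> n mod 8 = 7" "[N = 3] (mod 8) \<longleftrightarrow> n mod 8 = 3"
    unfolding N cong_def e by linarith+
  show ?thesis
  proof (intro conjI impI)
    assume "[N = 7] (mod 8)"
    hence "chi 2 = 1" unfolding md c by simp
    thus "E0 = h" "E1 = 0" using sums by auto
  next
    assume "[N = 3] (mod 8)"
    hence "chi 2 = -1" unfolding md c by simp
    thus "E0 = 0" "E1 = 3 * h" using sums by auto
  qed
qed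

end
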